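(* Let $0\le T_0<T_1\le+\infty$ and let $\Gamma$ be a network with Hamiltonians $\{H_\gamma\}$ as described in the context. For any continuous initial datum $g:\Gamma\to\mathbb{R}$ and any flux limiter $x\mapsto c_x$, there exists one and only one continuous solution $u:\Gamma\times[T_0,T_1)\to\mathbb{R}$ of (HJ$\Gamma$) in $(T_0,T_1)$ with $u(\cdot,T_0)=g$. This solution is in addition uniformly continuous in $\Gamma\times[T_0,T_1)$. If $g$ is Lipschitz continuous, the solution is Lipschitz continuous as well.
   Context: Network. $\Gamma=\bigcup_{\gamma\in\mathcal{E}}\gamma([0,1])\subset\mathbb{R}^N$, where $\mathcal{E}$ is a finite collection of arcs, i.e. simple $C^1$ curves $\gamma:[0,1]\to\mathbb{R}^N$ with nonvanishing derivative. Together with each arc $\gamma$ one also considers its inverse arc $-\gamma(s)=\gamma(1-s)$ (so the collection of arcs is regarded as closed under inversion). It is assumed that $\gamma((0,1))\cap\gamma'([0,1])=\emptyset$ whenever $\gamma'\ne\gamma$, $\gamma'\neq-\gamma$. Vertices are the initial and terminal points of arcs; $\mathbf{V}$ is the set of vertices. The network is connected (any two vertices are linked by a finite concatenation of arcs) and has no loops ($\gamma(0)\ne\gamma(1)$ for every arc). For $x\in\mathbf{V}$, $\Gamma_x=\{\gamma : \gamma(1)=x\}$. Lipschitz continuity on $\Gamma$ (or $\Gamma\times[T_0,T_1)$) is understood along arcs: a continuous function $g$ on $\Gamma$ (resp. $u$ on $\Gamma\times[T_0,T_1)$) is Lipschitz if $g\circ\gamma$ (resp. $u\circ\gamma$) is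 Lipschitz on $[0,1]$ (resp. on $[0,1]\times[T_0,T_1)$) for every arc $\gamma$. Hamiltonians. For each arc $\gamma$ a function $H_\gamma:[0,1]\times\mathbb{R}\to\mathbb{R}$ is given, with $H_{-\gamma}(s,p)=H_\gamma(1-s,-p)$. Each $H_\gamma$ is continuous in $(s,p)$, convex in $p$, coercive in $p$ uniformly in $s$, and for every $M>0$ there is $C_M$ with $H_\gamma(s,p)-H_\gamma(s,q)\le C_M|p-q|$ for all $s\in[0,1]$, $p,q\in(-M,M)$. Set $c_\gamma=-\max_{s\in[0,1]}\min_{p\in\mathbb{R}}H_\gamma(s,p)$. A flux limiter is a function $x\mapsto c_x$ from $\mathbf{V}$ to $\mathbb{R}$ with $c_x\le\min_{\gamma\in\Gamma_x}c_\gamma$ for all $x$. Equation. For $v:\Gamma\times[T_0,T_1)\to\mathbb{R}$ put $(v\circ\gamma)(s,t)=v(\gamma(s),t)$; $'$ denotes the derivative in $s$ and subscript $t$ that in $t$. (HJ$_\gamma$) is $w_t+H_\gamma(s,w')=0$ in $(0,1)\times(T_0,T_1)$. A subtangent (resp. supertangent) to a function at a point is a $C^1$ function $\varphi$ such that (function $-\varphi$) has a local minimum (resp. maximum) at that point; it is constrained to a closed set $C$ if the point is a minimizer (resp. maximizer) only relative to a neighborhood of it intersected with $C$. A continuous $v:\Gamma\times[T_0,T_1)\to\mathbb{R}$ is a supersolution of (HJ$\Gamma$) in $(T_0,T_1)$ if (i) $v\circ\gamma$ is a viscosity supersolution of (HJ$_\gamma$) for every arc $\gamma$; (ii) for every $x\in\mathbf{V}$,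 $t_0\in(T_0,T_1)$: if some $C^1$ subtangent $\phi$ to $v(x,\cdot)$ at $t_0$ satisfies $\frac{d}{dt}\phi(t_0)<c_x$, then there is an arc $\gamma\in\Gamma_x$ such that all $C^1$ subtangents $\varphi$, constrained to $[0,1]\times\overline{(T_0,T_1)}$, to $v\circ\gamma$ at $(1,t_0)$ satisfy $\varphi_t(1,t_0)+H_\gamma(1,\varphi'(1,t_0))\ge0$. It is a subsolution of (HJ$\Gamma$) in $(T_0,T_1)$ if (i) $v\circ\gamma$ is a viscosity subsolution of (HJ$_\gamma$) for every arc $\gamma$; (ii) for every $x\in\mathbf{V}$, $t_0\in(T_0,T_1)$, all $C^1$ supertangents $\psi$ to $v(x,\cdot)$ at $t_0$ satisfy $\frac{d}{dt}\psi(t_0)\le c_x$. A solution is a continuous function that is both a subsolution and a supersolution. *)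

theory Defs
  imports "HOL-Analysis.Analysis"
begin

text \<open>
  An arc is a total function on the reals of which only the restriction to the unit interval
  matters, and its inverse arc is its \<^const>\<open>reversepath\<close>. Two members of \<open>E\<close> that agree on
  the unit interval are the same function, by the disjointness assumption of the locale below.
\<close>

text \<open>At the end points of the unit interval the derivative is one-sided.\<close>

definition regular_C1_curve :: "(real \<Rightarrow> 'a::real_normed_vector) \<Rightarrow> bool" where
  "regular_C1_curve \<gamma> \<longleftrightarrow>
     (\<exists>\<gamma>'. continuous_on {0..1} \<gamma>' \<and>
        (\<forall>s\<in>{0..1}. (\<gamma> has_vector_derivative \<gamma>' s) (at s within {0..1}) \<and> \<gamma>' s \<noteq> 0))"

definition network_set :: "(real \<Rightarrow> 'a) set \<Rightarrow> 'a::topological_space set" where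
  "network_set E = (\<Union>\<gamma>\<in>E. path_image \<gamma>)"

definition vertices :: "(real \<Rightarrow> 'a) set \<Rightarrow> 'a::topological_space set" where
  "vertices E = pathstart ` E \<union> pathfinish ` E"

definition arcs_into :: "(real \<Rightarrow> 'a) set \<Rightarrow> 'a::topological_space \<Rightarrow> (real \<Rightarrow> 'a) set" where
  "arcs_into E x = {\<gamma>\<in>E. pathfinish \<gamma> = x}"

locale network =
  fixes E :: "(real \<Rightarrow> 'a::euclidean_space) set"
  assumes finite_arcs: "finite E"
    and simple_arc: "\<gamma> \<in> E \<Longrightarrow> simple_path \<gamma>"
    and regular_arc: "\<gamma> \<in> E \<Longrightarrow> regular_C1_curve \<gamma>"
    and inverse_arc: "\<gamma> \<in> E \<Longrightarrow> reversepath \<gamma> \<in> E"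
    and disjoint_arcs: "\<lbrakk>\<gamma> \<in> E; \<gamma>' \<in> E; \<gamma>' \<noteq> \<gamma>; \<gamma>' \<noteq> reversepath \<gamma>\<rbrakk>
           \<Longrightarrow> \<gamma> ` {0<..<1} \<inter> \<gamma>' ` {0..1} = {}"
    and connected_network: "\<lbrakk>x \<in> vertices E; y \<in> vertices E\<rbrakk>
           \<Longrightarrow> (x, y) \<in> ((\<lambda>\<gamma>. (pathstart \<gamma>, pathfinish \<gamma>)) ` E)\<^sup>*"
    and no_loops: "\<gamma> \<in> E \<Longrightarrow> pathstart \<gamma> \<noteq> pathfinish \<gamma>"

locale network_hamiltonians = network E
  for E :: "(real \<Rightarrow> 'a::euclidean_space) set" +
  fixes H :: "(real \<Rightarrow> 'a) \<Rightarrow> real \<Rightarrow> real \<Rightarrow> real"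
  assumes H_inverse: "\<lbrakk>\<gamma> \<in> E; s \<in> {0..1}\<rbrakk> \<Longrightarrow> H (reversepath \<gamma>) s p = H \<gamma> (1 - s) (- p)"
    and H_continuous: "\<gamma> \<in> E \<Longrightarrow> continuous_on ({0..1} \<times> UNIV) (\<lambda>(s, p). H \<gamma> s p)"
    and H_convex: "\<lbrakk>\<gamma> \<in> E; s \<in> {0..1}\<rbrakk> \<Longrightarrow> convex_on UNIV (H \<gamma> s)"
    and H_coercive: "\<gamma> \<in> E \<Longrightarrow> \<forall>\<^sub>F p in at_infinity. \<forall>s\<in>{0..1}. K \<le> H \<gamma> s p"
    and H_locally_Lipschitz: "\<lbrakk>\<gamma> \<in> E; M > 0\<rbrakk>
           \<Longrightarrow> \<exists>C. \<forall>s\<in>{0..1}. \<forall>p\<in>{-M<..<M}. \<forall>q\<in>{-M<..<M}.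
                 H \<gamma> s p - H \<gamma> s q \<le> C * \<bar>p - q\<bar>"

text \<open>
  Under the assumptions on the Hamiltonians the supremum and the infimum are attained, i.e. they
  are a maximum and a minimum.
\<close>

definition arc_constant :: "('b \<Rightarrow> real \<Rightarrow> real \<Rightarrow> real) \<Rightarrow> 'b \<Rightarrow> real" where
  "arc_constant H \<gamma> = - (SUP s\<in>{0..1}. INF p. H \<gamma> s p)"

definition flux_limiter ::
  "(real \<Rightarrow> 'a::topological_space) set \<Rightarrow> ((real \<Rightarrow> 'a) \<Rightarrow> real \<Rightarrow> real \<Rightarrow> real) \<Rightarrow> ('a \<Rightarrow> real) \<Rightarrow> bool"
where
  "flux_limiter E H c \<longleftrightarrow> (\<forall>x\<in>vertices E. c x \<le> Min (arc_constant H ` arcs_into E x))"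

definition C1_near :: "('b::real_normed_vector \<Rightarrow> real) \<Rightarrow> 'b \<Rightarrow> bool" where
  "C1_near \<phi> z \<longleftrightarrow>
     (\<exists>U D. open U \<and> z \<in> U \<and> continuous_on U D \<and>
        (\<forall>y\<in>U. (\<phi> has_derivative blinfun_apply (D y)) (at y)))"

text \<open>
  Tangents constrained to \<open>C\<close>; the unconstrained notions are those with \<open>C = UNIV\<close>. Only the
  comparison with \<open>w\<close> is restricted to \<open>C\<close>: the test function is continuously differentiable on a full
  neighbourhood of the contact point, so its two-sided partial derivatives exist on the boundary
  of \<open>C\<close> as well.
\<close>

definition subtangent ::
  "'b::real_normed_vector set \<Rightarrow> ('b \<Rightarrow> real) \<Rightarrow> 'b \<Rightarrow> ('b \<Rightarrow> real) \<Rightarrow> bool" where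
  "subtangent C w z \<phi> \<longleftrightarrow> C1_near \<phi> z \<and> (\<forall>\<^sub>F y in at z within C. w z - \<phi> z \<le> w y - \<phi> y)"

definition supertangent ::
  "'b::real_normed_vector set \<Rightarrow> ('b \<Rightarrow> real) \<Rightarrow> 'b \<Rightarrow> ('b \<Rightarrow> real) \<Rightarrow> bool" where
  "supertangent C w z \<phi> \<longleftrightarrow> C1_near \<phi> z \<and> (\<forall>\<^sub>F y in at z within C. w y - \<phi> y \<le> w z - \<phi> z)"

definition partial_s :: "(real \<times> real \<Rightarrow> real) \<Rightarrow> real \<times> real \<Rightarrow> real" where
  "partial_s \<phi> z = deriv (\<lambda>s. \<phi> (s, snd z)) (fst z)"

definition partial_t :: "(real \<times> real \<Rightarrow> real) \<Rightarrow> real \<times> real \<Rightarrow> real" where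
  "partial_t \<phi> z = deriv (\<lambda>t. \<phi> (fst z, t)) (snd z)"

definition open_times :: "real \<Rightarrow> ereal \<Rightarrow> real set" where
  "open_times T0 T1 = {t. T0 < t \<and> ereal t < T1}"

definition times_from :: "real \<Rightarrow> ereal \<Rightarrow> real set" where
  "times_from T0 T1 = {t. T0 \<le> t \<and> ereal t < T1}"

definition along :: "('a \<times> real \<Rightarrow> real) \<Rightarrow> (real \<Rightarrow> 'a) \<Rightarrow> real \<times> real \<Rightarrow> real" where
  "along v \<gamma> = (\<lambda>(s, t). v (\<gamma> s, t))"

text \<open>
  Viscosity sub- and supersolutions of \<open>w\<^sub>t + h(s, w') = 0\<close> in \<open>(0,1) \<times> (T0,T1)\<close>.
\<close>

definition viscosity_supersolution ::
  "real \<Rightarrow> ereal \<Rightarrow> (real \<Rightarrow> real \<Rightarrow> real) \<Rightarrow> (real \<times> real \<Rightarrow> real) \<Rightarrow> bool" where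
  "viscosity_supersolution T0 T1 h w \<longleftrightarrow>
     continuous_on ({0<..<1} \<times> open_times T0 T1) w \<and>
     (\<forall>s\<in>{0<..<1}. \<forall>t\<in>open_times T0 T1. \<forall>\<phi>. subtangent UNIV w (s, t) \<phi> \<longrightarrow>
        partial_t \<phi> (s, t) + h s (partial_s \<phi> (s, t)) \<ge> 0)"

definition viscosity_subsolution ::
  "real \<Rightarrow> ereal \<Rightarrow> (real \<Rightarrow> real \<Rightarrow> real) \<Rightarrow> (real \<times> real \<Rightarrow> real) \<Rightarrow> bool" where
  "viscosity_subsolution T0 T1 h w \<longleftrightarrow>
     continuous_on ({0<..<1} \<times> open_times T0 T1) w \<and>
     (\<forall>s\<in>{0<..<1}. \<forall>t\<in>open_times T0 T1. \<forall>\<psi>. supertangent UNIV w (s, t) \<psi> \<longrightarrow>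
        partial_t \<psi> (s, t) + h s (partial_s \<psi> (s, t)) \<le> 0)"

definition HJ_supersolution ::
  "(real \<Rightarrow> 'a::euclidean_space) set \<Rightarrow> ((real \<Rightarrow> 'a) \<Rightarrow> real \<Rightarrow> real \<Rightarrow> real) \<Rightarrow> ('a \<Rightarrow> real)
     \<Rightarrow> real \<Rightarrow> ereal \<Rightarrow> ('a \<times> real \<Rightarrow> real) \<Rightarrow> bool" where
  "HJ_supersolution E H c T0 T1 v \<longleftrightarrow>
     continuous_on (network_set E \<times> times_from T0 T1) v \<and>
     (\<forall>\<gamma>\<in>E. viscosity_supersolution T0 T1 (H \<gamma>) (along v \<gamma>)) \<and>
     (\<forall>x\<in>vertices E. \<forall>t0\<in>open_times T0 T1.
        (\<exists>\<phi>. subtangent UNIV (\<lambda>t. v (x, t)) t0 \<phi> \<and> deriv \<phi> t0 < c x) \<longrightarrow>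
        (\<exists>\<gamma>\<in>arcs_into E x. \<forall>\<phi>.
           subtangent ({0..1} \<times> closure (open_times T0 T1)) (along v \<gamma>) (1, t0) \<phi> \<longrightarrow>
             partial_t \<phi> (1, t0) + H \<gamma> 1 (partial_s \<phi> (1, t0)) \<ge> 0))"

definition HJ_subsolution ::
  "(real \<Rightarrow> 'a::euclidean_space) set \<Rightarrow> ((real \<Rightarrow> 'a) \<Rightarrow> real \<Rightarrow> real \<Rightarrow> real) \<Rightarrow> ('a \<Rightarrow> real)
     \<Rightarrow> real \<Rightarrow> ereal \<Rightarrow> ('a \<times> real \<Rightarrow> real) \<Rightarrow> bool" where
  "HJ_subsolution E H c T0 T1 v \<longleftrightarrow>
     continuous_on (network_set E \<times> times_from T0 T1) v \<and>
     (\<forall>\<gamma>\<in>E. viscosity_subsolution T0 T1 (H \<gamma>) (along v \<gamma>)) \<and>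
     (\<forall>x\<in>vertices E. \<forall>t0\<in>open_times T0 T1.
        \<forall>\<psi>. supertangent UNIV (\<lambda>t. v (x, t)) t0 \<psi> \<longrightarrow> deriv \<psi> t0 \<le> c x)"

definition HJ_solution ::
  "(real \<Rightarrow> 'a::euclidean_space) set \<Rightarrow> ((real \<Rightarrow> 'a) \<Rightarrow> real \<Rightarrow> real \<Rightarrow> real) \<Rightarrow> ('a \<Rightarrow> real)
     \<Rightarrow> real \<Rightarrow> ereal \<Rightarrow> ('a \<times> real \<Rightarrow> real) \<Rightarrow> bool" where
  "HJ_solution E H c T0 T1 v \<longleftrightarrow>
     HJ_subsolution E H c T0 T1 v \<and> HJ_supersolution E H c T0 T1 v"

definition HJ_solution_from ::
  "(real \<Rightarrow> 'a::euclidean_space) set \<Rightarrow> ((real \<Rightarrow> 'a) \<Rightarrow> real \<Rightarrow> real \<Rightarrow> real) \<Rightarrow> ('a \<Rightarrow> real)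
     \<Rightarrow> real \<Rightarrow> ereal \<Rightarrow> ('a \<Rightarrow> real) \<Rightarrow> ('a \<times> real \<Rightarrow> real) \<Rightarrow> bool" where
  "HJ_solution_from E H c T0 T1 g v \<longleftrightarrow>
     HJ_solution E H c T0 T1 v \<and> (\<forall>x\<in>network_set E. v (x, T0) = g x)"

definition Lipschitz_on_network :: "(real \<Rightarrow> 'a::topological_space) set \<Rightarrow> ('a \<Rightarrow> real) \<Rightarrow> bool" where
  "Lipschitz_on_network E g \<longleftrightarrow>
     continuous_on (network_set E) g \<and> (\<forall>\<gamma>\<in>E. \<exists>L. L-lipschitz_on {0..1} (g \<circ> \<gamma>))"

definition Lipschitz_on_network_times ::
  "(real \<Rightarrow> 'a::topological_space) set \<Rightarrow> real \<Rightarrow> ereal \<Rightarrow> ('a \<times> real \<Rightarrow> real) \<Rightarrow> bool" where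
  "Lipschitz_on_network_times E T0 T1 u \<longleftrightarrow>
     continuous_on (network_set E \<times> times_from T0 T1) u \<and>
     (\<forall>\<gamma>\<in>E. \<exists>L. L-lipschitz_on ({0..1} \<times> times_from T0 T1) (along u \<gamma>))"

end

theory Submission
  imports Defs
begin

text \<open>
  The solution is the largest subsolution lying below the initial datum. Coercivity turns the
  subsolution inequality into \<open>w(\<gamma>(s'), t + h) \<le> w(\<gamma>(s), t) + C h\<close> for \<open>\<bar>s' - s\<bar> \<le> \<kappa> h\<close>; for
  Lipschitz data, gluing a subsolution shifted in time to \<open>g - K (t - T0)\<close> gives the opposite
  estimate in time, so that the supremum is Lipschitz continuous. General data are approximated
  uniformly. The supremum is a supersolution because it cannot be exceeded by a bump.

  Comparison is obtained by doubling the time variable only. At a vertex the maximum point yields a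
  time slope \<open>a \<le> c x\<close> for the subsolution; transporting the subsolution along the arc with the
  speed \<open>q > 0\<close> of a subgradient of \<open>H\<close> at a point \<open>P\<close> of the level slightly above \<open>-a\<close> shows that \<open>P\<close> is
  the space slope of a constrained subtangent to the supersolution, which violates the
  supersolution condition. At an interior point of an arc the space variable is doubled as well.
\<close>

section \<open>Test functions and tangents\<close>

text \<open>Doubling the space variable is of no use at a vertex: the two points may lie on
  different arcs, and the subsolution condition there speaks of time slopes only. With time doubled
  alone the slopes for \<open>u\<close> and \<open>v\<close> are \<open>a\<close> and
  \<open>a - l\<close>, where \<open>l > 0\<close> is the slope of a barrier in time; hence
  \<open>a - l < c x\<close>, and the supersolution condition supplies an arc to work on. The flux
  bound puts the level slightly above \<open>- a\<close> strictly above the minimum of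
  \<open>H \<gamma> 1\<close>; on the increasing branch the subgradient \<open>q\<close> is
  positive, so the characteristic runs along the arc into the vertex.

  The price is that the subsolution must be Lipschitz along arcs. So only the supremum for a
  Lipschitz datum is compared with arbitrary supersolutions. This suffices: every solution belongs
  to the class whose supremum is taken, so one inequality of uniqueness is maximality, and the other
  follows by lowering the datum slightly to a Lipschitz one.

  The time interval is open at \<open>T1\<close>; a barrier that becomes large before some
  \<open>S < T1\<close> keeps maxima away from the final time.\<close>

lemma C1_near_const [simp]: "C1_near (\<lambda>_. k) z"
  unfolding C1_near_def
  by (rule exI[of _ UNIV], rule exI[of _ "\<lambda>_. 0"])
    (auto intro!: derivative_eq_intros)

lemma C1_near_bounded_linear:
  assumes "bounded_linear f"
  shows "C1_near f z"
  unfolding C1_near_def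
  by (rule exI[of _ UNIV], rule exI[of _ "\<lambda>_. Blinfun f"])
    (auto simp: bounded_linear_Blinfun_apply assms bounded_linear_imp_has_derivative)

lemma C1_near_fst [simp]: "C1_near (fst :: real \<times> real \<Rightarrow> real) z"
  by (rule C1_near_bounded_linear[OF bounded_linear_fst])

lemma C1_near_snd [simp]: "C1_near (snd :: real \<times> real \<Rightarrow> real) z"
  by (rule C1_near_bounded_linear[OF bounded_linear_snd])

lemma C1_near_ident [simp]: "C1_near (\<lambda>x::real. x) z"
  by (rule C1_near_bounded_linear[OF bounded_linear_ident])

lemma C1_near_add [intro]:
  assumes "C1_near f z" "C1_near g z"
  shows "C1_near (\<lambda>y. f y + g y) z"
proof -
  obtain U D where U: "open U" "z \<in> U" "continuous_on U D"
    "\<And>y. y \<in> U \<Longrightarrow> (f has_derivative blinfun_apply (D y)) (at y)"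
    using assms(1) unfolding C1_near_def by blast
  obtain V F where V: "open V" "z \<in> V" "continuous_on V F"
    "\<And>y. y \<in> V \<Longrightarrow> (g has_derivative blinfun_apply (F y)) (at y)"
    using assms(2) unfolding C1_near_def by blast
  have "continuous_on (U \<inter> V) (\<lambda>y. D y + F y)"
    using U(3) V(3) by (intro continuous_intros) (auto intro: continuous_on_subset)
  moreover have "((\<lambda>y. f y + g y) has_derivative blinfun_apply (D y + F y)) (at y)"
    if "y \<in> U \<inter> V" for y
    using has_derivative_add[OF U(4) V(4)] that by (auto simp: blinfun.add_left[abs_def])
  ultimately show ?thesis
    unfolding C1_near_def using U(1,2) V(1,2)
    by (intro exI[of _ "U \<inter> V"] exI[of _ "\<lambda>y. D y + F y"]) auto
qed

lemma C1_near_mult [intro]: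
  assumes "C1_near f z" "C1_near g z"
  shows "C1_near (\<lambda>y. f y * g y) z"
proof -
  obtain U D where U: "open U" "z \<in> U" "continuous_on U D"
    "\<And>y. y \<in> U \<Longrightarrow> (f has_derivative blinfun_apply (D y)) (at y)"
    using assms(1) unfolding C1_near_def by blast
  obtain V F where V: "open V" "z \<in> V" "continuous_on V F"
    "\<And>y. y \<in> V \<Longrightarrow> (g has_derivative blinfun_apply (F y)) (at y)"
    using assms(2) unfolding C1_near_def by blast
  have f: "continuous_on U f"
    by (rule continuous_at_imp_continuous_on) (use U(4) has_derivative_continuous in blast)
  have g: "continuous_on V g"
    by (rule continuous_at_imp_continuous_on) (use V(4) has_derivative_continuous in blast)
  have "continuous_on (U \<inter> V) (\<lambda>y. f y *\<^sub>R F y + g y *\<^sub>R D y)"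
    using U(3) V(3) f g by (intro continuous_intros) (auto intro: continuous_on_subset)
  moreover have "((\<lambda>y. f y * g y) has_derivative blinfun_apply (f y *\<^sub>R F y + g y *\<^sub>R D y)) (at y)"
    if "y \<in> U \<inter> V" for y
    using has_derivative_mult[OF U(4) V(4)] that
    by (auto simp: blinfun.add_left[abs_def] blinfun.scaleR_left[abs_def] mult.commute)
  ultimately show ?thesis
    unfolding C1_near_def using U(1,2) V(1,2)
    by (intro exI[of _ "U \<inter> V"] exI[of _ "\<lambda>y. f y *\<^sub>R F y + g y *\<^sub>R D y"]) auto
qed

lemma C1_near_minus [intro]: "C1_near f z \<Longrightarrow> C1_near (\<lambda>y. - f y) z"
  using C1_near_mult[OF C1_near_const[of "-1" z], of f] by simp

lemma C1_near_diff [intro]: "C1_near f z \<Longrightarrow> C1_near g z \<Longrightarrow> C1_near (\<lambda>y. f y - g y) z"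
  using C1_near_add[OF _ C1_near_minus, of f z g] by simp

lemma C1_near_divide [intro]: "C1_near f z \<Longrightarrow> C1_near (\<lambda>y. f y / k) z"
  using C1_near_mult[OF _ C1_near_const[of "inverse k" z], of f] by (simp add: field_simps)

lemma C1_near_power [intro]: "C1_near f z \<Longrightarrow> C1_near (\<lambda>y. f y ^ n) z"
  by (induction n) auto

lemma C1_near_compose_affine:
  assumes A: "bounded_linear A" and f: "C1_near f (A z + k)"
  shows "C1_near (\<lambda>y. f (A y + k)) z"
proof -
  obtain U D where U: "open U" "A z + k \<in> U" "continuous_on U D"
    "\<And>y. y \<in> U \<Longrightarrow> (f has_derivative blinfun_apply (D y)) (at y)"
    using f unfolding C1_near_def by blast
  have cont: "continuous_on B (\<lambda>y. A y + k)" for B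
    by (intro continuous_intros bounded_linear.continuous_on[OF A] continuous_on_id)
  let ?V = "(\<lambda>y. A y + k) -` U" and ?D = "\<lambda>y. D (A y + k) o\<^sub>L Blinfun A"
  have "open ?V" by (rule open_vimage[OF U(1) cont])
  moreover have "continuous_on ?V ?D"
    by (intro bounded_bilinear.continuous_on[OF bounded_bilinear_blinfun_compose]
        continuous_on_compose2[OF U(3) cont] continuous_on_const) auto
  moreover have "((\<lambda>y. f (A y + k)) has_derivative blinfun_apply (?D y)) (at y)"
    if "y \<in> ?V" for y
  proof -
    have "((\<lambda>y. A y + k) has_derivative A) (at y)"
      using bounded_linear_imp_has_derivative[OF A] by (auto intro!: derivative_eq_intros)
    from has_derivative_compose[OF this, of f] U(4)[of "A y + k"] that
    have "((\<lambda>y. f (A y + k)) has_derivative (\<lambda>h. blinfun_apply (D (A y + k)) (A h))) (at y)" by auto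
    then show ?thesis
      by (rule has_derivative_eq_rhs) (simp add: fun_eq_iff bounded_linear_Blinfun_apply[OF A])
  qed
  ultimately show ?thesis
    unfolding C1_near_def using U(2) by (intro exI[of _ ?V] exI[of _ ?D]) auto
qed

lemma C1_near_dist_sq:
  fixes z :: "'b::real_inner"
  shows "C1_near (\<lambda>y. (dist y z)\<^sup>2) x"
proof -
  have 1: "continuous_on UNIV (\<lambda>y. blinfun_inner_left (2 *\<^sub>R (y - z)) :: 'b \<Rightarrow>\<^sub>L real)"
    by (intro bounded_linear.continuous_on[OF bounded_linear_blinfun_inner_left] continuous_intros)
  have 2: "((\<lambda>y. (dist y z)\<^sup>2) has_derivative blinfun_apply (blinfun_inner_left (2 *\<^sub>R (y - z)))) (at y)"
    for y :: 'b
  proof -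
    have "((\<lambda>y. inner (y - z) (y - z)) has_derivative (\<lambda>h. inner (y - z) h + inner h (y - z))) (at y)"
      by (auto intro!: derivative_eq_intros)
    moreover have "(\<lambda>h. inner (y - z) h + inner h (y - z))
        = blinfun_apply (blinfun_inner_left (2 *\<^sub>R (y - z)))"
      by (auto simp: inner_commute)
    ultimately show ?thesis by (simp add: dist_norm power2_norm_eq_inner)
  qed
  show ?thesis unfolding C1_near_def using 1 2 by blast
qed

lemma C1_near_nearby:
  assumes "C1_near f z"
  obtains U where "open U" "z \<in> U" "\<And>y. y \<in> U \<Longrightarrow> C1_near f y" "continuous_on U f"
proof -
  obtain U D where U: "open U" "z \<in> U" "continuous_on U D"
    "\<And>y. y \<in> U \<Longrightarrow> (f has_derivative blinfun_apply (D y)) (at y)"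
    using assms unfolding C1_near_def by blast
  have "continuous_on U f"
    by (rule continuous_at_imp_continuous_on) (use U(4) has_derivative_continuous in blast)
  moreover have "C1_near f y" if "y \<in> U" for y
    using that U unfolding C1_near_def by blast
  ultimately show thesis by (rule that[OF U(1,2), rotated])
qed

section \<open>Partial derivatives of test functions\<close>

lemma has_derivative_partials:
  assumes "(\<phi> has_derivative D) (at (s, t))"
  shows "((\<lambda>s. \<phi> (s, t)) has_real_derivative D (1, 0)) (at s)"
    and "((\<lambda>t. \<phi> (s, t)) has_real_derivative D (0, 1)) (at t)"
proof -
  have lin: "linear D" using assms has_derivative_linear by blast
  have "((\<lambda>s. (s, t)) has_derivative (\<lambda>h. (h, 0))) (at s)"
    by (auto intro!: derivative_eq_intros)
  from has_derivative_compose[OF this, of \<phi> D] assms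
  have "((\<lambda>s. \<phi> (s, t)) has_derivative (\<lambda>h. D (h, 0))) (at s)" by simp
  moreover have "D (h, 0) = D (1, 0) * h" for h
    using linear_scale[OF lin, of h "(1, 0)"] by (simp add: mult.commute)
  ultimately show "((\<lambda>s. \<phi> (s, t)) has_real_derivative D (1, 0)) (at s)"
    unfolding has_field_derivative_def by (blast intro: has_derivative_eq_rhs)
  have "((\<lambda>t. (s, t)) has_derivative (\<lambda>h. (0, h))) (at t)"
    by (auto intro!: derivative_eq_intros)
  from has_derivative_compose[OF this, of \<phi> D] assms
  have "((\<lambda>t. \<phi> (s, t)) has_derivative (\<lambda>h. D (0, h))) (at t)" by simp
  moreover have "D (0, h) = D (0, 1) * h" for h
    using linear_scale[OF lin, of h "(0, 1)"] by (simp add: mult.commute)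
  ultimately show "((\<lambda>t. \<phi> (s, t)) has_real_derivative D (0, 1)) (at t)"
    unfolding has_field_derivative_def by (blast intro: has_derivative_eq_rhs)
qed

lemma partials_eq:
  assumes "(\<phi> has_derivative D) (at (s, t))"
  shows "partial_s \<phi> (s, t) = D (1, 0)" "partial_t \<phi> (s, t) = D (0, 1)"
  using has_derivative_partials[OF assms] unfolding partial_s_def partial_t_def
  by (auto intro: DERIV_imp_deriv)

lemma C1_near_has_partials:
  assumes "C1_near \<phi> (s, t)"
  shows "((\<lambda>s. \<phi> (s, t)) has_real_derivative partial_s \<phi> (s, t)) (at s)"
    and "((\<lambda>t. \<phi> (s, t)) has_real_derivative partial_t \<phi> (s, t)) (at t)"
    and "(\<phi> has_derivative (\<lambda>h. partial_s \<phi> (s, t) * fst h + partial_t \<phi> (s, t) * snd h)) (at (s, t))"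
proof -
  obtain D where D: "(\<phi> has_derivative D) (at (s, t))"
    using assms unfolding C1_near_def by blast
  show "((\<lambda>s. \<phi> (s, t)) has_real_derivative partial_s \<phi> (s, t)) (at s)"
    and "((\<lambda>t. \<phi> (s, t)) has_real_derivative partial_t \<phi> (s, t)) (at t)"
    using has_derivative_partials[OF D] partials_eq[OF D] by auto
  have lin: "linear D" using D has_derivative_linear by blast
  have "D h = D (1, 0) * fst h + D (0, 1) * snd h" for h
  proof -
    have "h = fst h *\<^sub>R (1, 0) + snd h *\<^sub>R (0, 1)" by (cases h) auto
    then have "D h = fst h *\<^sub>R D (1, 0) + snd h *\<^sub>R D (0, 1)"
      by (metis linear_add[OF lin] linear_scale[OF lin])
    then show ?thesis by (simp add: mult.commute)
  qed
  then show "(\<phi> has_derivative (\<lambda>h. partial_s \<phi> (s, t) * fst h + partial_t \<phi> (s, t) * snd h)) (at (s, t))"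
    unfolding partials_eq[OF D] by (intro has_derivative_eq_rhs[OF D] ext)
qed

lemma C1_near_continuous_partials:
  assumes "C1_near \<phi> z"
  shows "isCont (partial_s \<phi>) z" "isCont (partial_t \<phi>) z"
proof -
  obtain U D where U: "open U" "z \<in> U" "continuous_on U D"
    "\<And>y. y \<in> U \<Longrightarrow> (\<phi> has_derivative blinfun_apply (D y)) (at y)"
    using assms unfolding C1_near_def by blast
  have "continuous_on U (\<lambda>y. blinfun_apply (D y) (1, 0))" "continuous_on U (\<lambda>y. blinfun_apply (D y) (0, 1))"
    using U(3) by (auto intro!: continuous_intros)
  moreover have "partial_s \<phi> y = blinfun_apply (D y) (1, 0)" "partial_t \<phi> y = blinfun_apply (D y) (0, 1)"
    if "y \<in> U" for y
    using partials_eq[of \<phi> _ "fst y" "snd y"] U(4)[OF that] by auto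
  ultimately have "continuous_on U (partial_s \<phi>)" "continuous_on U (partial_t \<phi>)"
    by (auto cong: continuous_on_cong)
  then show "isCont (partial_s \<phi>) z" "isCont (partial_t \<phi>) z"
    using U(1,2) continuous_on_eq_continuous_at by blast+
qed

lemma C1_near_deriv:
  fixes \<phi> :: "real \<Rightarrow> real"
  assumes "C1_near \<phi> t"
  shows "(\<phi> has_real_derivative deriv \<phi> t) (at t)" "isCont (deriv \<phi>) t"
proof -
  obtain U D where U: "open U" "t \<in> U" "continuous_on U D"
    "\<And>y. y \<in> U \<Longrightarrow> (\<phi> has_derivative blinfun_apply (D y)) (at y)"
    using assms unfolding C1_near_def by blast
  have D: "(\<phi> has_real_derivative blinfun_apply (D y) 1) (at y)" if "y \<in> U" for y
  proof -
    have "blinfun_apply (D y) h = blinfun_apply (D y) 1 * h" for h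
      using blinfun.scaleR_right[of "D y" h 1] by (simp add: mult.commute)
    then show ?thesis unfolding has_field_derivative_def
      by (intro has_derivative_eq_rhs[OF U(4)[OF that]] ext)
  qed
  then show "(\<phi> has_real_derivative deriv \<phi> t) (at t)"
    using DERIV_imp_deriv[OF D[OF U(2)]] D[OF U(2)] by simp
  have "continuous_on U (\<lambda>y. blinfun_apply (D y) 1)" using U(3) by (auto intro!: continuous_intros)
  moreover have "deriv \<phi> y = blinfun_apply (D y) 1" if "y \<in> U" for y
    by (rule DERIV_imp_deriv[OF D[OF that]])
  ultimately have "continuous_on U (deriv \<phi>)"
    by (auto cong: continuous_on_cong)
  then show "isCont (deriv \<phi>) t"
    using U(1,2) continuous_on_eq_continuous_at by blast
qed

section \<open>Supertangents: translation, slope bounds and stability\<close>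

lemma supertangent_translate:
  assumes "supertangent UNIV (\<lambda>y. w (y + k) - m) z \<psi>"
  shows "supertangent UNIV w (z + k) (\<lambda>y. \<psi> (y - k))"
  unfolding supertangent_def
proof
  show "C1_near (\<lambda>y. \<psi> (y - k)) (z + k)"
    using C1_near_compose_affine[OF bounded_linear_ident, of \<psi> "z + k" "- k"] assms
    by (simp add: supertangent_def)
  have "\<forall>\<^sub>F y in at z. w (y + k) - \<psi> y \<le> w (z + k) - \<psi> z"
    using assms unfolding supertangent_def by (auto elim: eventually_mono)
  then have "\<forall>\<^sub>F y in at (z + k). w y - \<psi> (y - k) \<le> w (z + k) - \<psi> z"
    unfolding at_to_0[of "z + k"] at_to_0[of z] eventually_filtermap
    by (auto elim: eventually_mono simp: algebra_simps)
  then show "\<forall>\<^sub>F y in at (z + k). w y - \<psi> (y - k) \<le> w (z + k) - \<psi> (z + k - k)" by simp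
qed

lemma supertangent_transfer:
  assumes "supertangent C w z \<psi>" "w' z = w z" "\<forall>\<^sub>F y in at z within C. w' y \<le> w y"
  shows "supertangent C w' z \<psi>"
  using assms unfolding supertangent_def by (auto elim: eventually_elim2)

lemma eventually_at_slice:
  fixes s t :: real
  assumes "\<forall>\<^sub>F y in at (s, t). P y"
  shows "\<forall>\<^sub>F x in at s. P (x, t)" "\<forall>\<^sub>F x in at t. P (s, x)"
proof -
  obtain e where e: "e > 0" "\<And>y. y \<noteq> (s, t) \<Longrightarrow> dist y (s, t) < e \<Longrightarrow> P y"
    using assms unfolding eventually_at by auto
  show "\<forall>\<^sub>F x in at s. P (x, t)" unfolding eventually_at
    by (rule exI[of _ e]) (auto intro!: e simp: dist_Pair_Pair)
  show "\<forall>\<^sub>F x in at t. P (s, x)" unfolding eventually_at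
    by (rule exI[of _ e]) (auto intro!: e simp: dist_Pair_Pair)
qed

text \<open>The function \<open>w\<close> need not be differentiable: its difference quotients to
  the right are dominated by those of \<open>\<phi>\<close>, so a lower slope bound for
  \<open>w\<close> passes to the derivative.\<close>

lemma touching_derivative_ge:
  fixes w \<phi> :: "real \<Rightarrow> real"
  assumes "(\<phi> has_real_derivative d) (at x)"
    and "\<forall>\<^sub>F y in at x. w y - \<phi> y \<le> w x - \<phi> x"
    and "\<forall>\<^sub>F y in at_right x. w y - w x \<ge> m * (y - x)"
  shows "d \<ge> m"
proof -
  have 1: "((\<lambda>y. (\<phi> y - \<phi> x) / (y - x)) \<longlongrightarrow> d) (at_right x)"
    using assms(1) unfolding has_field_derivative_iff
    by (rule filterlim_mono) (auto simp: at_le)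
  have "\<forall>\<^sub>F y in at_right x. w y - \<phi> y \<le> w x - \<phi> x"
    using assms(2) by (rule filter_leD[rotated]) (auto simp: at_le)
  then have 2: "\<forall>\<^sub>F y in at_right x. m \<le> (\<phi> y - \<phi> x) / (y - x)"
    using assms(3) eventually_at_right_less[of x]
    by eventually_elim (auto simp: field_simps)
  show ?thesis by (rule tendsto_lowerbound[OF 1 2]) simp
qed

lemma touching_derivative_le:
  fixes w \<phi> :: "real \<Rightarrow> real"
  assumes "(\<phi> has_real_derivative d) (at x)"
    and "\<forall>\<^sub>F y in at x. w y - \<phi> y \<le> w x - \<phi> x"
    and "\<forall>\<^sub>F y in at_left x. w y - w x \<ge> m * (y - x)"
  shows "d \<le> m"
proof -
  have 1: "((\<lambda>y. (\<phi> y - \<phi> x) / (y - x)) \<longlongrightarrow> d) (at_left x)"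
    using assms(1) unfolding has_field_derivative_iff
    by (rule filterlim_mono) (auto simp: at_le)
  have "\<forall>\<^sub>F y in at_left x. w y - \<phi> y \<le> w x - \<phi> x"
    using assms(2) by (rule filter_leD[rotated]) (auto simp: at_le)
  moreover have "\<forall>\<^sub>F y in at_left x. y < x"
    by (simp add: eventually_at_filter)
  ultimately have 2: "\<forall>\<^sub>F y in at_left x. (\<phi> y - \<phi> x) / (y - x) \<le> m"
    using assms(3)
    by eventually_elim (auto simp: divide_le_eq)
  show ?thesis by (rule tendsto_upperbound[OF 1 2]) simp
qed

lemma supertangent_slices:
  fixes s t :: real
  assumes "supertangent UNIV w (s, t) \<psi>"
  shows "\<forall>\<^sub>F x in at s. w (x, t) - \<psi> (x, t) \<le> w (s, t) - \<psi> (s, t)"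
    "\<forall>\<^sub>F x in at t. w (s, x) - \<psi> (s, x) \<le> w (s, t) - \<psi> (s, t)"
  using assms eventually_at_slice[of "\<lambda>y. w y - \<psi> y \<le> w (s, t) - \<psi> (s, t)"]
  unfolding supertangent_def by auto

text \<open>Used with \<open>p = 0\<close> and a Lipschitz constant \<open>M\<close> for Lipschitz
  functions, and with \<open>p\<close> the slope of an explicit bump and \<open>M\<close> the size
  of its kink.\<close>

lemma supertangent_partial_s_bound:
  assumes "supertangent UNIV w (s, t) \<psi>"
    and "\<forall>\<^sub>F y in at s. p * (y - s) - M * \<bar>y - s\<bar> \<le> w (y, t) - w (s, t)"
  shows "\<bar>partial_s \<psi> (s, t) - p\<bar> \<le> M"
proof -
  have d: "((\<lambda>s. \<psi> (s, t)) has_real_derivative partial_s \<psi> (s, t)) (at s)"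
    using C1_near_has_partials(1) assms(1) unfolding supertangent_def by blast
  have "\<forall>\<^sub>F y in at_right s. (p - M) * (y - s) \<le> w (y, t) - w (s, t)"
    using filter_leD[OF at_le assms(2), of "{s<..}", simplified] eventually_at_right_less[of s]
    by eventually_elim (auto simp: algebra_simps)
  from touching_derivative_ge[OF d supertangent_slices(1)[OF assms(1)] this]
  have "p - M \<le> partial_s \<psi> (s, t)" .
  moreover have "\<forall>\<^sub>F y in at_left s. (p + M) * (y - s) \<le> w (y, t) - w (s, t)"
  proof -
    have "\<forall>\<^sub>F y in at_left s. y < s" by (simp add: eventually_at_filter)
    then show ?thesis using filter_leD[OF at_le assms(2), of "{..<s}", simplified]
      by eventually_elim (auto simp: algebra_simps)
  qed
  from touching_derivative_le[OF d supertangent_slices(1)[OF assms(1)] this]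
  have "partial_s \<psi> (s, t) \<le> p + M" .
  ultimately show ?thesis by auto
qed

text \<open>A bound to the left alone suffices for an upper bound on the time slope, so at a concave
  kink only the larger, left slope counts.\<close>

lemma supertangent_partial_t_le:
  assumes "supertangent UNIV w (s, t) \<psi>"
    and "\<forall>\<^sub>F y in at_left t. m * (y - t) \<le> w (s, y) - w (s, t)"
  shows "partial_t \<psi> (s, t) \<le> m"
  using touching_derivative_le[OF C1_near_has_partials(2) supertangent_slices(2)[OF assms(1)] assms(2)]
    assms(1) unfolding supertangent_def by blast

text \<open>Stability of supertangents under suprema: the penalty \<open>(dist y z)\<^sup>2\<close>
  makes the contact with \<open>u\<close> at \<open>z\<close> strict, so for an almost optimal
  \<open>w\<close> the maximum of \<open>w\<close> minus the penalized test function is attained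
  inside a small ball around \<open>z\<close>.\<close>

lemma supertangent_perturbed:
  fixes u :: "'b::euclidean_space \<Rightarrow> real"
  assumes "supertangent UNIV u z \<psi>" and "open S" "z \<in> S" and "e > 0"
    and le: "\<And>w y. w \<in> W \<Longrightarrow> y \<in> S \<Longrightarrow> w y \<le> u y"
    and cont: "\<And>w. w \<in> W \<Longrightarrow> continuous_on S w"
    and approx: "\<And>e. e > 0 \<Longrightarrow> \<exists>w\<in>W. w z > u z - e"
  obtains w y where "w \<in> W" "y \<in> S" "dist y z < e" "supertangent UNIV w y (\<lambda>y. \<psi> y + (dist y z)\<^sup>2)"
proof -
  obtain U where U: "open U" "z \<in> U" "\<And>y. y \<in> U \<Longrightarrow> C1_near \<psi> y" "continuous_on U \<psi>"
    using assms(1) C1_near_nearby unfolding supertangent_def by metis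
  obtain d where d: "d > 0" "\<And>y. y \<noteq> z \<Longrightarrow> dist y z < d \<Longrightarrow> u y - \<psi> y \<le> u z - \<psi> z"
    using assms(1) unfolding supertangent_def eventually_at by auto
  have d': "u y - \<psi> y \<le> u z - \<psi> z" if "dist y z < d" for y
    using d(2)[of y] that by (cases "y = z") auto
  obtain r where r: "r > 0" "cball z r \<subseteq> S \<inter> U \<inter> ball z (min d e)"
  proof -
    have "open (S \<inter> U \<inter> ball z (min d e))" "z \<in> S \<inter> U \<inter> ball z (min d e)"
      using U assms d(1) by auto
    then show thesis using that by (meson open_contains_cball)
  qed
  \<comment> \<open>\<open>r\<^sup>2\<close> is the value of the penalty on the sphere of radius
    \<open>r\<close>, so a defect below it keeps the maximum off the sphere.\<close>
  obtain w where w: "w \<in> W" "w z > u z - r\<^sup>2" using approx[of "r\<^sup>2"] r(1) by auto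
  let ?f = "\<lambda>y. w y - (\<psi> y + (dist y z)\<^sup>2)"
  have "continuous_on (cball z r) ?f"
    using cont[OF w(1)] U(4) r(2) by (intro continuous_intros) (auto intro: continuous_on_subset)
  then obtain y where y: "y \<in> cball z r" "\<And>x. x \<in> cball z r \<Longrightarrow> ?f x \<le> ?f y"
    using continuous_attains_sup[of "cball z r" ?f] r(1) by (auto simp: less_imp_le)
  have "y \<in> S \<inter> U \<inter> ball z (min d e)" using y(1) r(2) by blast
  then have yS: "y \<in> S" "y \<in> U" "dist y z < d" "dist y z < e" by (auto simp: dist_commute)
  have "u z - r\<^sup>2 - \<psi> z < ?f y" using y(2)[of z] w(2) r(1) by auto
  also have "\<dots> \<le> u y - \<psi> y - (dist y z)\<^sup>2" using le[OF w(1) yS(1)] by auto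
  also have "\<dots> \<le> u z - \<psi> z - (dist y z)\<^sup>2" using d'[OF yS(3)] by auto
  finally have "(dist y z)\<^sup>2 < r\<^sup>2" by auto
  then have "dist y z < r" using r(1) by (simp add: power2_less_imp_less)
  then have "\<forall>\<^sub>F x in at y. x \<in> ball z r"
    by (intro eventually_at_in_open') (auto simp: dist_commute)
  then have "\<forall>\<^sub>F x in at y. ?f x \<le> ?f y"
    by eventually_elim (auto intro: y(2))
  then have "supertangent UNIV w y (\<lambda>y. \<psi> y + (dist y z)\<^sup>2)"
    unfolding supertangent_def using C1_near_add[OF U(3)[OF yS(2)] C1_near_dist_sq] by auto
  with that w(1) yS show thesis by blast
qed

section \<open>Transport inequalities in the viscosity sense\<close>

lemma small_power_exists:
  fixes x m :: real
  assumes "0 \<le> x" "x < 1" "m > 0"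
  obtains n where "n > 0" "x ^ n < m"
proof -
  have "(\<lambda>n. x ^ n) \<longlonglongrightarrow> 0" using assms by (intro LIMSEQ_realpow_zero) auto
  then have "\<forall>\<^sub>F n in sequentially. x ^ n < m" using assms(3) order_tendstoD(2) by blast
  then have "\<forall>\<^sub>F n in sequentially. x ^ n < m \<and> n > 0"
    using eventually_gt_at_top[of 0] by eventually_elim auto
  then show thesis using that eventually_sequentially by auto
qed

text \<open>
  The touching function is a steep power of the time along the characteristic, which keeps the
  maximum away from the final time, plus a strong penalization of the distance to the
  characteristic, which does not contribute to the derivative in the direction \<open>(q, 1)\<close>.
\<close>

lemma viscosity_transport:
  fixes w :: "real \<times> real \<Rightarrow> real"
  assumes G: "open G" "continuous_on G w"
    and sub: "\<And>s t \<psi>. (s, t) \<in> G \<Longrightarrow> supertangent UNIV w (s, t) \<psi>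
      \<Longrightarrow> q * partial_s \<psi> (s, t) + partial_t \<psi> (s, t) \<le> L"
    and seg: "\<And>\<tau>. 0 \<le> \<tau> \<Longrightarrow> \<tau> \<le> h \<Longrightarrow> (s1 + q * \<tau>, t1 + \<tau>) \<in> G"
    and h: "0 \<le> h"
  shows "w (s1 + q * h, t1 + h) \<le> w (s1, t1) + L * h"
proof (rule ccontr)
  assume neg: "\<not> w (s1 + q * h, t1 + h) \<le> w (s1, t1) + L * h"
  then have h: "0 < h" using h by (cases "h = 0") auto
  \<comment> \<open>A third of the excess, to be spent on the linear part of \<open>B\<close>, on
    its power part at time \<open>h\<close>, and on the oscillation of \<open>w\<close> near the
    starting point.\<close>
  define m where "m = (w (s1 + q * h, t1 + h) - w (s1, t1) - L * h) / 3"
  have m: "m > 0" using neg by (simp add: m_def)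
  \<comment> \<open>Coordinates adapted to the characteristic: elapsed time \<open>\<tau>\<close>
    and spatial deviation \<open>\<rho>\<close> from it.\<close>
  define Z where "Z = (\<lambda>(\<tau>, \<rho>). (s1 + q * \<tau> + \<rho>, t1 + \<tau>))"
  have Zcont: "continuous_on A Z" for A
    unfolding Z_def case_prod_unfold by (intro continuous_intros)
  let ?K = "(\<lambda>\<tau>. Z (\<tau>, 0)) ` {0..h}"
  have "compact ?K"
    by (intro compact_continuous_image continuous_on_compose2[OF Zcont[of UNIV]] continuous_intros) auto
  moreover have "?K \<subseteq> G" using seg by (auto simp: Z_def)
  ultimately obtain e where e: "e > 0" "(\<Union>x\<in>?K. ball x e) \<subseteq> G"
    using compact_subset_open_imp_ball_epsilon_subset[of ?K G] G(1) h by auto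
  have "(s1, t1) \<in> G" using seg[of 0] h by auto
  then have "isCont w (s1, t1)" using G continuous_on_eq_continuous_at by blast
  then obtain d where d: "d > 0" "\<And>y. dist y (s1, t1) < d \<Longrightarrow> \<bar>w y - w (s1, t1)\<bar> < m"
    using m unfolding continuous_at_eps_delta dist_real_def by metis
  \<comment> \<open>Small enough that \<open>Z\<close> maps the box \<open>Q\<close>, which extends
    to times up to \<open>r\<close> beyond \<open>h\<close>, into \<open>G\<close>, and its initial
    face to where \<open>w\<close> varies by less than \<open>m\<close>.\<close>
  define r where "r = min (e / (2 * (\<bar>q\<bar> + 3))) (d / 2)"
  have r: "r > 0" "r < d" "(\<bar>q\<bar> + 2) * r < e"
  proof -
    have "r \<le> d / 2" unfolding r_def by (rule min.cobounded2)
    then show "r < d" using d(1) by simp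
    have "r \<le> e / (2 * (\<bar>q\<bar> + 3))" unfolding r_def by (rule min.cobounded1)
    then have "(\<bar>q\<bar> + 2) * r \<le> (\<bar>q\<bar> + 2) * (e / (2 * (\<bar>q\<bar> + 3)))" by (intro mult_left_mono) auto
    also have "\<dots> < e" using e(1) by (auto simp: field_simps) (smt (verit) mult_nonneg_nonneg)
    finally show "(\<bar>q\<bar> + 2) * r < e" .
  qed (use e d in \<open>auto simp: r_def\<close>)
  define Q where "Q = {0..h + r} \<times> {-r..r}"
  have Q: "compact Q" "Q \<noteq> {}" "(h, 0) \<in> Q"
    using h r(1) by (auto simp: Q_def compact_Times)
  have ZQ: "Z x \<in> G" if "x \<in> Q" for x
  proof -
    obtain \<tau> \<rho> where x: "x = (\<tau>, \<rho>)" by (cases x)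
    have \<tau>: "0 \<le> \<tau>" "\<tau> \<le> h + r" "\<bar>\<rho>\<bar> \<le> r" using that by (auto simp: Q_def x)
    let ?\<tau> = "min \<tau> h"
    have "dist (Z (?\<tau>, 0)) (Z x) \<le> dist (s1 + q * ?\<tau>) (s1 + q * \<tau> + \<rho>) + dist (t1 + ?\<tau>) (t1 + \<tau>)"
      unfolding Z_def x by (simp add: dist_Pair_Pair) (rule order_trans[OF sqrt_sum_squares_le_sum_abs], simp)
    also have "\<dots> \<le> (\<bar>q\<bar> * r + r) + r"
    proof -
      have "\<bar>q * (\<tau> - ?\<tau>)\<bar> \<le> \<bar>q\<bar> * r"
        unfolding abs_mult using \<tau> by (intro mult_left_mono) auto
      then show ?thesis using \<tau> by (auto simp: dist_real_def algebra_simps)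
    qed
    also have "\<dots> < e" using r(3) by (simp add: algebra_simps)
    finally have "Z x \<in> ball (Z (?\<tau>, 0)) e" by simp
    moreover have "Z (?\<tau>, 0) \<in> ?K" using \<tau> h by auto
    ultimately show ?thesis using e(2) by blast
  qed
  have wZ: "continuous_on Q (\<lambda>x. w (Z x) - L * fst x)"
    using ZQ by (intro continuous_intros continuous_on_compose2[OF G(2) Zcont]) auto
  then have "bounded ((\<lambda>x. w (Z x) - L * fst x) ` Q)"
    using Q(1) compact_continuous_image compact_imp_bounded by blast
  then obtain W where W: "W > 0" "\<And>x. x \<in> Q \<Longrightarrow> \<bar>w (Z x) - L * fst x\<bar> \<le> W"
    unfolding bounded_pos by auto
  \<comment> \<open>The ratio \<open>h / (h + r)\<close> is below 1, so a high power of
    \<open>\<tau> / (h + r)\<close> is negligible at time \<open>h\<close> while its value at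
    \<open>h + r\<close> is 1.\<close>
  obtain n where n: "n > 0" "(h / (h + r)) ^ n < m / (2 * W)"
    using small_power_exists[of "h / (h + r)" "m / (2 * W)"] h r(1) m W(1) by auto
  then have n2: "2 * W * (h / (h + r)) ^ n < m" using W(1) by (simp add: field_simps)
  define \<theta> where "\<theta> = m / (2 * h)"
  have \<theta>: "\<theta> > 0" "\<theta> * h < m" using m h by (auto simp: \<theta>_def)
  \<comment> \<open>On the lateral faces the penalty equals \<open>2 * W\<close>, as does the power
    part of \<open>B\<close> on the final face; either pushes \<open>f\<close> down to at most
    \<open>- W\<close>, below its maximum.\<close>
  define A where "A = 2 * W / r\<^sup>2"
  define B where "B = (\<lambda>\<tau>. \<theta> * \<tau> + 2 * W * (\<tau> / (h + r)) ^ n)"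
  define f where "f = (\<lambda>x. w (Z x) - L * fst x - B (fst x) - A * (snd x)\<^sup>2)"
  have "continuous_on Q f"
    unfolding f_def B_def using h r(1) by (intro continuous_intros wZ) auto
  then obtain x where x: "x \<in> Q" "\<And>y. y \<in> Q \<Longrightarrow> f y \<le> f x"
    using continuous_attains_sup[OF Q(1,2)] by blast
  obtain \<tau> \<rho> where x_eq: "x = (\<tau>, \<rho>)" by (cases x)
  have \<tau>: "0 \<le> \<tau>" "\<tau> \<le> h + r" "\<bar>\<rho>\<bar> \<le> r" using x(1) by (auto simp: Q_def x_eq)
  have B0: "B \<tau>' \<ge> 0" if "\<tau>' \<ge> 0" for \<tau>' using that \<theta> W(1) h r(1) by (auto simp: B_def)
  have f_low: "f (h, 0) > w (s1, t1) + m"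
    using n2 \<theta> by (auto simp: f_def B_def Z_def m_def field_simps)
  have "(0, 0) \<in> Q" using h r by (auto simp: Q_def)
  then have "\<bar>w (s1, t1)\<bar> \<le> W" using W(2)[of "(0,0)"] by (auto simp: Z_def)
  then have f_gt: "f x > - W" using f_low x(2)[OF Q(3)] m by auto
  have fx: "f x \<le> W - B \<tau> - A * \<rho>\<^sup>2" using W(2)[OF x(1)] by (auto simp: f_def x_eq)
  have A: "A > 0" using W(1) r by (simp add: A_def)
  have "\<tau> \<noteq> h + r"
  proof
    assume "\<tau> = h + r"
    then have "B \<tau> \<ge> 2 * W" using \<theta> h r(1) by (auto simp: B_def)
    then show False using fx f_gt A by (smt (verit) mult_nonneg_nonneg zero_le_power2)
  qed
  moreover have "\<bar>\<rho>\<bar> \<noteq> r"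
  proof
    assume "\<bar>\<rho>\<bar> = r"
    then have "A * \<rho>\<^sup>2 = 2 * W" using r(1) by (auto simp: A_def power2_eq_square abs_if split: if_splits)
    then show False using fx f_gt B0[OF \<tau>(1)] by auto
  qed
  moreover have "\<tau> \<noteq> 0"
  proof
    assume 0: "\<tau> = 0"
    have "dist (s1 + \<rho>, t1) (s1, t1) < d" using \<tau>(3) r(2) by (auto simp: dist_Pair_Pair dist_real_def)
    then have "w (s1 + \<rho>, t1) < w (s1, t1) + m" using d(2) by force
    moreover have "0 \<le> A * \<rho>\<^sup>2" using A by simp
    then have "f x \<le> w (s1 + \<rho>, t1)" using B0[of 0] by (auto simp: f_def x_eq 0 Z_def)
    ultimately show False using f_low x(2)[OF Q(3)] by linarith
  qed
  ultimately have int: "0 < \<tau>" "\<tau> < h + r" "-r < \<rho>" "\<rho> < r" using \<tau> by auto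
  define \<psi> where "\<psi> = (\<lambda>y. L * (snd y - t1) + (\<theta> * (snd y - t1) + 2 * W * ((snd y - t1) / (h + r)) ^ n)
      + A * (fst y - s1 - q * (snd y - t1))\<^sup>2)"
  have C1: "C1_near \<psi> z" for z
    unfolding \<psi>_def by (intro C1_near_add C1_near_mult C1_near_diff C1_near_power C1_near_divide
      C1_near_const C1_near_fst C1_near_snd)
  have f_eq: "f (t - t1, s - s1 - q * (t - t1)) = w (s, t) - \<psi> (s, t)" for s t
    by (simp add: f_def \<psi>_def B_def Z_def)
  obtain s t where st: "(s, t) = Z x" by (cases "Z x") auto
  then have st': "t - t1 = \<tau>" "s - s1 - q * (t - t1) = \<rho>" by (auto simp: Z_def x_eq)
  have "\<forall>\<^sub>F y in nhds (s, t). 0 < snd y - t1 \<and> snd y - t1 < h + r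
      \<and> - r < fst y - s1 - q * (snd y - t1) \<and> fst y - s1 - q * (snd y - t1) < r"
    by (intro eventually_conj order_tendstoD[of _ "snd (s, t) - t1"]
        order_tendstoD[of _ "fst (s, t) - s1 - q * (snd (s, t) - t1)"] tendsto_intros filterlim_ident)
      (use int st' in auto)
  then have "\<forall>\<^sub>F y in nhds (s, t). w y - \<psi> y \<le> w (s, t) - \<psi> (s, t)"
  proof (rule eventually_mono)
    fix y assume y: "0 < snd y - t1 \<and> snd y - t1 < h + r
      \<and> - r < fst y - s1 - q * (snd y - t1) \<and> fst y - s1 - q * (snd y - t1) < r"
    have "f (snd y - t1, fst y - s1 - q * (snd y - t1)) \<le> f x"
      by (rule x(2)) (use y in \<open>auto simp: Q_def\<close>)
    then show "w y - \<psi> y \<le> w (s, t) - \<psi> (s, t)"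
      using f_eq[of "snd y" "fst y"] f_eq[of t s] st' x_eq by auto
  qed
  then have "supertangent UNIV w (s, t) \<psi>"
    unfolding supertangent_def using C1 by (auto simp: eventually_at_filter elim: eventually_mono)
  moreover have "(s, t) \<in> G" using ZQ[OF x(1)] st by simp
  ultimately have le: "q * partial_s \<psi> (s, t) + partial_t \<psi> (s, t) \<le> L" using sub by blast
  have ps: "partial_s \<psi> (s, t) = 2 * A * (s - s1 - q * (t - t1))"
    unfolding partial_s_def \<psi>_def
    by (rule DERIV_imp_deriv) (auto intro!: derivative_eq_intros simp: algebra_simps)
  have pw: "((\<lambda>t. ((t - t1) / (h + r)) ^ n) has_real_derivative
      real n * ((t - t1) / (h + r)) ^ (n - 1) * (1 / (h + r))) (at t)"
    by (rule DERIV_cong, rule DERIV_power, rule DERIV_cdivide) (auto intro!: derivative_eq_intros)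
  have pt: "partial_t \<psi> (s, t) = L + (\<theta> + 2 * W * (real n * ((t - t1) / (h + r)) ^ (n - 1) * (1 / (h + r))))
      - 2 * A * (s - s1 - q * (t - t1)) * q"
    unfolding partial_t_def \<psi>_def fst_conv snd_conv
    by (rule DERIV_imp_deriv) (rule derivative_eq_intros pw refl | simp)+
  \<comment> \<open>The penalization contributes a term and its negative to the two summands and
    drops out. What is left is the strictly positive \<open>\<theta>\<close> plus a nonnegative
    derivative.\<close>
  have "\<theta> + 2 * W * (real n * (\<tau> / (h + r)) ^ (n - 1) * (1 / (h + r))) \<le> 0"
    using le unfolding ps pt st'(2) unfolding st'(1) by (simp add: mult.commute mult.left_commute)
  moreover have "2 * W * (real n * (\<tau> / (h + r)) ^ (n - 1) * (1 / (h + r))) \<ge> 0"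
    using W(1) int h r(1) by auto
  ultimately show False using \<theta> by auto
qed

section \<open>Topology of the network\<close>

context network
begin

lemma arc_in: "\<gamma> \<in> E \<Longrightarrow> arc \<gamma>"
  using simple_arc[of \<gamma>] no_loops[of \<gamma>] by (auto simp: arc_simple_path)

lemma arc_continuous: "\<gamma> \<in> E \<Longrightarrow> continuous_on {0..1} \<gamma>"
  using simple_arc simple_path_imp_path path_def by blast

lemma arc_inj: "\<gamma> \<in> E \<Longrightarrow> inj_on \<gamma> {0..1}"
  using arc_in arc_def by blast

lemma compact_network_set: "compact (network_set E)"
  unfolding network_set_def
  by (intro compact_UN finite_arcs compact_path_image simple_path_imp_path simple_arc)

lemma arc_mem_network: "\<gamma> \<in> E \<Longrightarrow> s \<in> {0..1} \<Longrightarrow> \<gamma> s \<in> network_set E"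
  unfolding network_set_def path_image_def by blast

text \<open>Disjointness leaves only \<open>\<gamma>\<close> and its reverse as candidates, and
  injectivity then determines the parameter.\<close>

lemma arcs_meet:
  assumes "\<gamma> \<in> E" "\<gamma>' \<in> E" "s \<in> {0<..<1}" "s' \<in> {0..1}" "\<gamma> s = \<gamma>' s'"
  shows "\<gamma>' = \<gamma> \<and> s' = s \<or> \<gamma>' = reversepath \<gamma> \<and> s' = 1 - s"
proof -
  have "\<gamma> s \<in> \<gamma> ` {0<..<1}" using assms(3) by blast
  moreover have "\<gamma> s \<in> \<gamma>' ` {0..1}" using assms(4,5) by auto
  ultimately consider "\<gamma>' = \<gamma>" | "\<gamma>' = reversepath \<gamma>"
    using disjoint_arcs[OF assms(1,2)] by blast
  then show ?thesis
  proof cases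
    case 1
    then show ?thesis using inj_onD[OF arc_inj[OF assms(1)], of s s'] assms by auto
  next
    case 2
    then have "\<gamma> s = \<gamma> (1 - s')" using assms(5) by (simp add: reversepath_def)
    then show ?thesis using inj_onD[OF arc_inj[OF assms(1)], of s "1 - s'"] assms 2 by auto
  qed
qed

lemma interior_not_vertex:
  assumes "\<gamma> \<in> E" "s \<in> {0<..<1}"
  shows "\<gamma> s \<notin> vertices E"
proof
  assume "\<gamma> s \<in> vertices E"
  then obtain \<gamma>' s' where "\<gamma>' \<in> E" "s' = 0 \<or> s' = 1" "\<gamma> s = \<gamma>' s'"
    unfolding vertices_def pathstart_def pathfinish_def by blast
  then show False using arcs_meet[of \<gamma> \<gamma>' s s'] assms by auto
qed

lemma vertex_network: "x \<in> vertices E \<Longrightarrow> x \<in> network_set E"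
  using arc_mem_network unfolding vertices_def pathstart_def pathfinish_def by fastforce

lemma arcs_intoD: "\<gamma> \<in> arcs_into E x \<Longrightarrow> \<gamma> \<in> E \<and> \<gamma> 1 = x"
  unfolding arcs_into_def pathfinish_def by auto

lemma arc_end_vertex: "\<gamma> \<in> E \<Longrightarrow> \<gamma> 0 \<in> vertices E" "\<gamma> \<in> E \<Longrightarrow> \<gamma> 1 \<in> vertices E"
  unfolding vertices_def pathstart_def pathfinish_def by auto

lemma network_cases:
  assumes "x \<in> network_set E"
  obtains (vertex) "x \<in> vertices E"
  | (interior) \<gamma> s where "\<gamma> \<in> E" "s \<in> {0<..<1}" "x = \<gamma> s"
proof -
  obtain \<gamma> s where s: "\<gamma> \<in> E" "s \<in> {0..1}" "x = \<gamma> s"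
    using assms unfolding network_set_def path_image_def by auto
  then consider "s = 0" | "s = 1" | "s \<in> {0<..<1}" by force
  then show thesis using s arc_end_vertex that by cases auto
qed

definition param :: "(real \<Rightarrow> 'a) \<Rightarrow> 'a \<Rightarrow> real" where
  "param \<gamma> = inv_into {0..1} \<gamma>"

lemma param_continuous: "\<gamma> \<in> E \<Longrightarrow> continuous_on (path_image \<gamma>) (param \<gamma>)"
  unfolding param_def path_image_def
  by (rule continuous_on_inv[OF arc_continuous]) (auto simp: inv_into_f_f arc_inj)

lemma param:
  assumes "x \<in> path_image \<gamma>"
  shows "param \<gamma> x \<in> {0..1}" "\<gamma> (param \<gamma> x) = x"
  using assms inv_into_into[of x \<gamma> "{0..1}"] unfolding param_def path_image_def
  by (auto simp: f_inv_into_f)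

text \<open>On each arc \<open>w\<close> factors through the continuous inverse
  \<open>param \<gamma>\<close>; the finitely many closed pieces are then pasted together.\<close>

lemma continuous_on_alongI:
  assumes "\<And>\<gamma>. \<gamma> \<in> E \<Longrightarrow> continuous_on ({0..1} \<times> TT) (along w \<gamma>)"
  shows "continuous_on (network_set E \<times> TT) w"
proof -
  have "continuous_on ((\<Union>\<gamma>\<in>F. path_image \<gamma>) \<times> TT) w" if "F \<subseteq> E" for F
    using finite_subset[OF that finite_arcs] that
  proof (induction F rule: finite_induct)
    case (insert \<gamma> F)
    have \<gamma>: "\<gamma> \<in> E" using insert by auto
    have "continuous_on (path_image \<gamma> \<times> TT) (\<lambda>z. along w \<gamma> (param \<gamma> (fst z), snd z))"
      by (rule continuous_on_compose2[OF assms[OF \<gamma>]])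
        (auto intro!: continuous_intros continuous_on_compose2[OF param_continuous[OF \<gamma>]]
          dest: param(1))
    moreover have "along w \<gamma> (param \<gamma> (fst z), snd z) = w z" if "z \<in> path_image \<gamma> \<times> TT" for z
      using that param(2)[of "fst z" \<gamma>] by (auto simp: along_def)
    ultimately have 1: "continuous_on (path_image \<gamma> \<times> TT) w"
      by (auto cong: continuous_on_cong)
    let ?B = "\<Union>\<gamma>\<in>F. path_image \<gamma>"
    have F: "closed ?B"
      using insert finite_arcs
      by (intro closed_UN) (auto intro!: compact_imp_closed compact_path_image simple_path_imp_path simple_arc)
    have g: "closed (path_image \<gamma>)"
      using \<gamma> by (auto intro!: compact_imp_closed compact_path_image simple_path_imp_path simple_arc)
    have eq: "(\<Union>\<gamma>\<in>insert \<gamma> F. path_image \<gamma>) \<times> TT = path_image \<gamma> \<times> TT \<union> ?B \<times> TT" by auto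
    have "closedin (top_of_set (path_image \<gamma> \<times> TT \<union> ?B \<times> TT)) (path_image \<gamma> \<times> TT)"
      unfolding closedin_closed
      by (rule exI[of _ "path_image \<gamma> \<times> UNIV"]) (auto intro: closed_Times g)
    moreover have "closedin (top_of_set (path_image \<gamma> \<times> TT \<union> ?B \<times> TT)) (?B \<times> TT)"
      unfolding closedin_closed
      by (rule exI[of _ "?B \<times> UNIV"]) (use closed_Times[OF F closed_UNIV] in auto)
    ultimately show ?case
      unfolding eq using 1 insert by (intro continuous_on_Un_local) auto
  qed auto
  from this[of E] show ?thesis by (simp add: network_set_def)
qed

lemma continuous_on_along:
  assumes "continuous_on (network_set E \<times> TT) w" "\<gamma> \<in> E"
  shows "continuous_on ({0..1} \<times> TT) (along w \<gamma>)"
proof -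
  have "continuous_on ({0..1} \<times> TT) (\<lambda>z. w (\<gamma> (fst z), snd z))"
    using arc_mem_network[OF assms(2)]
    by (intro continuous_on_compose2[OF assms(1)] continuous_intros
        continuous_on_compose2[OF arc_continuous[OF assms(2)]]) auto
  then show ?thesis by (simp add: along_def case_prod_unfold)
qed

end

section \<open>Hamiltonians\<close>

text \<open>\<open>P\<close> is found to the right of \<open>p0\<close> by the intermediate value
  theorem, and \<open>q\<close> is the right derivative of \<open>h\<close> there. By convexity it
  is at least the slope of the chord from \<open>p0\<close> to \<open>P\<close>, which is positive
  because \<open>h p0 < l = h P\<close>.\<close>

lemma convex_subgradient_at_level:
  fixes h :: "real \<Rightarrow> real"
  assumes convex: "convex_on UNIV h" and cont: "continuous_on UNIV h"
    and coercive: "\<forall>\<^sub>F p in at_infinity. l \<le> h p" and "h p0 < l"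
  obtains P q where "q > 0" "h P = l" "\<And>p. h p \<ge> h P + q * (p - P)"
proof -
  obtain R where R: "\<And>p. norm p \<ge> R \<Longrightarrow> l \<le> h p"
    using coercive unfolding eventually_at_infinity by auto
  define p1 where "p1 = max (p0 + 1) R"
  have "l \<le> h p1" "p0 \<le> p1" using R[of p1] by (auto simp: p1_def max_def abs_if split: if_splits)
  then obtain P where P: "p0 \<le> P" "P \<le> p1" "h P = l"
    using IVT'[of h p0 l p1] assms(4) continuous_on_subset[OF cont] by auto
  then have "p0 < P" using assms(4) by (cases "p0 = P") auto
  define S where "S = (\<lambda>t. (h P - h t) / (P - t)) ` {P<..}"
  have mono: "(h P - h p0) / (P - p0) \<le> (h P - h t) / (P - t)" if "P < t" for t
  proof -
    have "(h p0 - h P) / (p0 - P) \<le> (h P - h t) / (P - t)"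
      using convex_on_slope_le[OF convex, of p0 t P] that \<open>p0 < P\<close> by simp
    then show ?thesis by (metis minus_diff_eq minus_divide_divide)
  qed
  define q where "q = Inf S"
  have "q \<ge> (h P - h p0) / (P - p0)"
    unfolding q_def S_def by (rule cInf_greatest) (auto intro: mono)
  moreover have "(h P - h p0) / (P - p0) > 0" using P assms(4) \<open>p0 < P\<close> by auto
  ultimately have "q > 0" by linarith
  moreover have "h p \<ge> h P + q * (p - P)" for p
    using convex_le_Inf_differential[OF convex, of P p] unfolding q_def S_def by simp
  ultimately show thesis using that P(3) by blast
qed

context network_hamiltonians
begin

lemma H_cont_p:
  assumes "\<gamma> \<in> E" "s \<in> {0..1}"
  shows "continuous_on UNIV (H \<gamma> s)"
proof -
  have "continuous_on UNIV (\<lambda>p. (\<lambda>(s, p). H \<gamma> s p) (s, p))"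
    using assms(2) by (intro continuous_on_compose2[OF H_continuous[OF assms(1)]]
        continuous_on_Pair continuous_on_const continuous_on_id) auto
  then show ?thesis by simp
qed

lemma H_bounded:
  assumes "\<gamma> \<in> E"
  obtains B where "B \<ge> 0" "\<And>s p. s \<in> {0..1} \<Longrightarrow> \<bar>p\<bar> \<le> M \<Longrightarrow> \<bar>H \<gamma> s p\<bar> \<le> B"
proof -
  let ?S = "(\<lambda>(s, p). H \<gamma> s p) ` ({0..1} \<times> {-M..M})"
  have "compact ?S"
    by (intro compact_continuous_image continuous_on_subset[OF H_continuous[OF assms]] compact_Times) auto
  then obtain B where "B > 0" and B: "\<And>y. y \<in> ?S \<Longrightarrow> norm y \<le> B"
    using compact_imp_bounded[of ?S] unfolding bounded_pos by blast
  moreover have "\<bar>H \<gamma> s p\<bar> \<le> B" if "s \<in> {0..1}" "\<bar>p\<bar> \<le> M" for s p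
  proof -
    have "H \<gamma> s p \<in> ?S" using that by (intro image_eqI[of _ _ "(s, p)"]) auto
    then show ?thesis using B by force
  qed
  ultimately show thesis using that[of B] by simp
qed

text \<open>On \<open>\<bar>p\<bar> = R\<close> coercivity lifts \<open>H\<close> by at least 1
  above a bound for its values at \<open>p = 0\<close>; convexity along the ray from 0 continues
  this growth with slope \<open>1 / R\<close>. In the transport inequality \<open>\<kappa>\<close>
  becomes a maximal speed and \<open>C\<close> a rate of increase.\<close>

lemma H_linear_growth:
  assumes "\<gamma> \<in> E"
  obtains \<kappa> C where "\<kappa> > 0" "C \<ge> 0" "\<And>s p. s \<in> {0..1} \<Longrightarrow> \<kappa> * \<bar>p\<bar> - C \<le> H \<gamma> s p"
proof -
  obtain m where m: "m \<ge> 0" "\<And>s p. s \<in> {0..1} \<Longrightarrow> \<bar>p\<bar> \<le> 0 \<Longrightarrow> \<bar>H \<gamma> s p\<bar> \<le> m"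
    using H_bounded[OF assms, of 0] by metis
  obtain R0 where R0: "\<And>p s. norm p \<ge> R0 \<Longrightarrow> s \<in> {0..1} \<Longrightarrow> m + 1 \<le> H \<gamma> s p"
    using H_coercive[OF assms, of "m + 1"] unfolding eventually_at_infinity by blast
  define R where "R = max R0 1"
  have R: "R > 0" "R \<ge> R0" by (auto simp: R_def)
  obtain B where B: "B \<ge> 0" "\<And>s p. s \<in> {0..1} \<Longrightarrow> \<bar>p\<bar> \<le> R \<Longrightarrow> \<bar>H \<gamma> s p\<bar> \<le> B"
    using H_bounded[OF assms, of R] by metis
  show thesis
  proof (rule that[of "1 / R" "B + 1 + m"])
    fix s p :: real assume s: "s \<in> {0..1}"
    show "1 / R * \<bar>p\<bar> - (B + 1 + m) \<le> H \<gamma> s p"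
    proof (cases "\<bar>p\<bar> \<le> R")
      case True
      then have "1 / R * \<bar>p\<bar> \<le> 1" using R by (simp add: field_simps)
      then show ?thesis using B(2)[OF s True] m(1) by linarith
    next
      case False
      define \<theta> where "\<theta> = R / \<bar>p\<bar>"
      have \<theta>: "0 < \<theta>" "\<theta> < 1" "\<bar>\<theta> * p\<bar> = R" using False R by (auto simp: \<theta>_def abs_mult)
      have "H \<gamma> s (\<theta> *\<^sub>R p + (1 - \<theta>) *\<^sub>R 0) \<le> \<theta> * H \<gamma> s p + (1 - \<theta>) * H \<gamma> s 0"
        using convex_onD[OF H_convex[OF assms s], of "1 - \<theta>" p 0] \<theta> by auto
      moreover have "m + 1 \<le> H \<gamma> s (\<theta> * p)" using R0[of "\<theta> * p" s] \<theta> R s by auto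
      moreover have "(1 - \<theta>) * H \<gamma> s 0 \<le> (1 - \<theta>) * m"
        using m(2)[OF s, of 0] \<theta> by (intro mult_left_mono) auto
      ultimately have "\<theta> * (H \<gamma> s p - m) \<ge> 1" by (auto simp: algebra_simps)
      then have "H \<gamma> s p - m \<ge> 1 / \<theta>" using \<theta>(1) by (simp add: field_simps)
      then show ?thesis using B(1) m(1) by (simp add: \<theta>_def)
    qed
  qed (use R m B in auto)
qed

lemma H_uniform_at_end:
  assumes "\<gamma> \<in> E" "e > 0"
  obtains \<rho> where "\<rho> > 0" "\<rho> < 1" "\<And>s p. s \<in> {1-\<rho>..1} \<Longrightarrow> \<bar>p\<bar> \<le> M \<Longrightarrow> \<bar>H \<gamma> s p - H \<gamma> 1 p\<bar> < e"
proof -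
  have "uniformly_continuous_on ({0..1} \<times> {-M..M}) (\<lambda>(s, p). H \<gamma> s p)"
    by (intro compact_uniformly_continuous continuous_on_subset[OF H_continuous[OF assms(1)]] compact_Times) auto
  then obtain d where d: "d > 0" "\<And>y z. y \<in> {0..1} \<times> {-M..M} \<Longrightarrow> z \<in> {0..1} \<times> {-M..M} \<Longrightarrow> dist y z < d
      \<Longrightarrow> dist (case y of (s, p) \<Rightarrow> H \<gamma> s p) (case z of (s, p) \<Rightarrow> H \<gamma> s p) < e"
    using assms(2) unfolding uniformly_continuous_on_def by metis
  show thesis
  proof (rule that[of "min (1/2) (d/2)"])
    fix s p :: real assume "s \<in> {1 - min (1/2) (d/2)..1}" "\<bar>p\<bar> \<le> M"
    then show "\<bar>H \<gamma> s p - H \<gamma> 1 p\<bar> < e"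
      using d(2)[of "(s, p)" "(1, p)"] d(1)
      by (auto simp: dist_Pair_Pair dist_real_def abs_le_iff min_def split: if_splits)
  qed (use d in auto)
qed

text \<open>The chain \<open>a \<le> c x \<le> arc_constant H \<gamma> \<le> - (INF p. H \<gamma> 1
  p)\<close> puts the level \<open>\<eta> - a\<close> strictly above the infimum. This is where the
  bound on the flux limiter enters.\<close>

lemma subgradient_at_vertex:
  assumes flux: "flux_limiter E H c" and x: "x \<in> vertices E" and \<gamma>: "\<gamma> \<in> arcs_into E x"
    and "a \<le> c x" "\<eta> > 0"
  obtains P q where "q > 0" "H \<gamma> 1 P = \<eta> - a" "\<And>p. H \<gamma> 1 p \<ge> H \<gamma> 1 P + q * (p - P)"
proof -
  have E: "\<gamma> \<in> E" using \<gamma> arcs_intoD by blast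
  obtain \<kappa> C where \<kappa>: "\<kappa> > 0" "C \<ge> 0" "\<And>s p. s \<in> {0..1} \<Longrightarrow> \<kappa> * \<bar>p\<bar> - C \<le> H \<gamma> s p"
    using H_linear_growth[OF E] by metis
  have below: "- C \<le> H \<gamma> s p" if "s \<in> {0..1}" for s p
    using \<kappa>(3)[OF that, of p] \<kappa>(1) by (smt (verit) mult_nonneg_nonneg)
  obtain B where B: "\<And>s p. s \<in> {0..1} \<Longrightarrow> \<bar>p\<bar> \<le> 0 \<Longrightarrow> \<bar>H \<gamma> s p\<bar> \<le> B"
    using H_bounded[OF E, of 0] by metis
  have bdd: "bdd_below (range (H \<gamma> s))" if "s \<in> {0..1}" for s
    using below[OF that] by (intro bdd_belowI[of _ "-C"]) auto
  have "(INF p. H \<gamma> s p) \<le> B" if "s \<in> {0..1}" for s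
    using cINF_lower[OF bdd[OF that], of 0] B[OF that, of 0] by force
  then have "bdd_above ((\<lambda>s. INF p. H \<gamma> s p) ` {0..1})" by (intro bdd_aboveI[of _ B]) auto
  then have "(INF p. H \<gamma> 1 p) \<le> - arc_constant H \<gamma>"
    unfolding arc_constant_def using cSUP_upper[of 1 "{0..1}" "\<lambda>s. INF p. H \<gamma> s p"] by auto
  moreover have "c x \<le> arc_constant H \<gamma>"
  proof -
    have "finite (arcs_into E x)" using finite_arcs by (simp add: arcs_into_def)
    then have "Min (arc_constant H ` arcs_into E x) \<le> arc_constant H \<gamma>" using \<gamma> by (intro Min_le) auto
    then show ?thesis using flux x unfolding flux_limiter_def by force
  qed
  ultimately have "(INF p. H \<gamma> 1 p) < \<eta> - a" using assms(4,5) by linarith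
  then obtain p0 where "H \<gamma> 1 p0 < \<eta> - a"
    using cINF_less_iff[OF _ bdd[of 1]] by auto
  moreover have "\<forall>\<^sub>F p in at_infinity. \<eta> - a \<le> H \<gamma> 1 p"
    using H_coercive[OF E, of "\<eta> - a"] by (rule eventually_mono) auto
  ultimately show thesis
    using convex_subgradient_at_level[OF H_convex[OF E, of 1] H_cont_p[OF E, of 1]] that
    by (metis atLeastAtMost_iff zero_le_one order_refl)
qed

end

section \<open>Comparison\<close>

text \<open>A limit point \<open>l\<close> of the maximizers satisfies \<open>g l = 0\<close>, since
  otherwise the penalty would be unbounded along them, and \<open>f l \<ge> f z0\<close>; strictness
  of the maximum at \<open>z0\<close> then forces \<open>l = z0\<close>.\<close>

lemma penalized_maxima_converge:
  fixes f :: "'b::metric_space \<Rightarrow> real" and g :: "'b \<Rightarrow> real"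
  assumes "compact K" "continuous_on K f" "continuous_on K g" "\<And>z. z \<in> K \<Longrightarrow> g z \<ge> 0"
    and z0: "z0 \<in> K" "g z0 = 0" "\<And>z. z \<in> K \<Longrightarrow> g z = 0 \<Longrightarrow> z \<noteq> z0 \<Longrightarrow> f z < f z0"
    and "d > 0"
  obtains n z where "z \<in> K" "dist z z0 < d" "\<And>y. y \<in> K \<Longrightarrow> f y - real n * g y \<le> f z - real n * g z"
proof -
  have "\<exists>z\<in>K. \<forall>y\<in>K. f y - real n * g y \<le> f z - real n * g z" for n
    using assms(2,3) z0(1) by (intro continuous_attains_sup assms(1) continuous_intros) auto
  then obtain Z where Z: "\<And>n. Z n \<in> K" "\<And>n y. y \<in> K \<Longrightarrow> f y - real n * g y \<le> f (Z n) - real n * g (Z n)"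
    by metis
  obtain l \<sigma> where l: "l \<in> K" "strict_mono (\<sigma> :: nat \<Rightarrow> nat)" "(Z \<circ> \<sigma>) \<longlonglongrightarrow> l"
    using assms(1) Z(1) unfolding compact_def by blast
  have f: "(\<lambda>n. f (Z (\<sigma> n))) \<longlonglongrightarrow> f l" and g: "(\<lambda>n. g (Z (\<sigma> n))) \<longlonglongrightarrow> g l"
    using l Z(1) continuous_on_tendsto_compose[OF assms(2) l(3)] continuous_on_tendsto_compose[OF assms(3) l(3)]
    by (auto simp: comp_def)
  have ineq: "f z0 + real (\<sigma> n) * g (Z (\<sigma> n)) \<le> f (Z (\<sigma> n))" for n
    using Z(2)[OF z0(1), of "\<sigma> n"] z0(2) by auto
  have "f z0 \<le> f l"
  proof (rule LIMSEQ_le_const[OF f])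
    have "f z0 \<le> f (Z (\<sigma> n))" for n
      using ineq[of n] assms(4)[OF Z(1)[of "\<sigma> n"]] by (smt (verit) mult_nonneg_nonneg of_nat_0_le_iff)
    then show "\<exists>N. \<forall>n\<ge>N. f z0 \<le> f (Z (\<sigma> n))" by blast
  qed
  moreover have "g l = 0"
  proof -
    have "(\<lambda>n. (f (Z (\<sigma> n)) - f z0) * inverse (real (\<sigma> n))) \<longlonglongrightarrow> (f l - f z0) * 0"
      using LIMSEQ_subseq_LIMSEQ[OF lim_inverse_n l(2)] by (intro tendsto_intros f) (simp add: comp_def)
    moreover have "\<forall>\<^sub>F n in sequentially. g (Z (\<sigma> n)) \<le> (f (Z (\<sigma> n)) - f z0) * inverse (real (\<sigma> n))"
      using eventually_gt_at_top[of 0]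
    proof eventually_elim
      case (elim n)
      then have "\<sigma> n > 0" using seq_suble[OF l(2), of n] by linarith
      then show ?case using ineq[of n] by (simp add: field_simps)
    qed
    ultimately have "g l \<le> 0" using tendsto_le[OF _ _ g] by fastforce
    then show ?thesis using assms(4)[OF l(1)] by simp
  qed
  ultimately have "l = z0" using z0(3)[OF l(1)] by force
  then have "\<forall>\<^sub>F n in sequentially. dist (Z (\<sigma> n)) z0 < d"
    using l(3) assms(8) unfolding tendsto_iff comp_def by blast
  then obtain n where "dist (Z (\<sigma> n)) z0 < d" using eventually_happens'[OF sequentially_bot] by blast
  then show thesis by (rule that[OF Z(1) _ Z(2)])
qed

context network_hamiltonians
begin

text \<open>The hypotheses describe a maximum of the functional with doubled time, both times lying
  strictly between \<open>T0\<close> and \<open>S\<close>. The two possible positions of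
  \<open>x\<close> are refuted separately. The lower bound \<open>\<eta>\<close> on the slope of the
  barrier \<open>b\<close> supplies the strictness.\<close>

context
  fixes c :: "'a \<Rightarrow> real" and T0 :: real and T1 :: ereal and u v :: "'a \<times> real \<Rightarrow> real"
    and b b' :: "real \<Rightarrow> real" and S \<epsilon> \<eta> t1 r1 :: real and x :: 'a
  assumes flux: "flux_limiter E H c"
    and sub: "HJ_subsolution E H c T0 T1 u" and super: "HJ_supersolution E H c T0 T1 v"
    and Lip: "\<And>\<gamma>. \<gamma> \<in> E \<Longrightarrow> \<exists>M. \<forall>s\<in>{0..1}. \<forall>s'\<in>{0..1}. \<forall>t\<in>times_from T0 T1.
               \<bar>u (\<gamma> s, t) - u (\<gamma> s', t)\<bar> \<le> M * \<bar>s - s'\<bar>"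
    and S: "ereal S < T1" and \<epsilon>: "\<epsilon> > 0" and \<eta>: "\<eta> > 0"
    and bC1: "\<And>r. C1_near b r" "\<And>z::real \<times> real. C1_near (\<lambda>z. b (snd z)) z"
    and b': "\<And>r. (b has_real_derivative b' r) (at r)" "\<And>r. T0 \<le> r \<Longrightarrow> \<eta> \<le> b' r"
    and tr: "T0 < t1" "t1 < S" "T0 < r1" "r1 < S"
    and x: "x \<in> network_set E"
    and maximal: "\<And>y t r. y \<in> network_set E \<Longrightarrow> t \<in> {T0..S} \<Longrightarrow> r \<in> {T0..S} \<Longrightarrow>
        u (y, t) - v (y, r) - (t - r)\<^sup>2 / (2 * \<epsilon>) - b r
          \<le> u (x, t1) - v (x, r1) - (t1 - r1)\<^sup>2 / (2 * \<epsilon>) - b r1"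
begin

lemma times_S: "{T0..S} \<subseteq> times_from T0 T1" "{T0<..<S} \<subseteq> open_times T0 T1"
proof -
  have "ereal t < T1" if "t \<le> S" for t using that S by (meson ereal_less_eq(3) le_less_trans)
  then show "{T0..S} \<subseteq> times_from T0 T1" "{T0<..<S} \<subseteq> open_times T0 T1"
    by (auto simp: times_from_def open_times_def)
qed

lemma bcont: "continuous_on A b"
  by (rule DERIV_continuous_on[of A b b']) (use b'(1) in \<open>auto intro: DERIV_subset\<close>)

text \<open>Sliding back with speed \<open>q\<close> along the arc chosen by the supersolution
  condition converts maximality at \<open>x\<close> into a lower bound for \<open>v\<close> on that
  arc with space slope \<open>P\<close>. The resulting subtangent has time slope
  \<open>a - l\<close>, and \<open>H \<gamma> 1 P = l / 2 - a\<close>, so the supersolution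
  inequality would give \<open>- l / 2 \<ge> 0\<close>.\<close>

lemma no_maximum_at_vertex:
  assumes xv: "x \<in> vertices E"
  shows False
proof -
  \<comment> \<open>\<open>a\<close> is the time slope of the penalization at the maximum;
    \<open>l\<close> is the amount by which the barrier lowers the slope on the side of
    \<open>v\<close>.\<close>
  define a where "a = (t1 - r1) / \<epsilon>"
  define l where "l = b' r1"
  have l: "l > 0" using b'(2)[of r1] tr \<eta> by (simp add: l_def)
  have ev: "\<forall>\<^sub>F t in at y. t \<in> {T0<..<S}" if "y \<in> {T0<..<S}" for y
    using that by (intro eventually_at_in_open') auto
  have "supertangent UNIV (\<lambda>t. u (x, t)) t1 (\<lambda>t. (t - r1)\<^sup>2 / (2 * \<epsilon>))"
    unfolding supertangent_def
  proof
    show "C1_near (\<lambda>t. (t - r1)\<^sup>2 / (2 * \<epsilon>)) t1"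
      by (intro C1_near_divide C1_near_power C1_near_diff C1_near_ident C1_near_const)
    show "\<forall>\<^sub>F t in at t1. u (x, t) - (t - r1)\<^sup>2 / (2 * \<epsilon>) \<le> u (x, t1) - (t1 - r1)\<^sup>2 / (2 * \<epsilon>)"
      using ev[of t1] tr
    proof (rule_tac eventually_mono)
      fix t assume "t \<in> {T0<..<S}"
      then show "u (x, t) - (t - r1)\<^sup>2 / (2 * \<epsilon>) \<le> u (x, t1) - (t1 - r1)\<^sup>2 / (2 * \<epsilon>)"
        using maximal[OF x, of t r1] tr by auto
    qed auto
  qed
  moreover have "deriv (\<lambda>t. (t - r1)\<^sup>2 / (2 * \<epsilon>)) t1 = a"
    using \<epsilon> by (intro DERIV_imp_deriv) (auto intro!: derivative_eq_intros simp: a_def power2_eq_square field_simps)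
  ultimately have ac: "a \<le> c x"
    using sub xv times_S(2) tr unfolding HJ_subsolution_def by force
  have "subtangent UNIV (\<lambda>t. v (x, t)) r1 (\<lambda>r. - ((t1 - r)\<^sup>2 / (2 * \<epsilon>)) - b r)"
    unfolding subtangent_def
  proof
    show "C1_near (\<lambda>r. - ((t1 - r)\<^sup>2 / (2 * \<epsilon>)) - b r) r1"
      by (intro C1_near_divide C1_near_power C1_near_diff C1_near_minus C1_near_ident C1_near_const bC1)
    show "\<forall>\<^sub>F r in at r1. v (x, r1) - (- ((t1 - r1)\<^sup>2 / (2 * \<epsilon>)) - b r1) \<le> v (x, r) - (- ((t1 - r)\<^sup>2 / (2 * \<epsilon>)) - b r)"
      using ev[of r1] tr
    proof (rule_tac eventually_mono)
      fix r assume "r \<in> {T0<..<S}"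
      then show "v (x, r1) - (- ((t1 - r1)\<^sup>2 / (2 * \<epsilon>)) - b r1) \<le> v (x, r) - (- ((t1 - r)\<^sup>2 / (2 * \<epsilon>)) - b r)"
        using maximal[OF x, of t1 r] tr by auto
    qed auto
  qed
  moreover have "deriv (\<lambda>r. - ((t1 - r)\<^sup>2 / (2 * \<epsilon>)) - b r) r1 = a - l"
    using \<epsilon> by (intro DERIV_imp_deriv)
      (auto intro!: derivative_eq_intros b'(1) simp: a_def l_def power2_eq_square field_simps)
  moreover have "a - l < c x" using ac l by simp
  ultimately have "\<exists>\<phi>. subtangent UNIV (\<lambda>t. v (x, t)) r1 \<phi> \<and> deriv \<phi> r1 < c x" by metis
  moreover have "r1 \<in> open_times T0 T1" using times_S(2) tr by auto
  ultimately have "\<exists>\<gamma>\<in>arcs_into E x. \<forall>\<phi>.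
      subtangent ({0..1} \<times> closure (open_times T0 T1)) (along v \<gamma>) (1, r1) \<phi> \<longrightarrow>
             partial_t \<phi> (1, r1) + H \<gamma> 1 (partial_s \<phi> (1, r1)) \<ge> 0"
    using super xv unfolding HJ_supersolution_def by simp
  then obtain \<gamma> where \<gamma>: "\<gamma> \<in> arcs_into E x"
    and good: "\<And>\<phi>. subtangent ({0..1} \<times> closure (open_times T0 T1)) (along v \<gamma>) (1, r1) \<phi> \<Longrightarrow>
             partial_t \<phi> (1, r1) + H \<gamma> 1 (partial_s \<phi> (1, r1)) \<ge> 0"
    by blast
  have E: "\<gamma> \<in> E" "\<gamma> 1 = x" using arcs_intoD[OF \<gamma>] by auto
  \<comment> \<open>The level exceeds \<open>- a\<close> by \<open>l / 2\<close>: a quarter of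
    \<open>l\<close> goes into freezing \<open>H\<close> at the vertex, another quarter absorbs the
    errors of the final estimate, and the half left over gives the contradiction.\<close>
  obtain P q where Pq: "q > 0" "H \<gamma> 1 P = l / 2 - a" "\<And>p. H \<gamma> 1 p \<ge> H \<gamma> 1 P + q * (p - P)"
    using subgradient_at_vertex[OF flux xv \<gamma> ac, of "l / 2"] l by (metis half_gt_zero)
  obtain M where M: "\<And>s s' t. s \<in> {0..1} \<Longrightarrow> s' \<in> {0..1} \<Longrightarrow> t \<in> times_from T0 T1 \<Longrightarrow>
      \<bar>u (\<gamma> s, t) - u (\<gamma> s', t)\<bar> \<le> M * \<bar>s - s'\<bar>"
    using Lip[OF E(1)] by blast
  obtain \<rho> where \<rho>: "\<rho> > 0" "\<rho> < 1"
    "\<And>s p. s \<in> {1-\<rho>..1} \<Longrightarrow> \<bar>p\<bar> \<le> M \<Longrightarrow> \<bar>H \<gamma> s p - H \<gamma> 1 p\<bar> < l / 4"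
    using H_uniform_at_end[OF E(1), of "l / 4" M] l by auto
  \<comment> \<open>The bound for the derivative of \<open>u\<close> in the direction
    \<open>(q, 1)\<close>, read off from the subgradient inequality at \<open>P\<close> with the
    loss \<open>l / 4\<close>.\<close>
  define L where "L = q * P + a - l / 4"
  define G where "G = {1-\<rho><..<1} \<times> {T0<..<S}"
  have G: "open G" "G \<subseteq> {0..1} \<times> {T0..S}" using \<rho>(2) by (auto simp: G_def intro: open_Times)
  have cont: "continuous_on ({0..1} \<times> times_from T0 T1) (along u \<gamma>)"
    using sub continuous_on_along E(1) unfolding HJ_subsolution_def by blast
  have contG: "continuous_on G (along u \<gamma>)"
    using continuous_on_subset[OF cont] G(2) times_S(1) by blast
  have slope: "q * partial_s \<psi> (s, t) + partial_t \<psi> (s, t) \<le> L"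
    if st: "(s, t) \<in> G" and \<psi>: "supertangent UNIV (along u \<gamma>) (s, t) \<psi>" for s t \<psi>
  proof -
    have s: "s \<in> {0<..<1}" "t \<in> open_times T0 T1" "s \<in> {1-\<rho>..1}" "t \<in> times_from T0 T1"
      using st \<rho>(2) times_S unfolding G_def by auto
    have "\<forall>\<^sub>F y in at s. y \<in> {0<..<1}" using s by (intro eventually_at_in_open') auto
    then have "\<forall>\<^sub>F y in at s. 0 * (y - s) - M * \<bar>y - s\<bar> \<le> along u \<gamma> (y, t) - along u \<gamma> (s, t)"
    proof (rule eventually_mono)
      fix y :: real assume "y \<in> {0<..<1}"
      then show "0 * (y - s) - M * \<bar>y - s\<bar> \<le> along u \<gamma> (y, t) - along u \<gamma> (s, t)"
        using M[of y s t] s by (auto simp: along_def)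
    qed
    from supertangent_partial_s_bound[OF \<psi> this]
    have p: "\<bar>partial_s \<psi> (s, t)\<bar> \<le> M" by simp
    have "partial_t \<psi> (s, t) + H \<gamma> s (partial_s \<psi> (s, t)) \<le> 0"
      using sub E(1) s \<psi> unfolding HJ_subsolution_def viscosity_subsolution_def by blast
    moreover have "H \<gamma> 1 (partial_s \<psi> (s, t)) - l / 4 \<le> H \<gamma> s (partial_s \<psi> (s, t))"
      using \<rho>(3)[OF s(3) p] by linarith
    ultimately show ?thesis
      using Pq(3)[of "partial_s \<psi> (s, t)"] unfolding L_def Pq(2) by (simp add: algebra_simps)
  qed
  define h0 where "h0 = min (\<rho> / (2 * q)) ((t1 - T0) / 2)"
  have h0: "h0 > 0" "q * h0 \<le> \<rho> / 2" "h0 < t1 - T0"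
  proof -
    have "h0 \<le> \<rho> / (2 * q)" unfolding h0_def by (rule min.cobounded1)
    then show "q * h0 \<le> \<rho> / 2" using Pq(1) by (simp add: field_simps)
    have "h0 \<le> (t1 - T0) / 2" unfolding h0_def by (rule min.cobounded2)
    then show "h0 < t1 - T0" using tr by simp
  qed (use \<rho> Pq tr in \<open>simp add: h0_def\<close>)
  \<comment> \<open>The characteristic ends at the vertex, outside the open set \<open>G\<close>. It
    is shifted inwards by \<open>d\<close>, and the Lipschitz bound in space pays for both end
    points.\<close>
  have transport: "u (x, t1) \<le> u (\<gamma> (1 - q * h), t1 - h) + L * h" if h: "0 \<le> h" "h \<le> h0" for h
  proof (rule field_le_epsilon)
    fix e :: real assume e: "e > 0"
    have M0: "M \<ge> 0" using M[of 0 1 T0] times_S(1) tr by fastforce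
    define d where "d = min (\<rho> / 4) (e / (2 * (M + 1)))"
    have d: "0 < d" "d \<le> \<rho> / 4" "2 * M * d \<le> e"
    proof -
      have "d \<le> e / (2 * (M + 1))" unfolding d_def by (rule min.cobounded2)
      then have "d * (2 * (M + 1)) \<le> e" using M0 by (simp add: pos_le_divide_eq)
      moreover have "0 < d" using \<rho> e M0 by (simp add: d_def)
      ultimately show "0 < d" "2 * M * d \<le> e" by (auto simp: algebra_simps)
      show "d \<le> \<rho> / 4" unfolding d_def by (rule min.cobounded1)
    qed
    have qh: "0 \<le> q * h" "q * h \<le> \<rho> / 2"
      using h h0 Pq(1) mult_left_mono[of h h0 q] by (simp, linarith)
    have "along u \<gamma> ((1 - d - q * h) + q * h, (t1 - h) + h) \<le> along u \<gamma> (1 - d - q * h, t1 - h) + L * h"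
    proof (rule viscosity_transport[OF G(1) contG slope])
      fix \<tau> assume \<tau>: "0 \<le> \<tau>" "\<tau> \<le> h"
      have "0 \<le> q * \<tau>" "q * \<tau> \<le> q * h" using \<tau> Pq(1) by auto
      then show "(1 - d - q * h + q * \<tau>, t1 - h + \<tau>) \<in> G"
        using d qh \<tau> h h0 \<rho> tr by (auto simp: G_def)
    qed (use h in auto)
    then have "u (\<gamma> (1 - d), t1) \<le> u (\<gamma> (1 - d - q * h), t1 - h) + L * h" by (simp add: along_def)
    moreover have "\<bar>u (\<gamma> 1, t1) - u (\<gamma> (1 - d), t1)\<bar> \<le> M * \<bar>1 - (1 - d)\<bar>"
      by (rule M) (use d \<rho> tr times_S in auto)
    moreover have "\<bar>u (\<gamma> (1 - d - q * h), t1 - h) - u (\<gamma> (1 - q * h), t1 - h)\<bar> \<le> M * \<bar>1 - d - q * h - (1 - q * h)\<bar>"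
      by (rule M) (use d \<rho> tr times_S qh h h0 in auto)
    ultimately show "u (x, t1) \<le> u (\<gamma> (1 - q * h), t1 - h) + L * h + e"
      using d E(2) by (auto simp: algebra_simps abs_le_iff)
  qed
  \<comment> \<open>The test function collects the terms of the maximality inequality that depend on
    \<open>r\<close>, plus a linear term in space with slope \<open>P\<close>.\<close>
  define \<phi> where "\<phi> = (\<lambda>z. P * (fst z - 1) - (t1 - snd z)\<^sup>2 / (2 * \<epsilon>) - b (snd z))"
  \<comment> \<open>The bounds \<open>l * \<epsilon> / 4\<close> and
    \<open>l * \<epsilon> / 8\<close> make both errors of the final estimate,
    \<open>h / (2 * \<epsilon>)\<close> and \<open>\<bar>r1 - r\<bar> / \<epsilon>\<close>, at most
    \<open>l / 8\<close>.\<close>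
  define h1 where "h1 = min h0 (l * \<epsilon> / 4)"
  define d where "d = Min {q * h1, l * \<epsilon> / 8, r1 - T0, S - r1}"
  have h1: "h1 > 0" "h1 \<le> h0" "h1 \<le> l * \<epsilon> / 4" using h0 l \<epsilon> by (auto simp: h1_def)
  have d: "d > 0" "d \<le> q * h1" "d \<le> l * \<epsilon> / 8" "d \<le> r1 - T0" "d \<le> S - r1"
  proof -
    show "d > 0" unfolding d_def using h1 l \<epsilon> Pq(1) tr by (subst Min_gr_iff) auto
  qed (unfold d_def, (rule Min_le; simp)+)
  have "subtangent ({0..1} \<times> closure (open_times T0 T1)) (along v \<gamma>) (1, r1) \<phi>"
    unfolding subtangent_def
  proof
    show "C1_near \<phi> (1, r1)" unfolding \<phi>_def
      by (intro C1_near_divide C1_near_power C1_near_diff C1_near_minus C1_near_mult C1_near_const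
          C1_near_fst C1_near_snd bC1)
    have "along v \<gamma> (1, r1) - \<phi> (1, r1) \<le> along v \<gamma> y - \<phi> y"
      if y: "y \<in> {0..1} \<times> closure (open_times T0 T1)" "dist y (1, r1) < d" for y
    proof -
      obtain s r where y_eq: "y = (s, r)" by (cases y)
      have "\<bar>s - 1\<bar> < d" "\<bar>r - r1\<bar> < d"
        using y(2) dist_fst_le[of y "(1, r1)"] dist_snd_le[of y "(1, r1)"] by (auto simp: y_eq dist_real_def)
      then have r: "r \<in> {T0..S}" "s \<in> {0..1}" "1 - s < q * h1" "\<bar>r - r1\<bar> \<le> l * \<epsilon> / 8"
        using d y(1) by (auto simp: y_eq)
      \<comment> \<open>The duration of the characteristic that starts at parameter \<open>s\<close>
        and reaches the vertex at time \<open>t1\<close>.\<close>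
      define h where "h = (1 - s) / q"
      have h: "0 \<le> h" "h \<le> h1" "s = 1 - q * h" using r Pq(1) by (auto simp: h_def field_simps)
      have "u (x, t1) \<le> u (\<gamma> s, t1 - h) + L * h" using transport[of h] h h1 by auto
      moreover have "u (\<gamma> s, t1 - h) - v (\<gamma> s, r) - (t1 - h - r)\<^sup>2 / (2 * \<epsilon>) - b r
          \<le> u (x, t1) - v (x, r1) - (t1 - r1)\<^sup>2 / (2 * \<epsilon>) - b r1"
        using maximal[OF arc_mem_network[OF E(1) r(2)], of "t1 - h" r] r(1) h h1 h0 tr by auto
      moreover have "0 \<le> (P * q - L) * h + ((t1 - r)\<^sup>2 / (2 * \<epsilon>) - (t1 - h - r)\<^sup>2 / (2 * \<epsilon>))"
      proof -
        have "(P * q - L) * h + ((t1 - r)\<^sup>2 / (2 * \<epsilon>) - (t1 - h - r)\<^sup>2 / (2 * \<epsilon>))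
            = h * (l / 4 - a + (t1 - r) / \<epsilon> - h / (2 * \<epsilon>))"
          using \<epsilon> by (simp add: L_def field_simps power2_eq_square)
        also have "\<dots> = h * (l / 4 + (r1 - r) / \<epsilon> - h / (2 * \<epsilon>))"
          by (simp add: a_def diff_divide_distrib)
        also have "\<dots> \<ge> 0"
        proof -
          have "\<bar>(r1 - r) / \<epsilon>\<bar> \<le> l / 8" using r(4) \<epsilon> by (simp add: abs_minus_commute field_simps)
          moreover have "h / (2 * \<epsilon>) \<le> l / 8" using h h1 \<epsilon> by (simp add: field_simps)
          ultimately have "0 \<le> l / 4 + (r1 - r) / \<epsilon> - h / (2 * \<epsilon>)" by linarith
          then show ?thesis using h(1) by (intro mult_nonneg_nonneg)
        qed
        finally show ?thesis .
      qed
      ultimately show ?thesis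
        using E(2) unfolding along_def \<phi>_def y_eq by (simp add: h(3) algebra_simps)
    qed
    then show "\<forall>\<^sub>F y in at (1, r1) within {0..1} \<times> closure (open_times T0 T1).
        along v \<gamma> (1, r1) - \<phi> (1, r1) \<le> along v \<gamma> y - \<phi> y"
      using d(1) unfolding eventually_at by blast
  qed
  from good[OF this] have "partial_t \<phi> (1, r1) + H \<gamma> 1 (partial_s \<phi> (1, r1)) \<ge> 0" .
  moreover have "partial_s \<phi> (1, r1) = P"
    unfolding partial_s_def \<phi>_def by (intro DERIV_imp_deriv) (auto intro!: derivative_eq_intros)
  moreover have "partial_t \<phi> (1, r1) = a - l"
    unfolding partial_t_def \<phi>_def using \<epsilon>
    by (intro DERIV_imp_deriv) (auto intro!: derivative_eq_intros b'(1) simp: a_def l_def power2_eq_square field_simps)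
  ultimately show False using Pq(2) l by auto
qed

text \<open>Here both points move on one arc. The subsolution inequality and the linear growth of
  \<open>H\<close> bound the slope \<open>\<pi>\<close> of the space penalization independently of
  \<open>n\<close>, so uniform continuity of \<open>H\<close> on a compact set makes the two
  Hamiltonians differ by less than \<open>\<eta> / 4\<close>.\<close>

lemma no_maximum_in_interior:
  assumes \<gamma>: "\<gamma> \<in> E" and s1: "s1 \<in> {0<..<1}" "x = \<gamma> s1"
  shows False
proof -
  obtain \<kappa> C where \<kappa>: "\<kappa> > 0" "C \<ge> 0" "\<And>s p. s \<in> {0..1} \<Longrightarrow> \<kappa> * \<bar>p\<bar> - C \<le> H \<gamma> s p"
    using H_linear_growth[OF \<gamma>] by metis
  \<comment> \<open>The bracket bounds the time derivatives that occur below; the summand 2 makes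
    room for the slope \<open>2 * (s - s1)\<close> of the localizing term.\<close>
  define R where "R = ((S - T0) / \<epsilon> + 2 * (S - T0) + C) / \<kappa> + 2"
  have "uniformly_continuous_on ({0..1} \<times> {-R..R}) (\<lambda>(s, p). H \<gamma> s p)"
    by (intro compact_uniformly_continuous continuous_on_subset[OF H_continuous[OF \<gamma>]] compact_Times) auto
  then obtain d0 where d0: "d0 > 0" "\<And>y z. y \<in> {0..1} \<times> {-R..R} \<Longrightarrow> z \<in> {0..1} \<times> {-R..R} \<Longrightarrow> dist y z < d0
      \<Longrightarrow> dist (case y of (s, p) \<Rightarrow> H \<gamma> s p) (case z of (s, p) \<Rightarrow> H \<gamma> s p) < \<eta> / 4"
    using \<eta> unfolding uniformly_continuous_on_def by (metis zero_less_divide_iff zero_less_numeral)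
  define d where "d = Min {s1, 1 - s1, t1 - T0, S - t1, r1 - T0, S - r1, \<eta> / 8, d0 / 4}"
  have d: "d > 0" "d \<le> s1" "d \<le> 1 - s1" "d \<le> t1 - T0" "d \<le> S - t1" "d \<le> r1 - T0" "d \<le> S - r1" "d \<le> \<eta> / 8" "d \<le> d0 / 4"
  proof -
    show "d > 0" unfolding d_def using s1(1) tr \<eta> d0(1) by (subst Min_gr_iff) auto
  qed (unfold d_def, (rule Min_le; simp)+)
  define K where "K = {0..1::real} \<times> {0..1::real} \<times> {T0..S} \<times> {T0..S}"
  \<comment> \<open>The squares centred at \<open>s1\<close>, \<open>t1\<close>, \<open>r1\<close>
    make the maximum strict, as required for the convergence of the penalized maxima; near the
    maximum their slopes are below \<open>2 * d\<close>.\<close>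
  define f where "f = (\<lambda>(s, s', t, r). u (\<gamma> s, t) - v (\<gamma> s', r) - (t - r)\<^sup>2 / (2 * \<epsilon>) - b r
      - (s - s1)\<^sup>2 - (t - t1)\<^sup>2 - (r - r1)\<^sup>2)"
  define g where "g = (\<lambda>(s, s', t :: real, r :: real). (s - s')\<^sup>2 / 2 :: real)"
  have cu: "continuous_on ({0..1} \<times> {T0..S}) (along u \<gamma>)"
    and cv: "continuous_on ({0..1} \<times> {T0..S}) (along v \<gamma>)"
    using sub super continuous_on_along[OF _ \<gamma>] times_S(1)
    unfolding HJ_subsolution_def HJ_supersolution_def
    by (meson Sigma_mono continuous_on_subset order_refl)+
  have "continuous_on K (\<lambda>z. along u \<gamma> (fst z, fst (snd (snd z))))"
    by (rule continuous_on_compose2[OF cu]) (auto intro!: continuous_intros simp: K_def)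
  moreover have "continuous_on K (\<lambda>z. along v \<gamma> (fst (snd z), snd (snd (snd z))))"
    by (rule continuous_on_compose2[OF cv]) (auto intro!: continuous_intros simp: K_def)
  moreover have "continuous_on K (\<lambda>z. b (snd (snd (snd z))))"
    by (rule continuous_on_compose2[OF bcont[of UNIV]]) (auto intro!: continuous_intros)
  ultimately have fcont: "continuous_on K f"
    unfolding f_def case_prod_unfold along_def fst_conv snd_conv using \<epsilon>
    by (intro continuous_intros) auto
  have gcont: "continuous_on K g"
    unfolding g_def case_prod_unfold by (intro continuous_intros) auto
  have K: "compact K" by (auto simp: K_def intro!: compact_Times)
  obtain n z where z: "z \<in> K" "dist z (s1, s1, t1, r1) < d"
    "\<And>y. y \<in> K \<Longrightarrow> f y - real n * g y \<le> f z - real n * g z"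
  proof (rule penalized_maxima_converge[OF K fcont gcont _ _ _ _ d(1)])
    show "(s1, s1, t1, r1) \<in> K" using s1 tr by (auto simp: K_def)
    show "f z < f (s1, s1, t1, r1)" if z: "z \<in> K" "g z = 0" "z \<noteq> (s1, s1, t1, r1)" for z
    proof -
      obtain s s' t r where z_eq: "z = (s, s', t, r)" by (cases z) auto
      have s': "s' = s" using z(2) by (auto simp: z_eq g_def)
      have "(s - s1)\<^sup>2 + (t - t1)\<^sup>2 + (r - r1)\<^sup>2 > 0"
        using z(3) by (auto simp: z_eq s' add_pos_nonneg add_nonneg_pos)
      moreover have "u (\<gamma> s, t) - v (\<gamma> s, r) - (t - r)\<^sup>2 / (2 * \<epsilon>) - b r
          \<le> u (x, t1) - v (x, r1) - (t1 - r1)\<^sup>2 / (2 * \<epsilon>) - b r1"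
        using z(1) by (intro maximal arc_mem_network[OF \<gamma>]) (auto simp: K_def z_eq)
      ultimately show ?thesis by (simp add: f_def z_eq s' s1(2))
    qed
    show "0 \<le> g z" for z by (simp add: g_def split: prod.split)
    show "g (s1, s1, t1, r1) = 0" by (simp add: g_def)
  qed (rule that)
  obtain s s' t r where z_eq: "z = (s, s', t, r)" by (cases z) auto
  have near: "\<bar>s - s1\<bar> < d" "\<bar>s' - s1\<bar> < d" "\<bar>t - t1\<bar> < d" "\<bar>r - r1\<bar> < d"
  proof -
    have 1: "dist (s', t, r) (s1, t1, r1) < d" "\<bar>s - s1\<bar> < d"
      using z(2) dist_snd_le[of z "(s1, s1, t1, r1)"] dist_fst_le[of z "(s1, s1, t1, r1)"]
      by (auto simp: z_eq dist_real_def)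
    have 2: "dist (t, r) (t1, r1) < d" "\<bar>s' - s1\<bar> < d"
      using 1(1) dist_snd_le[of "(s', t, r)" "(s1, t1, r1)"] dist_fst_le[of "(s', t, r)" "(s1, t1, r1)"]
      by (auto simp: dist_real_def)
    show "\<bar>s - s1\<bar> < d" "\<bar>s' - s1\<bar> < d" "\<bar>t - t1\<bar> < d" "\<bar>r - r1\<bar> < d"
      using 1 2 dist_snd_le[of "(t, r)" "(t1, r1)"] dist_fst_le[of "(t, r)" "(t1, r1)"]
      by (auto simp: dist_real_def)
  qed
  then have int: "s \<in> {0<..<1}" "s' \<in> {0<..<1}" "t \<in> {T0<..<S}" "r \<in> {T0<..<S}"
    using d by auto
  then have times: "t \<in> open_times T0 T1" "r \<in> open_times T0 T1" using times_S by auto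
  define \<pi> where "\<pi> = real n * (s - s')"
  define \<psi> where "\<psi> = (\<lambda>y. real n * ((fst y - s')\<^sup>2 / 2) + (snd y - r)\<^sup>2 / (2 * \<epsilon>) + (fst y - s1)\<^sup>2 + (snd y - t1)\<^sup>2)"
  define \<phi> where "\<phi> = (\<lambda>y. - (real n * ((s - fst y)\<^sup>2 / 2)) - (t - snd y)\<^sup>2 / (2 * \<epsilon>) - b (snd y) - (snd y - r1)\<^sup>2)"
  have ev: "\<forall>\<^sub>F y in at p. y \<in> {0<..<1} \<times> {T0<..<S}" if "p \<in> {0<..<1} \<times> {T0<..<S}" for p :: "real \<times> real"
    using that by (intro eventually_at_in_open') (auto intro: open_Times)
  have "supertangent UNIV (along u \<gamma>) (s, t) \<psi>"
    unfolding supertangent_def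
  proof
    show "C1_near \<psi> (s, t)" unfolding \<psi>_def
      by (intro C1_near_divide C1_near_power C1_near_diff C1_near_add C1_near_mult C1_near_const
          C1_near_fst C1_near_snd)
    have "(s, t) \<in> {0<..<1} \<times> {T0<..<S}" using int by auto
    from ev[OF this] show "\<forall>\<^sub>F y in at (s, t). along u \<gamma> y - \<psi> y \<le> along u \<gamma> (s, t) - \<psi> (s, t)"
    proof (rule eventually_mono)
      fix y :: "real \<times> real" assume y: "y \<in> {0<..<1} \<times> {T0<..<S}"
      then have "(fst y, s', snd y, r) \<in> K" using int by (auto simp: K_def)
      from z(3)[OF this] show "along u \<gamma> y - \<psi> y \<le> along u \<gamma> (s, t) - \<psi> (s, t)"
        by (simp add: f_def g_def z_eq \<psi>_def along_def case_prod_unfold)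
    qed
  qed
  then have "partial_t \<psi> (s, t) + H \<gamma> s (partial_s \<psi> (s, t)) \<le> 0"
    using sub \<gamma> int times unfolding HJ_subsolution_def viscosity_subsolution_def by blast
  moreover have "partial_s \<psi> (s, t) = \<pi> + 2 * (s - s1)"
    unfolding partial_s_def \<psi>_def fst_conv snd_conv
    by (intro DERIV_imp_deriv) (auto intro!: derivative_eq_intros simp: \<pi>_def field_simps)
  moreover have "partial_t \<psi> (s, t) = (t - r) / \<epsilon> + 2 * (t - t1)"
    unfolding partial_t_def \<psi>_def fst_conv snd_conv using \<epsilon>
    by (intro DERIV_imp_deriv) (auto intro!: derivative_eq_intros simp: power2_eq_square field_simps)
  ultimately have sub_ineq: "(t - r) / \<epsilon> + 2 * (t - t1) + H \<gamma> s (\<pi> + 2 * (s - s1)) \<le> 0" by simp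
  have "subtangent UNIV (along v \<gamma>) (s', r) \<phi>"
    unfolding subtangent_def
  proof
    show "C1_near \<phi> (s', r)" unfolding \<phi>_def
      by (intro C1_near_divide C1_near_power C1_near_diff C1_near_add C1_near_mult C1_near_minus C1_near_const
          C1_near_fst C1_near_snd bC1)
    have "(s', r) \<in> {0<..<1} \<times> {T0<..<S}" using int by auto
    from ev[OF this] show "\<forall>\<^sub>F y in at (s', r). along v \<gamma> (s', r) - \<phi> (s', r) \<le> along v \<gamma> y - \<phi> y"
    proof (rule eventually_mono)
      fix y :: "real \<times> real" assume y: "y \<in> {0<..<1} \<times> {T0<..<S}"
      then have "(s, fst y, t, snd y) \<in> K" using int by (auto simp: K_def)
      from z(3)[OF this] show "along v \<gamma> (s', r) - \<phi> (s', r) \<le> along v \<gamma> y - \<phi> y"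
        by (simp add: f_def g_def z_eq \<phi>_def along_def case_prod_unfold)
    qed
  qed
  then have "partial_t \<phi> (s', r) + H \<gamma> s' (partial_s \<phi> (s', r)) \<ge> 0"
    using super \<gamma> int times unfolding HJ_supersolution_def viscosity_supersolution_def by blast
  moreover have "partial_s \<phi> (s', r) = \<pi>"
    unfolding partial_s_def \<phi>_def fst_conv snd_conv
    by (intro DERIV_imp_deriv) (auto intro!: derivative_eq_intros simp: \<pi>_def field_simps)
  moreover have "partial_t \<phi> (s', r) = (t - r) / \<epsilon> - b' r - 2 * (r - r1)"
    unfolding partial_t_def \<phi>_def fst_conv snd_conv using \<epsilon>
    by (intro DERIV_imp_deriv) (auto intro!: derivative_eq_intros b'(1) simp: power2_eq_square field_simps)
  ultimately have super_ineq: "(t - r) / \<epsilon> - b' r - 2 * (r - r1) + H \<gamma> s' \<pi> \<ge> 0" by simp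
  have \<pi>_bound: "\<bar>\<pi> + 2 * (s - s1)\<bar> \<le> R - 2"
  proof -
    have "\<kappa> * \<bar>\<pi> + 2 * (s - s1)\<bar> - C \<le> - ((t - r) / \<epsilon>) - 2 * (t - t1)"
      using \<kappa>(3)[of s "\<pi> + 2 * (s - s1)"] sub_ineq int by auto
    also have "- ((t - r) / \<epsilon>) \<le> (S - T0) / \<epsilon>"
    proof -
      have "(r - t) / \<epsilon> \<le> (S - T0) / \<epsilon>" using int \<epsilon> by (intro divide_right_mono) auto
      then show ?thesis by (simp add: diff_divide_distrib)
    qed
    finally have "\<kappa> * \<bar>\<pi> + 2 * (s - s1)\<bar> \<le> (S - T0) / \<epsilon> + 2 * (S - T0) + C" using int tr by auto
    then show ?thesis using \<kappa>(1) by (simp add: R_def field_simps)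
  qed
  have "\<bar>s - s1\<bar> \<le> 1" using int s1 by auto
  then have "(s, \<pi> + 2 * (s - s1)) \<in> {0..1} \<times> {-R..R}" "(s', \<pi>) \<in> {0..1} \<times> {-R..R}"
    using \<pi>_bound int by auto
  moreover have "dist (s, \<pi> + 2 * (s - s1)) (s', \<pi>) < d0"
  proof -
    have "dist (s, \<pi> + 2 * (s - s1)) (s', \<pi>) \<le> \<bar>s - s'\<bar> + \<bar>2 * (s - s1)\<bar>"
      using sqrt_sum_squares_le_sum_abs[of "s - s'" "2 * (s - s1)"] by (simp add: dist_Pair_Pair dist_real_def)
    also have "\<dots> < 4 * d" using near by (auto simp: abs_if split: if_splits)
    finally show ?thesis using d by simp
  qed
  ultimately have "\<bar>H \<gamma> s (\<pi> + 2 * (s - s1)) - H \<gamma> s' \<pi>\<bar> < \<eta> / 4"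
    using d0(2) by (fastforce simp: dist_real_def)
  moreover have "b' r \<ge> \<eta>" using b'(2)[of r] int by auto
  \<comment> \<open>The gap \<open>\<eta>\<close> outweighs the \<open>\<eta> / 4\<close> from
    \<open>H\<close> together with the \<open>4 * d \<le> \<eta> / 2\<close> from the localization
    in time.\<close>
  ultimately have "H \<gamma> s' \<pi> - H \<gamma> s (\<pi> + 2 * (s - s1)) < b' r - 3 * (\<eta> / 4)" by linarith
  moreover have "- (r - r1) < d" "- (t - t1) < d" using near by linarith+
  ultimately show False using sub_ineq super_ineq d(8) \<eta> by argo
qed

lemma no_interior_maximum: False
  using network_cases[OF x] no_maximum_at_vertex no_maximum_in_interior by metis

end

text \<open>If \<open>u > v\<close> somewhere, the functional with doubled time has a positive
  maximum on a compact set. The barrier excludes late times, continuity and \<open>init\<close>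
  exclude the initial time, and an interior maximum is impossible.\<close>

theorem comparison:
  assumes flux: "flux_limiter E H c"
    and sub: "HJ_subsolution E H c T0 T1 u" and super: "HJ_supersolution E H c T0 T1 v"
    and Lip: "\<And>\<gamma>. \<gamma> \<in> E \<Longrightarrow> \<exists>M. \<forall>s\<in>{0..1}. \<forall>s'\<in>{0..1}. \<forall>t\<in>times_from T0 T1.
               \<bar>u (\<gamma> s, t) - u (\<gamma> s', t)\<bar> \<le> M * \<bar>s - s'\<bar>"
    and init: "\<And>x. x \<in> network_set E \<Longrightarrow> u (x, T0) \<le> v (x, T0)"
    and x0: "x0 \<in> network_set E" and t0: "t0 \<in> times_from T0 T1"
  shows "u (x0, t0) \<le> v (x0, t0)"
proof (rule ccontr)
  assume "\<not> u (x0, t0) \<le> v (x0, t0)"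
  define m where "m = u (x0, t0) - v (x0, t0)"
  have m: "m > 0" using \<open>\<not> _\<close> by (simp add: m_def)
  have "T0 \<le> t0" "ereal t0 < T1" using t0 by (auto simp: times_from_def)
  then obtain S where S: "t0 < S" "ereal S < T1" using ereal_dense2 by force
  \<comment> \<open>An intermediate time: the barrier is effective from \<open>S'\<close> on, and
    the gap between \<open>S'\<close> and \<open>S\<close> accommodates the difference of the two
    times.\<close>
  define S' where "S' = (t0 + S) / 2"
  have S': "t0 < S'" "S' < S" "T0 < S'" using S \<open>T0 \<le> t0\<close> by (auto simp: S'_def)
  define K where "K = network_set E \<times> {T0..S}"
  have K: "compact K" unfolding K_def by (intro compact_Times compact_network_set) auto
  have "ereal t < T1" if "t \<le> S" for t using that S(2) by (meson ereal_less_eq(3) le_less_trans)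
  then have "K \<subseteq> network_set E \<times> times_from T0 T1" by (auto simp: K_def times_from_def)
  then have cont: "continuous_on K u" "continuous_on K v"
    using sub super unfolding HJ_subsolution_def HJ_supersolution_def by (auto elim: continuous_on_subset)
  obtain B1 where B1: "\<And>z. z \<in> K \<Longrightarrow> \<bar>u z\<bar> \<le> B1"
    using compact_imp_bounded[OF compact_continuous_image[OF cont(1) K]] unfolding bounded_iff by auto
  obtain B2 where B2: "\<And>z. z \<in> K \<Longrightarrow> \<bar>v z\<bar> \<le> B2"
    using compact_imp_bounded[OF compact_continuous_image[OF cont(2) K]] unfolding bounded_iff by auto
  define B where "B = B1 + B2 + 1"
  have B: "u z - v y \<le> B" if "z \<in> K" "y \<in> K" for z y
    using B1[OF that(1)] B2[OF that(2)] by (auto simp: B_def)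
  have Bpos: "B > 0" using B1[of "(x0, t0)"] B2[of "(x0, t0)"] x0 S \<open>T0 \<le> t0\<close> by (force simp: B_def K_def)
  obtain \<delta>1 where \<delta>1: "\<delta>1 > 0" "\<And>y z. y \<in> K \<Longrightarrow> z \<in> K \<Longrightarrow> dist y z < \<delta>1 \<Longrightarrow> dist (u y) (u z) < m / 8"
    using compact_uniformly_continuous[OF cont(1) K] m unfolding uniformly_continuous_on_def
    by (metis zero_less_divide_iff zero_less_numeral)
  obtain \<delta>2 where \<delta>2: "\<delta>2 > 0" "\<And>y z. y \<in> K \<Longrightarrow> z \<in> K \<Longrightarrow> dist y z < \<delta>2 \<Longrightarrow> dist (v y) (v z) < m / 8"
    using compact_uniformly_continuous[OF cont(2) K] m unfolding uniformly_continuous_on_def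
    by (metis zero_less_divide_iff zero_less_numeral)
  define \<delta> where "\<delta> = min (S - S') (min \<delta>1 \<delta>2)"
  have \<delta>: "\<delta> > 0" "\<delta> \<le> S - S'" "\<delta> \<le> \<delta>1" "\<delta> \<le> \<delta>2" using \<delta>1 \<delta>2 S' by (auto simp: \<delta>_def)
  \<comment> \<open>Chosen so that the penalty can stay below \<open>B\<close> only when
    \<open>\<bar>t - r\<bar> < \<delta>\<close>.\<close>
  define \<epsilon> where "\<epsilon> = \<delta>\<^sup>2 / (4 * B)"
  have \<epsilon>: "\<epsilon> > 0" using \<delta> Bpos by (simp add: \<epsilon>_def)
  define \<eta> where "\<eta> = m / 4 / (S' - T0)"
  have \<eta>: "\<eta> > 0" using m S' by (simp add: \<eta>_def)
  obtain n where n: "n > 0" "((t0 - T0) / (S' - T0)) ^ n < m / (4 * B)"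
    using small_power_exists[of "(t0 - T0) / (S' - T0)" "m / (4 * B)"] S' m Bpos \<open>T0 \<le> t0\<close> by auto
  \<comment> \<open>The linear part contributes at most \<open>m / 4\<close> up to
    \<open>S'\<close>. The power part contributes less than \<open>m / 4\<close> at
    \<open>t0\<close>, but makes \<open>b\<close> exceed \<open>B\<close>, a bound for
    \<open>u z - v y\<close> over all pairs in \<open>K\<close>, from \<open>S'\<close> on.\<close>
  define b where "b = (\<lambda>r. \<eta> * (r - T0) + B * ((r - T0) / (S' - T0)) ^ n)"
  define b' where "b' = (\<lambda>r. \<eta> + B * (real n * ((r - T0) / (S' - T0)) ^ (n - 1) * (1 / (S' - T0))))"
  have pw: "((\<lambda>r. ((r - T0) / (S' - T0)) ^ n) has_real_derivative
      real n * ((r - T0) / (S' - T0)) ^ (n - 1) * (1 / (S' - T0))) (at r)" for r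
    by (rule DERIV_cong, rule DERIV_power, rule DERIV_cdivide) (auto intro!: derivative_eq_intros)
  have b': "(b has_real_derivative b' r) (at r)" for r
    unfolding b_def b'_def by (rule derivative_eq_intros pw refl | simp)+
  have b'_ge: "\<eta> \<le> b' r" if "T0 \<le> r" for r
    using that S' Bpos by (auto simp: b'_def)
  have bC1: "C1_near b r" "C1_near (\<lambda>z. b (snd z)) z" for r and z :: "real \<times> real"
    unfolding b_def by (intro C1_near_divide C1_near_power C1_near_diff C1_near_add C1_near_mult C1_near_const
          C1_near_ident C1_near_snd)+
  have bcont: "continuous_on A b" for A
    unfolding b_def using S' by (intro continuous_intros) auto
  have b_nonneg: "0 \<le> b r" if "T0 \<le> r" for r using that S' \<eta> Bpos by (auto simp: b_def)
  have b_late: "B < b r" if "S' \<le> r" for r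
  proof -
    have "1 \<le> ((r - T0) / (S' - T0)) ^ n" using that S' by (intro one_le_power) simp
    then have "B * 1 \<le> B * ((r - T0) / (S' - T0)) ^ n" using Bpos by (intro mult_left_mono) auto
    moreover have "0 < \<eta> * (r - T0)" using \<eta> that S' by simp
    ultimately show ?thesis by (simp add: b_def)
  qed
  have b_t0: "b t0 < m / 2"
  proof -
    have "\<eta> * (t0 - T0) \<le> \<eta> * (S' - T0)" using \<eta> S' by (intro mult_left_mono) auto
    also have "\<dots> = m / 4"
    proof -
      have "\<eta> * D = m / 4" if "\<eta> = m / 4 / D" "D \<noteq> 0" for D :: real using that by simp
      then show ?thesis using S' \<eta>_def by simp
    qed
    finally have "\<eta> * (t0 - T0) \<le> m / 4" .
    moreover have "B * ((t0 - T0) / (S' - T0)) ^ n < m / 4" using n(2) Bpos by (simp add: field_simps)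
    ultimately show ?thesis by (simp add: b_def)
  qed
  define Q where "Q = network_set E \<times> {T0..S} \<times> {T0..S}"
  define f where "f = (\<lambda>z. u (fst z, fst (snd z)) - v (fst z, snd (snd z))
      - (fst (snd z) - snd (snd z))\<^sup>2 / (2 * \<epsilon>) - b (snd (snd z)))"
  have Q: "compact Q" unfolding Q_def by (intro compact_Times compact_network_set) auto
  have z0: "(x0, t0, t0) \<in> Q" using x0 S \<open>T0 \<le> t0\<close> by (auto simp: Q_def)
  have "continuous_on Q f"
    unfolding f_def using \<epsilon>
    by (intro continuous_intros continuous_on_compose2[OF cont(1)] continuous_on_compose2[OF cont(2)]
        continuous_on_compose2[OF bcont[of UNIV]]) (auto simp: Q_def K_def)
  then obtain z where z: "z \<in> Q" "\<And>y. y \<in> Q \<Longrightarrow> f y \<le> f z"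
    using continuous_attains_sup[OF Q, of f] z0 by blast
  obtain x t r where z_eq: "z = (x, t, r)" by (cases z)
  have in_K: "x \<in> network_set E" "t \<in> {T0..S}" "r \<in> {T0..S}" "(x, t) \<in> K" "(x, r) \<in> K" "(x, T0) \<in> K"
    using z(1) by (auto simp: Q_def K_def z_eq)
  have fz: "m / 2 < f z" using z(2)[OF z0] b_t0 by (simp add: f_def m_def)
  have fz_eq: "f z = u (x, t) - v (x, r) - (t - r)\<^sup>2 / (2 * \<epsilon>) - b r" by (simp add: f_def z_eq)
  have pos: "0 \<le> (t - r)\<^sup>2 / (2 * \<epsilon>)" "0 \<le> b r" using \<epsilon> b_nonneg in_K by auto
  have "r < S'"
  proof (rule ccontr)
    assume "\<not> r < S'"
    then show False using b_late[of r] B[OF in_K(4,5)] fz fz_eq pos m by auto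
  qed
  have close: "\<bar>t - r\<bar> < \<delta>"
  proof -
    have "(t - r)\<^sup>2 / (2 * \<epsilon>) < B" using B[OF in_K(4,5)] fz fz_eq pos m by auto
    then have "(t - r)\<^sup>2 < B * (2 * \<epsilon>)" using \<epsilon> by (simp add: field_simps)
    also have "\<dots> = \<delta>\<^sup>2 / 2" using Bpos by (simp add: \<epsilon>_def)
    also have "\<dots> < \<delta>\<^sup>2" using \<delta> by simp
    finally have "\<bar>t - r\<bar>\<^sup>2 < \<delta>\<^sup>2" by simp
    then show ?thesis using \<delta>(1) by (simp add: power2_less_imp_less)
  qed
  have "t < S" using close \<open>r < S'\<close> \<delta>(2) by auto
  \<comment> \<open>At \<open>t = T0\<close> the order of the initial data bounds \<open>f z\<close>
    by the oscillation of \<open>v\<close>, less than \<open>m / 8\<close>, whereas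
    \<open>f z > m / 2\<close>.\<close>
  have "T0 < t"
  proof (rule ccontr)
    assume "\<not> T0 < t"
    then have "t = T0" using in_K by auto
    then have "dist (v (x, T0)) (v (x, r)) < m / 8"
      using close \<delta> by (intro \<delta>2(2) in_K) (auto simp: dist_Pair_Pair dist_real_def)
    then show False using init[OF in_K(1)] fz fz_eq pos m \<open>t = T0\<close> by (auto simp: dist_real_def)
  qed
  have "T0 < r"
  proof (rule ccontr)
    assume "\<not> T0 < r"
    then have "r = T0" using in_K by auto
    then have "dist (u (x, T0)) (u (x, t)) < m / 8"
      using close \<delta> by (intro \<delta>1(2) in_K) (auto simp: dist_Pair_Pair dist_real_def)
    then show False using init[OF in_K(1)] fz fz_eq pos m \<open>r = T0\<close> by (auto simp: dist_real_def)
  qed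
  show False
  proof (rule no_interior_maximum[OF flux sub super Lip S(2) \<epsilon> \<eta> bC1 b' b'_ge \<open>T0 < t\<close> \<open>t < S\<close> \<open>T0 < r\<close> _ in_K(1)])
    show "r < S" using \<open>r < S'\<close> S' by simp
    show "u (y, t') - v (y, r') - (t' - r')\<^sup>2 / (2 * \<epsilon>) - b r'
        \<le> u (x, t) - v (x, r) - (t - r)\<^sup>2 / (2 * \<epsilon>) - b r"
      if "y \<in> network_set E" "t' \<in> {T0..S}" "r' \<in> {T0..S}" for y t' r'
      using z(2)[of "(y, t', r')"] that fz_eq by (simp add: f_def Q_def)
  qed auto
qed

end

section \<open>The class of subsolutions below an initial datum\<close>

lemma open_times_open: "open (open_times T0 T1)"
proof -
  have "open {t::real. ereal t < T1}"
  proof (cases T1)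
    case (real r)
    then have "{t::real. ereal t < T1} = {..<r}" by auto
    then show ?thesis by simp
  qed auto
  then have "open ({T0<..} \<inter> {t. ereal t < T1})" by (intro open_Int open_greaterThan)
  moreover have "{T0<..} \<inter> {t. ereal t < T1} = open_times T0 T1" by (auto simp: open_times_def)
  ultimately show ?thesis by (simp only:)
qed

lemma times_from_le: "t \<in> times_from T0 T1 \<Longrightarrow> T0 \<le> r \<Longrightarrow> r \<le> t \<Longrightarrow> r \<in> times_from T0 T1"
  by (auto simp: times_from_def) (meson ereal_less_eq(3) le_less_trans)

lemma times_from_later:
  assumes "t \<in> times_from T0 T1"
  obtains h where "h > 0" "t + h \<in> times_from T0 T1"
proof -
  obtain S where "ereal t < ereal S" "ereal S < T1"
    using assms ereal_dense2[of "ereal t" T1] by (auto simp: times_from_def)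
  then show thesis using that[of "S - t"] assms by (auto simp: times_from_def)
qed

lemma L_lipschitz_on_prodI:
  fixes f :: "real \<times> real \<Rightarrow> real"
  assumes "M \<ge> 0" "N \<ge> 0"
    and "\<And>s s' t. s \<in> A \<Longrightarrow> s' \<in> A \<Longrightarrow> t \<in> B \<Longrightarrow> \<bar>f (s, t) - f (s', t)\<bar> \<le> M * \<bar>s - s'\<bar>"
    and "\<And>s t t'. s \<in> A \<Longrightarrow> t \<in> B \<Longrightarrow> t' \<in> B \<Longrightarrow> \<bar>f (s, t) - f (s, t')\<bar> \<le> N * \<bar>t - t'\<bar>"
  shows "(M + N)-lipschitz_on (A \<times> B) f"
proof (rule lipschitz_onI)
  fix y z assume yz: "y \<in> A \<times> B" "z \<in> A \<times> B"
  obtain s t s' t' where eq: "y = (s, t)" "z = (s', t')" by (cases y, cases z)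
  have "\<bar>f y - f z\<bar> \<le> \<bar>f (s, t) - f (s', t)\<bar> + \<bar>f (s', t) - f (s', t')\<bar>" by (simp add: eq)
  also have "\<dots> \<le> M * \<bar>s - s'\<bar> + N * \<bar>t - t'\<bar>" using yz by (intro add_mono assms) (auto simp: eq)
  also have "\<dots> \<le> M * dist y z + N * dist y z"
    using dist_fst_le[of y z] dist_snd_le[of y z] assms(1,2)
    by (intro add_mono mult_left_mono) (auto simp: eq dist_real_def)
  finally show "dist (f y) (f z) \<le> (M + N) * dist y z" by (simp add: dist_real_def algebra_simps)
qed (use assms in auto)

locale flux_limited_network = network_hamiltonians E H
  for E :: "(real \<Rightarrow> 'a::euclidean_space) set" and H +
  fixes c :: "'a \<Rightarrow> real" and T0 :: real and T1 :: ereal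
  assumes T0_less_T1: "ereal T0 < T1" and flux: "flux_limiter E H c"
begin

abbreviation "\<Gamma> \<equiv> network_set E"
abbreviation "TT \<equiv> times_from T0 T1"
abbreviation "OT \<equiv> open_times T0 T1"

lemma OT_subset: "OT \<subseteq> TT" and T0_in: "T0 \<in> TT"
  using T0_less_T1 by (auto simp: times_from_def open_times_def)

text \<open>Glued functions are checked point by point against whichever piece is active there, so
  the subsolution inequality is isolated at a single point. It is stated on the parameter side, so
  that it also applies to bumps defined on one arc only.\<close>

definition sub_at :: "(real \<times> real \<Rightarrow> real) \<Rightarrow> (real \<Rightarrow> 'a) \<Rightarrow> real \<Rightarrow> real \<Rightarrow> bool" where
  "sub_at w \<gamma> s t \<longleftrightarrow>
     (\<forall>\<psi>. supertangent UNIV w (s, t) \<psi> \<longrightarrow> partial_t \<psi> (s, t) + H \<gamma> s (partial_s \<psi> (s, t)) \<le> 0)"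

definition vertex_sub_at :: "(real \<Rightarrow> real) \<Rightarrow> 'a \<Rightarrow> real \<Rightarrow> bool" where
  "vertex_sub_at w x t \<longleftrightarrow> (\<forall>\<psi>. supertangent UNIV w t \<psi> \<longrightarrow> deriv \<psi> t \<le> c x)"

lemma HJ_subsolution_iff:
  "HJ_subsolution E H c T0 T1 w \<longleftrightarrow>
     continuous_on (\<Gamma> \<times> TT) w \<and>
     (\<forall>\<gamma>\<in>E. \<forall>s\<in>{0<..<1}. \<forall>t\<in>OT. sub_at (along w \<gamma>) \<gamma> s t) \<and>
     (\<forall>x\<in>vertices E. \<forall>t\<in>OT. vertex_sub_at (\<lambda>t. w (x, t)) x t)"
proof -
  have "continuous_on ({0<..<1} \<times> OT) (along w \<gamma>)" if "continuous_on (\<Gamma> \<times> TT) w" "\<gamma> \<in> E" for \<gamma>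
    by (rule continuous_on_subset[OF continuous_on_along[OF that]]) (use OT_subset in auto)
  then show ?thesis
    unfolding HJ_subsolution_def viscosity_subsolution_def sub_at_def vertex_sub_at_def by blast
qed

text \<open>Raising a function without changing its value at the point can only remove supertangents
  there. This covers maxima and all the gluings below.\<close>

lemma sub_at_transfer:
  assumes "sub_at w \<gamma> s t" "w' (s, t) = w (s, t)" "\<forall>\<^sub>F y in at (s, t). w y \<le> w' y"
  shows "sub_at w' \<gamma> s t"
  using assms supertangent_transfer[of UNIV w' "(s, t)" _ w] unfolding sub_at_def by auto

lemma vertex_sub_at_transfer:
  assumes "vertex_sub_at w x t" "w' t = w t" "\<forall>\<^sub>F y in at t. w y \<le> w' y"
  shows "vertex_sub_at w' x t"
  using assms supertangent_transfer[of UNIV w' t _ w] unfolding vertex_sub_at_def by auto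

lemma near_interior:
  fixes s :: real
  assumes "s \<in> {0<..<1}" "t \<in> OT"
  shows "\<forall>\<^sub>F y in at (s, t). y \<in> {0<..<1} \<times> OT"
  using assms by (intro eventually_at_in_open' open_Times open_times_open) auto

lemma near_OT: "t \<in> OT \<Longrightarrow> \<forall>\<^sub>F y in at t. y \<in> OT"
  by (intro eventually_at_in_open' open_times_open)

text \<open>The substitution of \<open>1 - s\<close> for \<open>s\<close> changes the sign of the
  space derivative, which \<open>H_inverse\<close> compensates. Patches are prescribed on arcs
  ending at a vertex; this carries their inequality to the reversed arcs.\<close>

lemma sub_at_reverse:
  assumes "\<gamma> \<in> E" "s \<in> {0..1}" "sub_at w \<gamma> s t"
  shows "sub_at (\<lambda>z. w (1 - fst z, snd z)) (reversepath \<gamma>) (1 - s) t"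
  unfolding sub_at_def
proof (intro allI impI)
  fix \<psi> assume \<psi>: "supertangent UNIV (\<lambda>z. w (1 - fst z, snd z)) (1 - s, t) \<psi>"
  define \<psi>' where "\<psi>' = (\<lambda>z. \<psi> (1 - fst z, snd z))"
  have C1: "C1_near \<psi> (1 - s, t)" using \<psi> by (simp add: supertangent_def)
  have "bounded_linear (\<lambda>z::real\<times>real. (- fst z, snd z))"
    by (intro bounded_linear_Pair bounded_linear_minus bounded_linear_fst bounded_linear_snd)
  from C1_near_compose_affine[OF this, of \<psi> "(s, t)" "(1, 0)"] C1
  have "C1_near \<psi>' (s, t)" by (simp add: \<psi>'_def)
  moreover have "\<forall>\<^sub>F y in at (s, t). w y - \<psi>' y \<le> w (s, t) - \<psi>' (s, t)"
  proof -
    obtain d where d: "d > 0" "\<And>y. y \<noteq> (1 - s, t) \<Longrightarrow> dist y (1 - s, t) < d \<Longrightarrow>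
        w (1 - fst y, snd y) - \<psi> y \<le> w (s, t) - \<psi> (1 - s, t)"
      using \<psi> unfolding supertangent_def eventually_at by auto
    have "w y - \<psi>' y \<le> w (s, t) - \<psi>' (s, t)" if "y \<noteq> (s, t)" "dist y (s, t) < d" for y
    proof -
      have "(1 - fst y, snd y) \<noteq> (1 - s, t)" using that(1) by (cases y) auto
      moreover have "dist (1 - fst y, snd y) (1 - s, t) < d"
        using that(2) by (cases y) (simp add: dist_Pair_Pair dist_real_def abs_minus_commute power2_commute)
      ultimately show ?thesis using d(2)[of "(1 - fst y, snd y)"] by (simp add: \<psi>'_def)
    qed
    then show ?thesis unfolding eventually_at using d(1) by auto
  qed
  ultimately have "supertangent UNIV w (s, t) \<psi>'" by (simp add: supertangent_def)
  then have "partial_t \<psi>' (s, t) + H \<gamma> s (partial_s \<psi>' (s, t)) \<le> 0"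
    using assms(3) unfolding sub_at_def by blast
  moreover have "partial_t \<psi>' (s, t) = partial_t \<psi> (1 - s, t)" by (simp add: partial_t_def \<psi>'_def)
  moreover have "partial_s \<psi>' (s, t) = - partial_s \<psi> (1 - s, t)"
  proof -
    have "((\<lambda>s. 1 - s) has_real_derivative - 1) (at s)" by (auto intro!: derivative_eq_intros)
    from DERIV_chain2[OF C1_near_has_partials(1)[OF C1] this]
    have "((\<lambda>s. \<psi> (1 - s, t)) has_real_derivative - partial_s \<psi> (1 - s, t)) (at s)" by simp
    moreover have "partial_s \<psi>' (s, t) = deriv (\<lambda>s. \<psi> (1 - s, t)) s"
      by (simp add: partial_s_def \<psi>'_def)
    ultimately show ?thesis by (simp only: DERIV_imp_deriv)
  qed
  moreover have "H (reversepath \<gamma>) (1 - s) p = H \<gamma> s (- p)" for p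
    using H_inverse[OF assms(1), of "1 - s"] assms(2) by simp
  ultimately show "partial_t \<psi> (1 - s, t) + H (reversepath \<gamma>) (1 - s) (partial_s \<psi> (1 - s, t)) \<le> 0"
    by simp
qed

text \<open>Neither time nor the unknown itself occurs in the equation, so delays and added
  constants preserve the inequality.\<close>

lemma sub_at_shift:
  assumes "sub_at w \<gamma> s (t - h)"
  shows "sub_at (\<lambda>z. w (fst z, snd z - h) - k) \<gamma> s t"
  unfolding sub_at_def
proof (intro allI impI)
  fix \<psi> assume \<psi>: "supertangent UNIV (\<lambda>z. w (fst z, snd z - h) - k) (s, t) \<psi>"
  then have C1: "C1_near \<psi> (s, t)" by (simp add: supertangent_def)
  have "supertangent UNIV (\<lambda>y. w (y + (0, - h)) - k) (s, t) \<psi>"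
    using \<psi> unfolding plus_prod_def by simp
  from supertangent_translate[OF this]
  have "supertangent UNIV w (s, t - h) (\<lambda>y. \<psi> (y - (0, - h)))" by simp
  then have "partial_t (\<lambda>y. \<psi> (y - (0, - h))) (s, t - h) + H \<gamma> s (partial_s (\<lambda>y. \<psi> (y - (0, - h))) (s, t - h)) \<le> 0"
    using assms unfolding sub_at_def by blast
  moreover have "partial_s (\<lambda>y. \<psi> (y - (0, - h))) (s, t - h) = partial_s \<psi> (s, t)"
    by (simp add: partial_s_def)
  moreover have "partial_t (\<lambda>y. \<psi> (y - (0, - h))) (s, t - h) = partial_t \<psi> (s, t)"
  proof -
    have "((\<lambda>t. \<psi> (s, t + h)) has_real_derivative partial_t \<psi> (s, t)) (at (t - h))"
      using C1_near_has_partials(2)[OF C1] DERIV_shift[of "\<lambda>t. \<psi> (s, t)" _ "t - h" h] by simp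
    from DERIV_imp_deriv[OF this] show ?thesis
      unfolding partial_t_def[of "\<lambda>y. \<psi> (y - (0, - h))"] by simp
  qed
  ultimately show "partial_t \<psi> (s, t) + H \<gamma> s (partial_s \<psi> (s, t)) \<le> 0" by simp
qed

lemma vertex_sub_at_shift:
  assumes "vertex_sub_at w x (t - h)"
  shows "vertex_sub_at (\<lambda>t. w (t - h) - k) x t"
  unfolding vertex_sub_at_def
proof (intro allI impI)
  fix \<psi> assume \<psi>: "supertangent UNIV (\<lambda>t. w (t - h) - k) t \<psi>"
  then have C1: "C1_near \<psi> t" by (simp add: supertangent_def)
  have "supertangent UNIV (\<lambda>y. w (y + (- h)) - k) t \<psi>" using \<psi> by simp
  from supertangent_translate[OF this]
  have "supertangent UNIV w (t - h) (\<lambda>y. \<psi> (y + h))" by simp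
  then have "deriv (\<lambda>y. \<psi> (y + h)) (t - h) \<le> c x" using assms unfolding vertex_sub_at_def by blast
  moreover have "deriv (\<lambda>y. \<psi> (y + h)) (t - h) = deriv \<psi> t"
    by (rule DERIV_imp_deriv) (use DERIV_shift[of \<psi> "deriv \<psi> t" "t - h" h] C1_near_deriv(1)[OF C1] in simp)
  ultimately show "deriv \<psi> t \<le> c x" by simp
qed

text \<open>For a speed with \<open>\<bar>q\<bar> \<le> \<kappa>\<close> the growth condition gives
  \<open>q * p \<le> \<kappa> * \<bar>p\<bar> \<le> H \<gamma> s p + C\<close>, so every
  supertangent has derivative at most \<open>C\<close> in the direction
  \<open>(q, 1)\<close>.\<close>

lemma subsolution_transport:
  assumes \<gamma>: "\<gamma> \<in> E" and growth: "\<And>s p. s \<in> {0..1} \<Longrightarrow> \<kappa> * \<bar>p\<bar> - C \<le> H \<gamma> s p"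
    and w: "HJ_subsolution E H c T0 T1 w"
    and s: "s \<in> {0..1}" "s' \<in> {0..1}" and t: "t \<in> TT" "t + h \<in> TT"
    and h: "0 \<le> h" "\<bar>s' - s\<bar> \<le> \<kappa> * h"
  shows "w (\<gamma> s', t + h) \<le> w (\<gamma> s, t) + C * h"
proof (cases "h = 0")
  case True
  then show ?thesis using h by auto
next
  case False
  then have h: "0 < h" "\<bar>s' - s\<bar> \<le> \<kappa> * h" using h by auto
  define q where "q = (s' - s) / h"
  have q: "\<bar>q\<bar> \<le> \<kappa>" "q * h = s' - s" using h by (auto simp: q_def field_simps)
  define G where "G = {0<..<1::real} \<times> OT"
  have G: "open G" unfolding G_def by (intro open_Times open_times_open) auto
  have cont: "continuous_on ({0..1} \<times> TT) (along w \<gamma>)"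
    using w continuous_on_along[OF _ \<gamma>] unfolding HJ_subsolution_iff by blast
  have contG: "continuous_on G (along w \<gamma>)"
    by (rule continuous_on_subset[OF cont]) (use OT_subset in \<open>auto simp: G_def\<close>)
  have interior: "along w \<gamma> (\<sigma> + q' * h, \<tau> + h) \<le> along w \<gamma> (\<sigma>, \<tau>) + C * h"
    if "\<sigma> \<in> {0<..<1}" "\<sigma> + q' * h \<in> {0<..<1}" "\<tau> \<in> OT" "\<tau> + h \<in> OT" "\<bar>q'\<bar> \<le> \<kappa>" for \<sigma> \<tau> q'
  proof (rule viscosity_transport[OF G contG])
    show "q' * partial_s \<psi> (s, t) + partial_t \<psi> (s, t) \<le> C"
      if st: "(s, t) \<in> G" "supertangent UNIV (along w \<gamma>) (s, t) \<psi>" for s t \<psi>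
    proof -
      have "partial_t \<psi> (s, t) + H \<gamma> s (partial_s \<psi> (s, t)) \<le> 0"
        using w \<gamma> st unfolding HJ_subsolution_iff sub_at_def G_def by blast
      moreover have "\<kappa> * \<bar>partial_s \<psi> (s, t)\<bar> - C \<le> H \<gamma> s (partial_s \<psi> (s, t))"
        using st by (intro growth) (auto simp: G_def)
      moreover have "q' * partial_s \<psi> (s, t) \<le> \<kappa> * \<bar>partial_s \<psi> (s, t)\<bar>"
      proof -
        have "q' * partial_s \<psi> (s, t) \<le> \<bar>q'\<bar> * \<bar>partial_s \<psi> (s, t)\<bar>" by (simp flip: abs_mult)
        also have "\<dots> \<le> \<kappa> * \<bar>partial_s \<psi> (s, t)\<bar>" using \<open>\<bar>q'\<bar> \<le> \<kappa>\<close> by (intro mult_right_mono) auto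
        finally show ?thesis .
      qed
      ultimately show ?thesis by linarith
    qed
    show "(\<sigma> + q' * \<tau>', \<tau> + \<tau>') \<in> G" if "0 \<le> \<tau>'" "\<tau>' \<le> h" for \<tau>'
    proof -
      have "convex {0<..<1::real}" by simp
      have "(1 - \<tau>' / h) * \<sigma> + \<tau>' / h * (\<sigma> + q' * h) \<in> {0<..<1}"
        using convexD[OF \<open>convex {0<..<1::real}\<close> \<open>\<sigma> \<in> {0<..<1}\<close> \<open>\<sigma> + q' * h \<in> {0<..<1}\<close>, of "1 - \<tau>' / h" "\<tau>' / h"]
          that h by auto
      moreover have "(1 - \<tau>' / h) * \<sigma> + \<tau>' / h * (\<sigma> + q' * h) = \<sigma> + q' * \<tau>'"
        using h by (simp add: field_simps)
      moreover have "\<tau> + \<tau>' \<in> OT"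
        using \<open>\<tau> \<in> OT\<close> \<open>\<tau> + h \<in> OT\<close> that unfolding open_times_def
        by (auto intro: le_less_trans[of "ereal (\<tau> + \<tau>')" "ereal (\<tau> + h)"])
      ultimately show ?thesis by (simp add: G_def)
    qed
  qed (use h in auto)
  \<comment> \<open>End points of the arc and the initial time lie outside the open set of the
    equation. Contracting towards the midpoint by \<open>\<theta>\<close> and delaying by
    \<open>\<theta>\<close> moves the characteristic inside, with speed reduced by the factor
    \<open>1 - \<theta>\<close>; then \<open>\<theta>\<close> tends to 0.\<close>
  define \<sigma> where "\<sigma> = (\<lambda>s \<theta>. s + \<theta> * (1 / 2 - s) :: real)"
  have \<sigma>_int: "\<sigma> s \<theta> \<in> {0<..<1}" if "s \<in> {0..1}" "0 < \<theta>" "\<theta> < 1" for s \<theta>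
  proof -
    have eq: "\<sigma> s \<theta> = (1 - \<theta>) * s + \<theta> / 2" by (simp add: \<sigma>_def algebra_simps)
    have "0 \<le> (1 - \<theta>) * s" "(1 - \<theta>) * s \<le> (1 - \<theta>) * 1"
      using that by (auto intro!: mult_left_mono)
    moreover have "(1 - \<theta>) * 1 + \<theta> / 2 < 1" using that by simp
    ultimately have "0 < \<sigma> s \<theta>" "\<sigma> s \<theta> < 1" using that unfolding eq by linarith+
    then show ?thesis by simp
  qed
  have lim\<sigma>: "((\<lambda>\<theta>. (\<sigma> s \<theta>, t + \<theta>)) \<longlongrightarrow> (s, t)) (at_right 0)" for s t
  proof -
    have "((\<lambda>\<theta>. (\<sigma> s \<theta>, t + \<theta>)) \<longlongrightarrow> (s + 0 * (1 / 2 - s), t + 0)) (at_right 0)"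
      unfolding \<sigma>_def by (intro tendsto_intros)
    then show ?thesis by simp
  qed
  have small: "\<forall>\<^sub>F \<theta> in at_right 0. 0 < \<theta> \<and> \<theta> < (1::real)"
    by (auto simp: eventually_at_right_field intro!: exI[of _ 1])
  have later: "\<forall>\<^sub>F \<theta> in at_right 0. \<tau> + \<theta> \<in> OT" if \<tau>: "\<tau> \<in> TT" for \<tau>
  proof -
    obtain d where d: "d > 0" "\<tau> + d \<in> TT" using times_from_later[OF \<tau>] by blast
    show ?thesis unfolding eventually_at_right_field
    proof (intro exI conjI allI impI)
      fix \<theta> :: real assume "0 < \<theta>" "\<theta> < 0 + d"
      then show "\<tau> + \<theta> \<in> OT"
        using \<tau> d(2) times_from_le[OF d(2), of "\<tau> + \<theta>"] by (auto simp: times_from_def open_times_def)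
    qed (use d in auto)
  qed
  have "((\<lambda>\<theta>. along w \<gamma> (\<sigma> s \<theta>, t + \<theta>) + C * h) \<longlongrightarrow> along w \<gamma> (s, t) + C * h) (at_right 0)"
  proof (intro tendsto_intros continuous_on_tendsto_compose[OF cont lim\<sigma>])
    show "\<forall>\<^sub>F \<theta> in at_right 0. (\<sigma> s \<theta>, t + \<theta>) \<in> {0..1} \<times> TT"
      using small later[OF t(1)]
      by eventually_elim (use \<sigma>_int[OF s(1)] OT_subset in force)
  qed (use s t in auto)
  moreover have "((\<lambda>\<theta>. along w \<gamma> (\<sigma> s' \<theta>, (t + h) + \<theta>)) \<longlongrightarrow> along w \<gamma> (s', t + h)) (at_right 0)"
  proof (intro continuous_on_tendsto_compose[OF cont lim\<sigma>])
    show "\<forall>\<^sub>F \<theta> in at_right 0. (\<sigma> s' \<theta>, t + h + \<theta>) \<in> {0..1} \<times> TT"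
      using small later[OF t(2)]
      by eventually_elim (use \<sigma>_int[OF s(2)] OT_subset in force)
  qed (use s t in auto)
  moreover have "\<forall>\<^sub>F \<theta> in at_right 0. along w \<gamma> (\<sigma> s' \<theta>, (t + h) + \<theta>) \<le> along w \<gamma> (\<sigma> s \<theta>, t + \<theta>) + C * h"
    using small later[OF t(1)] later[OF t(2)]
  proof eventually_elim
    case (elim \<theta>)
    have "((1 - \<theta>) * q) * h = (1 - \<theta>) * (s' - s)" using q(2) by (simp add: mult.assoc)
    then have eq: "\<sigma> s \<theta> + ((1 - \<theta>) * q) * h = \<sigma> s' \<theta>" by (simp add: \<sigma>_def algebra_simps)
    have "\<bar>(1 - \<theta>) * q\<bar> \<le> 1 * \<bar>q\<bar>" unfolding abs_mult using elim by (intro mult_right_mono) auto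
    then have "along w \<gamma> (\<sigma> s \<theta> + ((1 - \<theta>) * q) * h, (t + \<theta>) + h) \<le> along w \<gamma> (\<sigma> s \<theta>, t + \<theta>) + C * h"
      using elim \<sigma>_int[OF s(1)] \<sigma>_int[OF s(2)] q(1) eq by (intro interior) (auto simp: add_ac)
    then show ?case unfolding eq by (simp add: add_ac)
  qed
  ultimately have "along w \<gamma> (s', t + h) \<le> along w \<gamma> (s, t) + C * h"
    by (intro tendsto_le[of "at_right (0::real)"]) auto
  then show ?thesis by (simp add: along_def)
qed

section \<open>The class of competitors and its supremum\<close>

definition subsolutions_below :: "('a \<Rightarrow> real) \<Rightarrow> ('a \<times> real \<Rightarrow> real) set" where
  "subsolutions_below g = {w. HJ_subsolution E H c T0 T1 w \<and> (\<forall>x\<in>\<Gamma>. w (x, T0) \<le> g x)}"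

text \<open>A supremum in the conditionally complete reals: it carries information only where the
  class is nonempty and bounded above, so these two facts are supplied separately.\<close>

definition upper_envelope :: "('a \<Rightarrow> real) \<Rightarrow> 'a \<times> real \<Rightarrow> real" where
  "upper_envelope g z = (SUP w\<in>subsolutions_below g. w z)"

text \<open>Transport with the characteristic at rest, from the initial time to
  \<open>t\<close>.\<close>

lemma subsolutions_below_bound:
  assumes "w \<in> subsolutions_below g" "\<gamma> \<in> E" "s \<in> {0..1}" "t \<in> TT"
    "\<And>s p. s \<in> {0..1} \<Longrightarrow> \<kappa> * \<bar>p\<bar> - C \<le> H \<gamma> s p" "\<kappa> > 0"
  shows "w (\<gamma> s, t) \<le> g (\<gamma> s) + C * (t - T0)"
proof -
  have "w (\<gamma> s, T0 + (t - T0)) \<le> w (\<gamma> s, T0) + C * (t - T0)"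
    using assms T0_in by (intro subsolution_transport[where \<kappa> = \<kappa>])
      (auto simp: subsolutions_below_def times_from_def)
  moreover have "w (\<gamma> s, T0) \<le> g (\<gamma> s)"
    using assms(1) arc_mem_network[OF assms(2,3)] by (auto simp: subsolutions_below_def)
  ultimately show ?thesis by simp
qed

lemma bdd_above_subsolutions:
  assumes "z \<in> \<Gamma> \<times> TT"
  shows "bdd_above ((\<lambda>w. w z) ` subsolutions_below g)"
proof -
  obtain \<gamma> s t where z: "z = (\<gamma> s, t)" "\<gamma> \<in> E" "s \<in> {0..1}" "t \<in> TT"
    using assms unfolding network_set_def path_image_def by auto
  obtain \<kappa> C where \<kappa>: "\<kappa> > 0" "\<And>s p. s \<in> {0..1} \<Longrightarrow> \<kappa> * \<bar>p\<bar> - C \<le> H \<gamma> s p"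
    using H_linear_growth[OF z(2)] by metis
  show ?thesis
    using subsolutions_below_bound[OF _ z(2-4) \<kappa>(2,1)] unfolding z(1) by (intro bdd_aboveI2)
qed

lemma upper_envelope_upper:
  "w \<in> subsolutions_below g \<Longrightarrow> z \<in> \<Gamma> \<times> TT \<Longrightarrow> w z \<le> upper_envelope g z"
  unfolding upper_envelope_def by (rule cSUP_upper[OF _ bdd_above_subsolutions])

lemma upper_envelope_least:
  "subsolutions_below g \<noteq> {} \<Longrightarrow> (\<And>w. w \<in> subsolutions_below g \<Longrightarrow> w z \<le> M) \<Longrightarrow> upper_envelope g z \<le> M"
  unfolding upper_envelope_def by (rule cSUP_least)

lemma upper_envelope_approx:
  assumes "subsolutions_below g \<noteq> {}" "e > 0"
  shows "\<exists>w\<in>subsolutions_below g. upper_envelope g z - e < w z"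
proof (rule ccontr)
  assume "\<not> ?thesis"
  then have "upper_envelope g z \<le> upper_envelope g z - e"
    using assms(1) by (intro upper_envelope_least) (auto simp: not_less)
  then show False using assms(2) by simp
qed

text \<open>Supertangents to this function have space slopes bounded by the Lipschitz constant of
  the datum, where \<open>H\<close> is bounded, and time slopes at most \<open>- K\<close>.
  Finiteness lets one large \<open>K\<close> serve all arcs and, through
  \<open>- K \<le> c x\<close>, all vertices. In particular the class is nonempty.\<close>

lemma initial_minus_time:
  assumes "Lipschitz_on_network E g"
  obtains K where "K \<ge> 0" "(\<lambda>z. g (fst z) - K * (snd z - T0)) \<in> subsolutions_below g"
proof -
  define good where "good = (\<lambda>K \<gamma>. \<forall>s\<in>{0<..<1}. \<forall>t\<in>OT. sub_at (along (\<lambda>z. g (fst z) - K * (snd z - T0)) \<gamma>) \<gamma> s t)"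
  have *: "\<forall>\<^sub>F K in at_top. good K \<gamma>" if \<gamma>: "\<gamma> \<in> E" for \<gamma>
  proof -
    obtain L where L: "L-lipschitz_on {0..1} (g \<circ> \<gamma>)"
      using assms \<gamma> unfolding Lipschitz_on_network_def by blast
    obtain B where B: "\<And>s p. s \<in> {0..1} \<Longrightarrow> \<bar>p\<bar> \<le> L \<Longrightarrow> \<bar>H \<gamma> s p\<bar> \<le> B"
      using H_bounded[OF \<gamma>, of L] by metis
    have "good K \<gamma>" if K: "K \<ge> B" for K
      unfolding good_def sub_at_def
    proof (intro ballI allI impI)
      fix s t \<psi> assume s: "s \<in> {0<..<1::real}" and t: "t \<in> OT"
        and \<psi>: "supertangent UNIV (along (\<lambda>z. g (fst z) - K * (snd z - T0)) \<gamma>) (s, t) \<psi>"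
      have "\<forall>\<^sub>F y in at s. y \<in> {0<..<1}" using s by (intro eventually_at_in_open') auto
      then have "\<forall>\<^sub>F y in at s. 0 * (y - s) - L * \<bar>y - s\<bar> \<le> along (\<lambda>z. g (fst z) - K * (snd z - T0)) \<gamma> (y, t)
          - along (\<lambda>z. g (fst z) - K * (snd z - T0)) \<gamma> (s, t)"
      proof (rule eventually_mono)
        fix y :: real assume "y \<in> {0<..<1}"
        then have "\<bar>g (\<gamma> y) - g (\<gamma> s)\<bar> \<le> L * \<bar>y - s\<bar>"
          using lipschitz_onD[OF L, of y s] s by (auto simp: dist_real_def)
        then show "0 * (y - s) - L * \<bar>y - s\<bar> \<le> along (\<lambda>z. g (fst z) - K * (snd z - T0)) \<gamma> (y, t)
          - along (\<lambda>z. g (fst z) - K * (snd z - T0)) \<gamma> (s, t)" by (simp add: along_def)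
      qed
      from supertangent_partial_s_bound[OF \<psi> this] have "\<bar>partial_s \<psi> (s, t)\<bar> \<le> L" by simp
      then have "H \<gamma> s (partial_s \<psi> (s, t)) \<le> K" using B[of s] s K by force
      moreover have "partial_t \<psi> (s, t) \<le> - K"
        by (rule supertangent_partial_t_le[OF \<psi>]) (simp add: along_def algebra_simps)
      ultimately show "partial_t \<psi> (s, t) + H \<gamma> s (partial_s \<psi> (s, t)) \<le> 0" by linarith
    qed
    then show ?thesis unfolding eventually_at_top_linorder by blast
  qed
  have "finite (vertices E)" using finite_arcs by (simp add: vertices_def)
  then have "\<forall>\<^sub>F K in at_top. \<forall>x\<in>vertices E. - K \<le> c x"
  proof (rule eventually_ball_finite, intro ballI)
    fix x assume "x \<in> vertices E"
    show "\<forall>\<^sub>F K in at_top. - K \<le> c x" using eventually_ge_at_top[of "- c x"] by eventually_elim auto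
  qed
  moreover have "\<forall>\<^sub>F K in at_top. \<forall>\<gamma>\<in>E. good K \<gamma>"
    using * by (intro eventually_ball_finite finite_arcs) auto
  ultimately have "\<forall>\<^sub>F K in at_top. 0 \<le> K \<and> (\<forall>\<gamma>\<in>E. good K \<gamma>) \<and> (\<forall>x\<in>vertices E. - K \<le> c x)"
    using eventually_ge_at_top[of 0] by eventually_elim auto
  from eventually_happens'[OF trivial_limit_at_top_linorder this]
  obtain K where K: "0 \<le> K" "\<forall>\<gamma>\<in>E. good K \<gamma>" "\<forall>x\<in>vertices E. - K \<le> c x" by (elim exE conjE)
  have "continuous_on (\<Gamma> \<times> TT) (\<lambda>z. g (fst z) - K * (snd z - T0))"
  proof -
    have "continuous_on \<Gamma> g" using assms unfolding Lipschitz_on_network_def by blast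
    then have "continuous_on (\<Gamma> \<times> TT) (\<lambda>z. g (fst z))"
      by (rule continuous_on_compose2) (auto intro: continuous_intros)
    then show ?thesis by (intro continuous_intros)
  qed
  moreover have "vertex_sub_at (\<lambda>t. g (fst (x, t)) - K * (snd (x, t) - T0)) x t" if x: "x \<in> vertices E" for x t
    unfolding vertex_sub_at_def
  proof (intro allI impI)
    fix \<psi> assume "supertangent UNIV (\<lambda>t. g (fst (x, t)) - K * (snd (x, t) - T0)) t \<psi>"
    then have "deriv \<psi> t \<le> - K"
      unfolding supertangent_def
      by (intro touching_derivative_le[OF C1_near_deriv(1), of _ _ "\<lambda>t. g x - K * (t - T0)"])
        (auto simp: algebra_simps)
    then show "deriv \<psi> t \<le> c x" using K(3) x by fastforce
  qed
  ultimately have "(\<lambda>z. g (fst z) - K * (snd z - T0)) \<in> subsolutions_below g"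
    using K(2) unfolding subsolutions_below_def HJ_subsolution_iff good_def by simp
  with K(1) show thesis using that by blast
qed

text \<open>The competitor \<open>w\<close> is delayed by \<open>h\<close> and lowered by
  \<open>K * h\<close>. Membership of the result gives
  \<open>w (x, t) - K * h \<le> upper_envelope g (x, t + h)\<close>, the lower estimate in
  time.\<close>

lemma glued_subsolution:
  assumes w: "w \<in> subsolutions_below g" and base: "(\<lambda>z. g (fst z) - K * (snd z - T0)) \<in> subsolutions_below g"
    and h: "h > 0"
  shows "(\<lambda>z. if snd z \<le> T0 + h then g (fst z) - K * (snd z - T0)
      else max (g (fst z) - K * (snd z - T0)) (w (fst z, snd z - h) - K * h)) \<in> subsolutions_below g"
    (is "?w \<in> _")
proof -
  let ?b = "\<lambda>z::'a\<times>real. g (fst z) - K * (snd z - T0)"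
  let ?s = "\<lambda>z::'a\<times>real. w (fst z, snd z - h) - K * h"
  have contb: "continuous_on (\<Gamma> \<times> TT) ?b" and contw: "continuous_on (\<Gamma> \<times> TT) w"
    using base w unfolding subsolutions_below_def HJ_subsolution_iff by auto
  have later: "(x, t - h) \<in> \<Gamma> \<times> TT" if "(x, t) \<in> \<Gamma> \<times> TT" "T0 + h \<le> t" for x t
    using that h times_from_le[of t T0 T1 "t - h"] by auto
  have "continuous_on {z \<in> \<Gamma> \<times> TT. T0 + h \<le> snd z} (\<lambda>z. max (?b z) (?s z))"
    by (intro continuous_intros continuous_on_subset[OF contb] continuous_on_compose2[OF contw])
      (use later in auto)
  then have cont: "continuous_on (\<Gamma> \<times> TT) ?w"
  proof (rule continuous_on_cases_le[rotated])
    \<comment> \<open>At time \<open>T0 + h\<close> the shifted competitor is at most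
      \<open>g - K * h\<close>, the value of the base function, so the two pieces fit
      continuously.\<close>
    show "?b z = max (?b z) (?s z)" if "z \<in> \<Gamma> \<times> TT" "snd z = T0 + h" for z
      using that w by (auto simp: subsolutions_below_def max_def)
  qed (auto intro!: continuous_intros continuous_on_subset[OF contb])
  have ge: "?b z \<le> ?w z" for z by auto
  have eq: "?w z = ?b z \<or> T0 + h < snd z \<and> ?w z = ?s z" for z by (auto simp: max_def)
  have ge_s: "?s z \<le> ?w z" if "T0 + h < snd z" for z using that by auto
  have "sub_at (along ?w \<gamma>) \<gamma> s t" if \<gamma>: "\<gamma> \<in> E" and s: "s \<in> {0<..<1}" and t: "t \<in> OT" for \<gamma> s t
    using eq[of "(\<gamma> s, t)"]
  proof
    assume "?w (\<gamma> s, t) = ?b (\<gamma> s, t)"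
    moreover have "sub_at (along ?b \<gamma>) \<gamma> s t"
      using base \<gamma> s t unfolding subsolutions_below_def HJ_subsolution_iff by blast
    ultimately show ?thesis
      by (rule_tac sub_at_transfer[of "along ?b \<gamma>"]) (auto simp: along_def intro!: always_eventually)
  next
    assume *: "T0 + h < snd (\<gamma> s, t) \<and> ?w (\<gamma> s, t) = ?s (\<gamma> s, t)"
    then have "t - h \<in> OT" using t h
      unfolding open_times_def by (auto intro: le_less_trans[of "ereal (t - h)" "ereal t"])
    then have "sub_at (along w \<gamma>) \<gamma> s (t - h)"
      using w \<gamma> s unfolding subsolutions_below_def HJ_subsolution_iff by blast
    from sub_at_shift[OF this, of "K * h"]
    have "sub_at (\<lambda>z. along w \<gamma> (fst z, snd z - h) - K * h) \<gamma> s t" .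
    moreover have "\<forall>\<^sub>F y in at (s, t). y \<in> UNIV \<times> {T0 + h<..}"
      using * by (intro eventually_at_in_open' open_Times) auto
    then have "\<forall>\<^sub>F y in at (s, t). along w \<gamma> (fst y, snd y - h) - K * h \<le> along ?w \<gamma> y"
      by eventually_elim (auto simp: along_def)
    ultimately show ?thesis
      using * by (rule_tac sub_at_transfer[of "\<lambda>z. along w \<gamma> (fst z, snd z - h) - K * h"]) (auto simp: along_def)
  qed
  moreover have "vertex_sub_at (\<lambda>t. ?w (x, t)) x t" if x: "x \<in> vertices E" and t: "t \<in> OT" for x t
    using eq[of "(x, t)"]
  proof
    assume "?w (x, t) = ?b (x, t)"
    moreover have "vertex_sub_at (\<lambda>t. ?b (x, t)) x t"
      using base x t unfolding subsolutions_below_def HJ_subsolution_iff by blast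
    ultimately show ?thesis
      by (rule_tac vertex_sub_at_transfer[of "\<lambda>t. ?b (x, t)"]) (auto intro!: always_eventually)
  next
    assume *: "T0 + h < snd (x, t) \<and> ?w (x, t) = ?s (x, t)"
    then have "t - h \<in> OT" using t h
      unfolding open_times_def by (auto intro: le_less_trans[of "ereal (t - h)" "ereal t"])
    then have "vertex_sub_at (\<lambda>t. w (x, t)) x (t - h)"
      using w x unfolding subsolutions_below_def HJ_subsolution_iff by blast
    from vertex_sub_at_shift[OF this, of "K * h"]
    have "vertex_sub_at (\<lambda>t. w (x, t - h) - K * h) x t" .
    moreover have "\<forall>\<^sub>F y in at t. y \<in> {T0 + h<..}"
      using * by (intro eventually_at_in_open') auto
    then have "\<forall>\<^sub>F y in at t. w (x, y - h) - K * h \<le> ?w (x, y)"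
      by eventually_elim auto
    ultimately show ?thesis
      using * by (rule_tac vertex_sub_at_transfer[of "\<lambda>t. w (x, t - h) - K * h"]) auto
  qed
  moreover have "?w (x, T0) \<le> g x" for x using h by simp
  ultimately show ?thesis using cont unfolding subsolutions_below_def HJ_subsolution_iff by blast
qed

lemma upper_envelope_initial_le:
  assumes "subsolutions_below g \<noteq> {}" "x \<in> \<Gamma>"
  shows "upper_envelope g (x, T0) \<le> g x"
  using assms(2) by (intro upper_envelope_least assms(1)) (auto simp: subsolutions_below_def)

text \<open>In time, transport at rest bounds the increase and the gluing bounds the decrease. In
  space, transport over a short time \<open>h\<close> is followed by a return to the original time,
  at the price of the estimate in time.\<close>

lemma upper_envelope_Lipschitz:
  assumes g: "Lipschitz_on_network E g"
  obtains K where "K \<ge> 0"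
    "\<And>x t t'. x \<in> \<Gamma> \<Longrightarrow> t \<in> TT \<Longrightarrow> t' \<in> TT \<Longrightarrow> \<bar>upper_envelope g (x, t) - upper_envelope g (x, t')\<bar> \<le> K * \<bar>t - t'\<bar>"
    "\<And>\<gamma>. \<gamma> \<in> E \<Longrightarrow> \<exists>M\<ge>0. \<forall>s\<in>{0..1}. \<forall>s'\<in>{0..1}. \<forall>t\<in>TT.
      \<bar>upper_envelope g (\<gamma> s, t) - upper_envelope g (\<gamma> s', t)\<bar> \<le> M * \<bar>s - s'\<bar>"
    "\<And>x. x \<in> \<Gamma> \<Longrightarrow> upper_envelope g (x, T0) = g x"
proof -
  obtain K where K: "K \<ge> 0" "(\<lambda>z. g (fst z) - K * (snd z - T0)) \<in> subsolutions_below g"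
    using initial_minus_time[OF g] by blast
  then have ne: "subsolutions_below g \<noteq> {}" by blast
  let ?u = "upper_envelope g"
  have initial: "?u (x, T0) = g x" if "x \<in> \<Gamma>" for x
    using upper_envelope_initial_le[OF ne that] upper_envelope_upper[OF K(2), of "(x, T0)"] that T0_in
    by auto
  have lower: "?u (x, t) - K * h \<le> ?u (x, t + h)" if x: "x \<in> \<Gamma>" and t: "t \<in> TT" "t + h \<in> TT" and h: "h > 0" for x t h
  proof -
    have "w (x, t) \<le> ?u (x, t + h) + K * h" if w: "w \<in> subsolutions_below g" for w
      using upper_envelope_upper[OF glued_subsolution[OF w K(2) h], of "(x, t + h)"] x t w
      by (cases "t = T0") (auto simp: subsolutions_below_def times_from_def)
    then have "?u (x, t) \<le> ?u (x, t + h) + K * h" by (rule upper_envelope_least[OF ne])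
    then show ?thesis by simp
  qed
  have transport: "?u (\<gamma> s', t + h) \<le> ?u (\<gamma> s, t) + C * h"
    if \<gamma>: "\<gamma> \<in> E" and "\<And>s p. s \<in> {0..1} \<Longrightarrow> \<kappa> * \<bar>p\<bar> - C \<le> H \<gamma> s p"
      "s \<in> {0..1}" "s' \<in> {0..1}" "t \<in> TT" "t + h \<in> TT" "0 \<le> h" "\<bar>s' - s\<bar> \<le> \<kappa> * h" for \<gamma> \<kappa> C s s' t h
  proof (rule upper_envelope_least[OF ne])
    fix w assume w: "w \<in> subsolutions_below g"
    then have "w (\<gamma> s', t + h) \<le> w (\<gamma> s, t) + C * h"
      using that by (intro subsolution_transport[where \<kappa> = \<kappa>]) (auto simp: subsolutions_below_def)
    also have "w (\<gamma> s, t) \<le> ?u (\<gamma> s, t)"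
      using that by (intro upper_envelope_upper w) (auto intro: arc_mem_network)
    finally show "w (\<gamma> s', t + h) \<le> ?u (\<gamma> s, t) + C * h" by simp
  qed
  have "\<forall>\<gamma>\<in>E. \<exists>\<kappa> C. \<kappa> > 0 \<and> C \<ge> 0 \<and> (\<forall>s\<in>{0..1}. \<forall>p. \<kappa> * \<bar>p\<bar> - C \<le> H \<gamma> s p)"
    using H_linear_growth by metis
  then obtain \<kappa> C where \<kappa>: "\<And>\<gamma>. \<gamma> \<in> E \<Longrightarrow> \<kappa> \<gamma> > 0 \<and> C \<gamma> \<ge> 0 \<and> (\<forall>s\<in>{0..1}. \<forall>p. \<kappa> \<gamma> * \<bar>p\<bar> - C \<gamma> \<le> H \<gamma> s p)"
    by metis
  \<comment> \<open>One rate dominating the slope \<open>K\<close> of the base function and the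
    transport constants of all arcs.\<close>
  define N where "N = K + sum C E"
  have C_le: "C \<gamma> \<le> sum C E" if "\<gamma> \<in> E" for \<gamma>
    using that \<kappa> finite_arcs by (intro member_le_sum) auto
  have N: "N \<ge> K" "N \<ge> 0" using \<kappa> K(1) by (auto simp: N_def sum_nonneg)
  have time: "\<bar>?u (x, t) - ?u (x, t')\<bar> \<le> N * \<bar>t - t'\<bar>" if x: "x \<in> \<Gamma>" and t: "t \<in> TT" "t' \<in> TT" for x t t'
  proof -
    have *: "\<bar>?u (x, t) - ?u (x, t + h)\<bar> \<le> N * h" if "t \<in> TT" "t + h \<in> TT" "h > 0" for t h
    proof -
      obtain \<gamma> s where \<gamma>: "\<gamma> \<in> E" "s \<in> {0..1}" "x = \<gamma> s"
        using x unfolding network_set_def path_image_def by auto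
      have "?u (\<gamma> s, t + h) \<le> ?u (\<gamma> s, t) + C \<gamma> * h"
        using \<kappa>[OF \<gamma>(1)] that \<gamma>(2) by (intro transport[where \<kappa> = "\<kappa> \<gamma>"] \<gamma>) auto
      moreover have "C \<gamma> * h \<le> N * h" "K * h \<le> N * h"
        using that C_le[OF \<gamma>(1)] N K(1) by (auto simp: N_def intro!: mult_right_mono)
      ultimately show ?thesis using lower[OF x that] \<gamma>(3) by (auto simp: abs_le_iff)
    qed
    consider "t = t'" | "t < t'" | "t' < t" by linarith
    then show ?thesis
      using *[of t "t' - t"] *[of t' "t - t'"] t by cases (auto simp: abs_minus_commute)
  qed
  have space: "\<exists>M\<ge>0. \<forall>s\<in>{0..1}. \<forall>s'\<in>{0..1}. \<forall>t\<in>TT. \<bar>?u (\<gamma> s, t) - ?u (\<gamma> s', t)\<bar> \<le> M * \<bar>s - s'\<bar>"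
    if \<gamma>: "\<gamma> \<in> E" for \<gamma>
  proof -
    have step: "?u (\<gamma> s', t) \<le> ?u (\<gamma> s, t) + (C \<gamma> + N) * h"
      if "s \<in> {0..1}" "s' \<in> {0..1}" "t \<in> TT" "t + h \<in> TT" "0 \<le> h" "\<bar>s' - s\<bar> \<le> \<kappa> \<gamma> * h" for s s' t h
    proof -
      have "?u (\<gamma> s', t + h) \<le> ?u (\<gamma> s, t) + C \<gamma> * h"
        using \<kappa>[OF \<gamma>] that by (intro transport[where \<kappa> = "\<kappa> \<gamma>"] \<gamma>) auto
      moreover have "\<bar>?u (\<gamma> s', t) - ?u (\<gamma> s', t + h)\<bar> \<le> N * h"
        using time[of "\<gamma> s'" t "t + h"] arc_mem_network[OF \<gamma> that(2)] that by simp
      ultimately show ?thesis by (auto simp: algebra_simps abs_le_iff)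
    qed
    have le: "?u (\<gamma> s', t) \<le> ?u (\<gamma> s, t) + (C \<gamma> + N) / \<kappa> \<gamma> * \<bar>s' - s\<bar>"
      if s: "s \<in> {0..1}" "s' \<in> {0..1}" and t: "t \<in> TT" for s s' t
    proof -
      obtain h0 where h0: "h0 > 0" "t + h0 \<in> TT" using times_from_later[OF t] by blast
      \<comment> \<open>The time left before \<open>T1\<close> may be too short to travel the whole
        distance at speed \<open>\<kappa> \<gamma>\<close>, so the path is cut into \<open>n\<close>
        pieces; the resulting constant does not depend on \<open>n\<close>.\<close>
      obtain n :: nat where n: "\<bar>s' - s\<bar> / (\<kappa> \<gamma> * h0) < n" using reals_Archimedean2 by blast
      have k: "\<kappa> \<gamma> > 0" using \<kappa>[OF \<gamma>] by blast
      have "0 \<le> \<bar>s' - s\<bar> / (\<kappa> \<gamma> * h0)" using k h0 by simp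
      then have n0: "n > 0" using n by (metis linorder_not_less of_nat_0 of_nat_le_0_iff neq0_conv)
      define h where "h = \<bar>s' - s\<bar> / (\<kappa> \<gamma> * real n)"
      have "\<bar>s' - s\<bar> < real n * (\<kappa> \<gamma> * h0)" using n k h0 by (simp add: pos_divide_less_eq)
      then have h: "0 \<le> h" "h \<le> h0" "real n * h = \<bar>s' - s\<bar> / \<kappa> \<gamma>"
        using k n0 by (auto simp: h_def field_simps)
      have th: "t + h \<in> TT" using h t by (intro times_from_le[OF h0(2)]) (auto simp: times_from_def)
      define p where "p = (\<lambda>i::nat. s + real i / real n * (s' - s))"
      have p: "p i \<in> {0..1}" if "i \<le> n" for i
      proof -
        have "p i = (1 - real i / real n) * s + real i / real n * s'"
          by (simp add: p_def algebra_simps diff_divide_distrib)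
        moreover have "(1 - real i / real n) *\<^sub>R s + (real i / real n) *\<^sub>R s' \<in> {0..1}"
          using s that n0 by (intro convexD[OF convex_real_interval(5)]) (auto simp: field_simps)
        ultimately show ?thesis by simp
      qed
      have "i \<le> n \<Longrightarrow> ?u (\<gamma> (p i), t) \<le> ?u (\<gamma> s, t) + real i * ((C \<gamma> + N) * h)" for i
      proof (induction i)
        case (Suc i)
        have "p (Suc i) - p i = (s' - s) / real n"
          using n0 by (simp add: p_def field_simps)
        then have "\<bar>p (Suc i) - p i\<bar> \<le> \<kappa> \<gamma> * h" using k n0 by (simp add: h_def)
        then have "?u (\<gamma> (p (Suc i)), t) \<le> ?u (\<gamma> (p i), t) + (C \<gamma> + N) * h"
          using Suc.prems h(1) th t by (intro step p) auto
        then show ?case using Suc by (auto simp: algebra_simps)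
      qed (simp add: p_def)
      from this[of n] have "?u (\<gamma> (p n), t) \<le> ?u (\<gamma> s, t) + (C \<gamma> + N) * (real n * h)"
        by (simp add: mult.left_commute)
      moreover have "p n = s'" using n0 by (simp add: p_def)
      ultimately show ?thesis unfolding h(3) by simp
    qed
    show ?thesis
    proof (intro exI conjI ballI)
      show "0 \<le> (C \<gamma> + N) / \<kappa> \<gamma>" using \<kappa>[OF \<gamma>] N by simp
      fix s s' t assume "s \<in> {0..1::real}" "s' \<in> {0..1::real}" "t \<in> TT"
      then show "\<bar>?u (\<gamma> s, t) - ?u (\<gamma> s', t)\<bar> \<le> (C \<gamma> + N) / \<kappa> \<gamma> * \<bar>s - s'\<bar>"
        using le[of s s' t] le[of s' s t] by (simp add: abs_le_iff abs_minus_commute)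
    qed
  qed
  show thesis by (rule that[OF N(2) time space initial])
qed

text \<open>A Lipschitz bound along arcs does not directly control differences by the ambient
  distance. Uniform continuity comes instead from equicontinuity of the time slices at each point,
  by continuity of \<open>param\<close>, together with compactness of the network.\<close>

lemma upper_envelope_Lipschitz_network:
  assumes "Lipschitz_on_network E g"
  shows "Lipschitz_on_network_times E T0 T1 (upper_envelope g)"
    and "uniformly_continuous_on (\<Gamma> \<times> TT) (upper_envelope g)"
proof -
  let ?u = "upper_envelope g"
  obtain K where K: "K \<ge> 0"
    and time: "\<And>x t t'. x \<in> \<Gamma> \<Longrightarrow> t \<in> TT \<Longrightarrow> t' \<in> TT \<Longrightarrow> \<bar>?u (x, t) - ?u (x, t')\<bar> \<le> K * \<bar>t - t'\<bar>"
    and space: "\<And>\<gamma>. \<gamma> \<in> E \<Longrightarrow> \<exists>M\<ge>0. \<forall>s\<in>{0..1}. \<forall>s'\<in>{0..1}. \<forall>t\<in>TT.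
      \<bar>?u (\<gamma> s, t) - ?u (\<gamma> s', t)\<bar> \<le> M * \<bar>s - s'\<bar>"
    by (rule upper_envelope_Lipschitz[OF assms]) (assumption | rule that)+
  have Lip: "\<exists>L. L-lipschitz_on ({0..1} \<times> TT) (along ?u \<gamma>)" if \<gamma>: "\<gamma> \<in> E" for \<gamma>
  proof -
    obtain M where M: "M \<ge> 0" "\<forall>s\<in>{0..1}. \<forall>s'\<in>{0..1}. \<forall>t\<in>TT. \<bar>?u (\<gamma> s, t) - ?u (\<gamma> s', t)\<bar> \<le> M * \<bar>s - s'\<bar>"
      using space[OF \<gamma>] by blast
    have "(M + K)-lipschitz_on ({0..1} \<times> TT) (along ?u \<gamma>)"
      using M K time arc_mem_network[OF \<gamma>] by (intro L_lipschitz_on_prodI) (auto simp: along_def)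
    then show ?thesis by blast
  qed
  then show "Lipschitz_on_network_times E T0 T1 ?u"
    unfolding Lipschitz_on_network_times_def
    by (auto intro!: continuous_on_alongI intro: lipschitz_on_continuous_on)
  have equicont: "\<exists>d>0. \<forall>t\<in>TT. \<forall>y\<in>\<Gamma>. dist y x < d \<longrightarrow> dist (?u (y, t)) (?u (x, t)) < e"
    if x: "x \<in> \<Gamma>" and e: "e > 0" for x e
  proof -
    have "\<forall>\<^sub>F d in at_right 0. \<forall>\<gamma>\<in>E. \<forall>t\<in>TT. \<forall>y\<in>path_image \<gamma>. dist y x < d \<longrightarrow> dist (?u (y, t)) (?u (x, t)) < e"
    proof (rule eventually_ball_finite[OF finite_arcs], rule ballI)
      fix \<gamma> assume \<gamma>: "\<gamma> \<in> E"
      have "\<exists>d>0. \<forall>t\<in>TT. \<forall>y\<in>path_image \<gamma>. dist y x < d \<longrightarrow> dist (?u (y, t)) (?u (x, t)) < e"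
      proof (cases "x \<in> path_image \<gamma>")
        case True
        obtain M where M: "M \<ge> 0" "\<And>s s' t. s \<in> {0..1} \<Longrightarrow> s' \<in> {0..1} \<Longrightarrow> t \<in> TT \<Longrightarrow> \<bar>?u (\<gamma> s, t) - ?u (\<gamma> s', t)\<bar> \<le> M * \<bar>s - s'\<bar>"
          using space[OF \<gamma>] by blast
        have "e / (M + 1) > 0" using e M by simp
        then obtain d where d: "d > 0"
          "\<And>y. y \<in> path_image \<gamma> \<Longrightarrow> dist y x < d \<Longrightarrow> dist (param \<gamma> y) (param \<gamma> x) < e / (M + 1)"
          using param_continuous[OF \<gamma>] True unfolding continuous_on_iff by meson
        have "dist (?u (y, t)) (?u (x, t)) < e" if t: "t \<in> TT" and y: "y \<in> path_image \<gamma>" "dist y x < d" for t y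
        proof -
          have "\<bar>?u (y, t) - ?u (x, t)\<bar> \<le> M * \<bar>param \<gamma> y - param \<gamma> x\<bar>"
            using M(2)[OF param(1)[OF y(1)] param(1)[OF True] t] param(2)[OF y(1)] param(2)[OF True] by simp
          also have "\<dots> \<le> M * (e / (M + 1))"
            using d(2)[OF y] M(1) by (intro mult_left_mono) (auto simp: dist_real_def)
          also have "\<dots> < e" using M(1) e by (simp add: field_simps)
          finally show ?thesis by (simp add: dist_real_def)
        qed
        then show ?thesis using d(1) by blast
      next
        \<comment> \<open>An arc that avoids \<open>x\<close> keeps a positive distance from it, so
          the condition becomes vacuous for small \<open>d\<close>.\<close>
        case False
        have "closed (path_image \<gamma>)"
          using \<gamma> by (auto intro!: compact_imp_closed compact_path_image simple_path_imp_path simple_arc)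
        then obtain d where "d > 0" "\<And>y. y \<in> path_image \<gamma> \<Longrightarrow> d \<le> dist x y"
          using separate_point_closed[OF _ False] by blast
        then show ?thesis by (metis dist_commute linorder_not_less)
      qed
      then obtain d0 where d0: "d0 > 0" "\<forall>t\<in>TT. \<forall>y\<in>path_image \<gamma>. dist y x < d0 \<longrightarrow> dist (?u (y, t)) (?u (x, t)) < e"
        by blast
      show "\<forall>\<^sub>F d in at_right 0. \<forall>t\<in>TT. \<forall>y\<in>path_image \<gamma>. dist y x < d \<longrightarrow> dist (?u (y, t)) (?u (x, t)) < e"
        unfolding eventually_at_right_field using d0 by (intro exI[of _ d0]) auto
    qed
    then have "\<forall>\<^sub>F d in at_right 0. 0 < d \<and> (\<forall>\<gamma>\<in>E. \<forall>t\<in>TT. \<forall>y\<in>path_image \<gamma>. dist y x < d \<longrightarrow> dist (?u (y, t)) (?u (x, t)) < e)"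
      using eventually_at_right_less by eventually_elim auto
    then obtain d :: real where "0 < d" "\<forall>\<gamma>\<in>E. \<forall>t\<in>TT. \<forall>y\<in>path_image \<gamma>. dist y x < d \<longrightarrow> dist (?u (y, t)) (?u (x, t)) < e"
      using eventually_happens'[OF trivial_limit_at_right_real] by blast
    then show ?thesis unfolding network_set_def by (intro exI[of _ d]) auto
  qed
  show "uniformly_continuous_on (\<Gamma> \<times> TT) ?u"
    unfolding uniformly_continuous_on_def
  proof (intro allI impI)
    fix e :: real assume e: "e > 0"
    obtain d where d: "d > 0" "\<And>f x y. f \<in> (\<lambda>t x. ?u (x, t)) ` TT \<Longrightarrow> x \<in> \<Gamma> \<Longrightarrow> y \<in> \<Gamma> \<Longrightarrow> dist y x < d \<Longrightarrow> dist (f y) (f x) < e / 2"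
    proof (rule compact_uniformly_equicontinuous[OF compact_network_set, of "(\<lambda>t x. ?u (x, t)) ` TT" "e / 2"])
      show "\<exists>d>0. \<forall>f\<in>(\<lambda>t x. ?u (x, t)) ` TT. \<forall>x'\<in>\<Gamma>. dist x' x < d \<longrightarrow> dist (f x') (f x) < e'"
        if "x \<in> \<Gamma>" "0 < e'" for x e'
        using equicont[OF that] by auto
    qed (use e in auto)
    define d' where "d' = min d (e / (2 * (K + 1)))"
    have d': "d' > 0" "d' \<le> d" "d' \<le> e / (2 * (K + 1))" using d(1) e K by (auto simp: d'_def)
    have "dist (?u z') (?u z) < e" if z: "z \<in> \<Gamma> \<times> TT" "z' \<in> \<Gamma> \<times> TT" "dist z' z < d'" for z z'
    proof -
      obtain x t x' t' where eq: "z = (x, t)" "z' = (x', t')" by (cases z, cases z')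
      have "dist x' x < d'" "dist t' t < d'"
        using z(3) dist_fst_le[of z' z] dist_snd_le[of z' z] by (auto simp: eq)
      then have "dist (?u (x', t)) (?u (x, t)) < e / 2"
        using d(2)[of "\<lambda>x. ?u (x, t)" x x'] z d' by (auto simp: eq)
      moreover have "dist (?u (x', t')) (?u (x', t)) \<le> K * \<bar>t' - t\<bar>"
        using time[of x' t' t] z by (auto simp: eq dist_real_def)
      moreover have "K * \<bar>t' - t\<bar> \<le> K * (e / (2 * (K + 1)))"
        using \<open>dist t' t < d'\<close> d' K by (intro mult_left_mono) (auto simp: dist_real_def)
      moreover have "K * (e / (2 * (K + 1))) \<le> e / 2" using K e by (simp add: field_simps)
      ultimately show ?thesis unfolding eq
        using dist_triangle[of "?u (x', t')" "?u (x, t)" "?u (x', t)"] by linarith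
    qed
    then show "\<exists>d>0. \<forall>z\<in>\<Gamma> \<times> TT. \<forall>z'\<in>\<Gamma> \<times> TT. dist z' z < d \<longrightarrow> dist (?u z') (?u z) < e"
      using d'(1) by blast
  qed
qed

end

section \<open>The maximal subsolution for continuous initial data\<close>

lemma regular_C1_curve_Lipschitz:
  fixes \<gamma> :: "real \<Rightarrow> 'b::euclidean_space"
  assumes "regular_C1_curve \<gamma>"
  obtains L where "L-lipschitz_on {0..1} \<gamma>"
proof -
  obtain \<gamma>' where \<gamma>': "continuous_on {0..1} \<gamma>'"
    "\<And>s. s \<in> {0..1} \<Longrightarrow> (\<gamma> has_vector_derivative \<gamma>' s) (at s within {0..1})"
    using assms unfolding regular_C1_curve_def by blast
  have "compact (\<gamma>' ` {0..1})" using \<gamma>'(1) by (intro compact_continuous_image) auto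
  then obtain B where B: "B > 0" "\<And>s. s \<in> {0..1} \<Longrightarrow> norm (\<gamma>' s) \<le> B"
    using compact_imp_bounded[of "\<gamma>' ` {0..1}"] unfolding bounded_pos by blast
  have "B-lipschitz_on {0..1} \<gamma>"
  proof (rule bounded_derivative_imp_lipschitz)
    show "(\<gamma> has_derivative (\<lambda>h. h *\<^sub>R \<gamma>' s)) (at s within {0..1})" if "s \<in> {0..1}" for s
      using \<gamma>'(2)[OF that] by (simp add: has_vector_derivative_def)
    show "onorm (\<lambda>h. h *\<^sub>R \<gamma>' s) \<le> B" if "s \<in> {0..1}" for s
    proof (rule onorm_bound)
      show "norm (h *\<^sub>R \<gamma>' s) \<le> B * norm h" for h
        using mult_right_mono[OF B(2)[OF that], of "norm h"] by (simp add: mult.commute)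
    qed (use B in auto)
  qed (use B in auto)
  then show thesis using that by blast
qed

lemma lipschitz_on_mult_compact:
  fixes f g :: "real \<Rightarrow> real"
  assumes "L-lipschitz_on {0..1} f" "M-lipschitz_on {0..1} g"
  obtains N where "N-lipschitz_on {0..1} (\<lambda>s. f s * g s)"
proof -
  have "compact (f ` {0..1})" "compact (g ` {0..1})"
    using assms by (auto intro!: compact_continuous_image lipschitz_on_continuous_on)
  then obtain A B where A: "A > 0" "\<And>s. s \<in> {0..1} \<Longrightarrow> \<bar>f s\<bar> \<le> A" and B: "B > 0" "\<And>s. s \<in> {0..1} \<Longrightarrow> \<bar>g s\<bar> \<le> B"
    using compact_imp_bounded[of "f ` {0..1}"] compact_imp_bounded[of "g ` {0..1}"]
    unfolding bounded_pos by force
  have "(A * M + B * L)-lipschitz_on {0..1} (\<lambda>s. f s * g s)"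
  proof (rule lipschitz_onI)
    fix s t :: real assume s: "s \<in> {0..1}" "t \<in> {0..1}"
    have "f s * g s - f t * g t = f s * (g s - g t) + g t * (f s - f t)" by (simp add: algebra_simps)
    also have "\<bar>\<dots>\<bar> \<le> \<bar>f s\<bar> * \<bar>g s - g t\<bar> + \<bar>g t\<bar> * \<bar>f s - f t\<bar>"
      using abs_triangle_ineq by (metis abs_mult)
    also have "\<dots> \<le> A * (M * dist s t) + B * (L * dist s t)"
      using A B s lipschitz_onD[OF assms(1) s] lipschitz_onD[OF assms(2) s]
      by (intro add_mono mult_mono) (auto simp: dist_real_def)
    finally show "dist (f s * g s) (f t * g t) \<le> (A * M + B * L) * dist s t"
      by (simp add: dist_real_def algebra_simps)
  qed (use A B lipschitz_on_nonneg[OF assms(1)] lipschitz_on_nonneg[OF assms(2)] in auto)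
  then show thesis using that by blast
qed

lemma dist_sq_prod: "(dist y (s, t))\<^sup>2 = (fst y - s)\<^sup>2 + (snd y - t)\<^sup>2" for s t :: real
  by (cases y) (simp add: dist_Pair_Pair dist_real_def)

context flux_limited_network
begin

text \<open>A polynomial from Stone-Weierstrass on the compact network is Lipschitz along arcs,
  since the arcs themselves are Lipschitz; subtracting \<open>e / 2\<close> places it below
  \<open>g\<close>.\<close>

lemma Lipschitz_approximation:
  assumes g: "continuous_on \<Gamma> g" and e: "e > 0"
  obtains g' where "Lipschitz_on_network E g'" "\<And>x. x \<in> \<Gamma> \<Longrightarrow> g' x \<le> g x" "\<And>x. x \<in> \<Gamma> \<Longrightarrow> g x \<le> g' x + e"
proof -
  obtain p where p: "real_polynomial_function p" "\<And>x. x \<in> \<Gamma> \<Longrightarrow> \<bar>g x - p x\<bar> < e / 2"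
    using Stone_Weierstrass_real_polynomial_function[OF compact_network_set g, of "e / 2"] e by auto
  have Lip: "\<exists>L. L-lipschitz_on {0..1} (p \<circ> \<gamma>)" if \<gamma>: "\<gamma> \<in> E" for \<gamma>
    using p(1)
  proof (induction p rule: real_polynomial_function.induct)
    case (linear f)
    obtain L where "L-lipschitz_on {0..1} \<gamma>" using regular_C1_curve_Lipschitz[OF regular_arc[OF \<gamma>]] .
    moreover obtain M where "M-lipschitz_on (\<gamma> ` {0..1}) f"
      using bounded_linear.lipschitz_boundE[OF linear] by blast
    ultimately show ?case using lipschitz_on_compose by blast
  next
    case (const c)
    then show ?case using lipschitz_on_constant[of "{0..1}" c] by (auto simp: comp_def)
  next
    case (add f h)
    then show ?case using lipschitz_on_add by (fastforce simp: comp_def)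
  next
    case (mult f h)
    then obtain L M where "L-lipschitz_on {0..1} (f \<circ> \<gamma>)" "M-lipschitz_on {0..1} (h \<circ> \<gamma>)" by blast
    from lipschitz_on_mult_compact[OF this] show ?case by (auto simp: comp_def)
  qed
  show thesis
  proof (rule that[of "\<lambda>x. p x - e / 2"])
    show "Lipschitz_on_network E (\<lambda>x. p x - e / 2)"
      unfolding Lipschitz_on_network_def
    proof (intro conjI ballI)
      show "continuous_on \<Gamma> (\<lambda>x. p x - e / 2)"
        using continuous_real_polymonial_function[OF p(1)]
        by (intro continuous_intros continuous_at_imp_continuous_on) auto
      fix \<gamma> assume "\<gamma> \<in> E"
      then obtain L where "L-lipschitz_on {0..1} (p \<circ> \<gamma>)" using Lip by blast
      from lipschitz_on_diff[OF this lipschitz_on_constant[of _ "e / 2"]]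
      show "\<exists>L. L-lipschitz_on {0..1} ((\<lambda>x. p x - e / 2) \<circ> \<gamma>)" by (auto simp: comp_def)
    qed
    show "p x - e / 2 \<le> g x" "g x \<le> p x - e / 2 + e" if "x \<in> \<Gamma>" for x
      using p(2)[OF that] by linarith+
  qed
qed

lemma subsolutions_below_shift:
  assumes w: "w \<in> subsolutions_below g" and "\<And>x. x \<in> \<Gamma> \<Longrightarrow> g x \<le> g' x + e"
  shows "(\<lambda>z. w z - e) \<in> subsolutions_below g'"
proof -
  have "sub_at (along (\<lambda>z. w z - e) \<gamma>) \<gamma> s t" if "\<gamma> \<in> E" "s \<in> {0<..<1}" "t \<in> OT" for \<gamma> s t
    using sub_at_shift[of "along w \<gamma>" \<gamma> s t 0 e] w that
    unfolding subsolutions_below_def HJ_subsolution_iff by (simp add: along_def case_prod_unfold)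
  moreover have "vertex_sub_at (\<lambda>t. w (x, t) - e) x t" if "x \<in> vertices E" "t \<in> OT" for x t
    using vertex_sub_at_shift[of "\<lambda>t. w (x, t)" x t 0 e] w that
    unfolding subsolutions_below_def HJ_subsolution_iff by simp
  moreover have "continuous_on (\<Gamma> \<times> TT) (\<lambda>z. w z - e)"
    using w unfolding subsolutions_below_def HJ_subsolution_iff by (auto intro: continuous_intros)
  moreover have "w (x, T0) - e \<le> g' x" if "x \<in> \<Gamma>" for x
    using w assms(2)[OF that] that by (force simp: subsolutions_below_def)
  ultimately show ?thesis unfolding subsolutions_below_def HJ_subsolution_iff by blast
qed

text \<open>Monotonicity in the datum and compatibility with constants make the supremum depend on
  the datum nonexpansively in the uniform distance, so continuity and the initial values pass from
  Lipschitz to continuous data.\<close>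

lemma upper_envelope_approximation:
  assumes g: "continuous_on \<Gamma> g" and e: "e > 0"
  obtains g' where "Lipschitz_on_network E g'" "\<And>x. x \<in> \<Gamma> \<Longrightarrow> g' x \<le> g x" "\<And>x. x \<in> \<Gamma> \<Longrightarrow> g x \<le> g' x + e"
    "subsolutions_below g \<noteq> {}"
    "\<And>z. z \<in> \<Gamma> \<times> TT \<Longrightarrow> upper_envelope g' z \<le> upper_envelope g z"
    "\<And>z. z \<in> \<Gamma> \<times> TT \<Longrightarrow> upper_envelope g z \<le> upper_envelope g' z + e"
proof -
  obtain g' where g': "Lipschitz_on_network E g'" "\<And>x. x \<in> \<Gamma> \<Longrightarrow> g' x \<le> g x" "\<And>x. x \<in> \<Gamma> \<Longrightarrow> g x \<le> g' x + e"
    using Lipschitz_approximation[OF g e] by blast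
  obtain K where "(\<lambda>z. g' (fst z) - K * (snd z - T0)) \<in> subsolutions_below g'"
    using initial_minus_time[OF g'(1)] by blast
  then have ne': "subsolutions_below g' \<noteq> {}" by blast
  have sub: "subsolutions_below g' \<subseteq> subsolutions_below g"
    using g'(2) by (force simp: subsolutions_below_def)
  then have ne: "subsolutions_below g \<noteq> {}" using ne' by blast
  show thesis
  proof (rule that[OF g' ne])
    fix z assume z: "z \<in> \<Gamma> \<times> TT"
    show "upper_envelope g' z \<le> upper_envelope g z"
      using sub z by (intro upper_envelope_least ne' upper_envelope_upper) auto
    show "upper_envelope g z \<le> upper_envelope g' z + e"
    proof (intro upper_envelope_least ne)
      fix w assume "w \<in> subsolutions_below g"
      from upper_envelope_upper[OF subsolutions_below_shift[OF this g'(3)] z]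
      show "w z \<le> upper_envelope g' z + e" by simp
    qed
  qed
qed

lemma upper_envelope_uniformly_continuous:
  assumes g: "continuous_on \<Gamma> g"
  shows "uniformly_continuous_on (\<Gamma> \<times> TT) (upper_envelope g)"
  unfolding uniformly_continuous_on_def
proof (intro allI impI)
  fix e :: real assume e: "e > 0"
  obtain g' where g': "Lipschitz_on_network E g'"
    "\<And>z. z \<in> \<Gamma> \<times> TT \<Longrightarrow> upper_envelope g' z \<le> upper_envelope g z"
    "\<And>z. z \<in> \<Gamma> \<times> TT \<Longrightarrow> upper_envelope g z \<le> upper_envelope g' z + e / 2"
    using upper_envelope_approximation[OF g, of "e / 2"] e by (metis half_gt_zero)
  obtain d where d: "d > 0" "\<And>z z'. z \<in> \<Gamma> \<times> TT \<Longrightarrow> z' \<in> \<Gamma> \<times> TT \<Longrightarrow> dist z' z < d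
      \<Longrightarrow> dist (upper_envelope g' z') (upper_envelope g' z) < e / 2"
    using upper_envelope_Lipschitz_network(2)[OF g'(1)] e unfolding uniformly_continuous_on_def
    by (meson half_gt_zero)
  have "dist (upper_envelope g z') (upper_envelope g z) < e"
    if "z \<in> \<Gamma> \<times> TT" "z' \<in> \<Gamma> \<times> TT" "dist z' z < d" for z z'
    using d(2)[OF that] g'(2,3)[OF that(1)] g'(2,3)[OF that(2)] unfolding dist_real_def by linarith
  then show "\<exists>d>0. \<forall>z\<in>\<Gamma> \<times> TT. \<forall>z'\<in>\<Gamma> \<times> TT. dist z' z < d \<longrightarrow> dist (upper_envelope g z') (upper_envelope g z) < e"
    using d(1) by blast
qed

lemma upper_envelope_initial:
  assumes g: "continuous_on \<Gamma> g" and x: "x \<in> \<Gamma>"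
  shows "upper_envelope g (x, T0) = g x"
proof (rule antisym)
  show "upper_envelope g (x, T0) \<le> g x"
    using upper_envelope_approximation[OF g zero_less_one] upper_envelope_initial_le[OF _ x] by metis
  show "g x \<le> upper_envelope g (x, T0)"
  proof (rule field_le_epsilon)
    fix e :: real assume "e > 0"
    then obtain g' where g': "Lipschitz_on_network E g'" "g x \<le> g' x + e"
      "\<And>z. z \<in> \<Gamma> \<times> TT \<Longrightarrow> upper_envelope g' z \<le> upper_envelope g z"
      using upper_envelope_approximation[OF g, of e] x by metis
    have "upper_envelope g' (x, T0) = g' x" using upper_envelope_Lipschitz[OF g'(1)] x by metis
    then show "g x \<le> upper_envelope g (x, T0) + e" using g'(2) g'(3)[of "(x, T0)"] x T0_in by auto
  qed
qed

text \<open>If the inequality failed, the penalized test function would violate it at all nearby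
  points as well, by continuity of \<open>H\<close> and of the partial derivatives. Stability of
  supertangents then yields such a point of contact with a member of the class.\<close>

lemma upper_envelope_sub_at:
  assumes ne: "subsolutions_below g \<noteq> {}" and \<gamma>: "\<gamma> \<in> E" and s: "s \<in> {0<..<1}" and t: "t \<in> OT"
  shows "sub_at (along (upper_envelope g) \<gamma>) \<gamma> s t"
  unfolding sub_at_def
proof (intro allI impI, rule ccontr)
  fix \<psi> assume \<psi>: "supertangent UNIV (along (upper_envelope g) \<gamma>) (s, t) \<psi>"
    and neg: "\<not> partial_t \<psi> (s, t) + H \<gamma> s (partial_s \<psi> (s, t)) \<le> 0"
  define S where "S = {0<..<1::real} \<times> OT"
  define W where "W = (\<lambda>w. along w \<gamma>) ` subsolutions_below g"
  \<comment> \<open>The penalty has zero derivative at \<open>(s, t)\<close>, so the strict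
    violation there is unchanged.\<close>
  define \<psi>' where "\<psi>' = (\<lambda>y. \<psi> y + (dist y (s, t))\<^sup>2)"
  have C1: "C1_near \<psi> (s, t)" using \<psi> by (simp add: supertangent_def)
  then have C1': "C1_near \<psi>' (s, t)" unfolding \<psi>'_def by (intro C1_near_add C1_near_dist_sq)
  have eq_s: "partial_s \<psi>' (s, t) = partial_s \<psi> (s, t)"
    unfolding partial_s_def[of \<psi>'] unfolding \<psi>'_def dist_sq_prod fst_conv snd_conv
    by (rule DERIV_imp_deriv) (auto intro!: derivative_eq_intros C1_near_has_partials[OF C1])
  have eq_t: "partial_t \<psi>' (s, t) = partial_t \<psi> (s, t)"
    unfolding partial_t_def[of \<psi>'] unfolding \<psi>'_def dist_sq_prod fst_conv snd_conv
    by (rule DERIV_imp_deriv) (auto intro!: derivative_eq_intros C1_near_has_partials[OF C1])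
  note eq = eq_s eq_t
  have S: "open S" "(s, t) \<in> S" using s t by (auto simp: S_def intro!: open_Times open_times_open)
  have "((\<lambda>y. case (fst y, partial_s \<psi>' y) of (s, p) \<Rightarrow> H \<gamma> s p) \<longlongrightarrow>
      (case (s, partial_s \<psi>' (s, t)) of (s, p) \<Rightarrow> H \<gamma> s p)) (at (s, t))"
  proof (rule continuous_on_tendsto_compose[OF H_continuous[OF \<gamma>]])
    have "((\<lambda>y. (fst y, partial_s \<psi>' y)) \<longlongrightarrow> (fst (s, t), partial_s \<psi>' (s, t))) (at (s, t))"
      using C1_near_continuous_partials(1)[OF C1'] by (intro tendsto_intros) (simp add: isCont_def)
    then show "((\<lambda>y. (fst y, partial_s \<psi>' y)) \<longlongrightarrow> (s, partial_s \<psi>' (s, t))) (at (s, t))" by simp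
    show "\<forall>\<^sub>F y in at (s, t). (fst y, partial_s \<psi>' y) \<in> {0..1} \<times> UNIV"
      using near_interior[OF s t] by eventually_elim auto
  qed (use s in auto)
  then have "((\<lambda>y. partial_t \<psi>' y + H \<gamma> (fst y) (partial_s \<psi>' y)) \<longlongrightarrow> partial_t \<psi>' (s, t) + H \<gamma> s (partial_s \<psi>' (s, t))) (at (s, t))"
    using C1_near_continuous_partials(2)[OF C1'] by (intro tendsto_add) (simp_all add: isCont_def)
  then have "\<forall>\<^sub>F y in at (s, t). 0 < partial_t \<psi>' y + H \<gamma> (fst y) (partial_s \<psi>' y)"
    using neg by (intro order_tendstoD(1)) (auto simp: eq)
  then obtain d where d: "d > 0" "\<And>y. y \<noteq> (s, t) \<Longrightarrow> dist y (s, t) < d \<Longrightarrow>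
      0 < partial_t \<psi>' y + H \<gamma> (fst y) (partial_s \<psi>' y)"
    unfolding eventually_at by auto
  have d': "0 < partial_t \<psi>' y + H \<gamma> (fst y) (partial_s \<psi>' y)" if "dist y (s, t) < d" for y
    using d(2)[of y] that neg by (cases "y = (s, t)") (auto simp: eq)
  obtain w y where w: "w \<in> W" "y \<in> S" "dist y (s, t) < d" "supertangent UNIV w y \<psi>'"
  proof (rule supertangent_perturbed[OF \<psi> S d(1), of W, folded \<psi>'_def])
    show "w y \<le> along (upper_envelope g) \<gamma> y" if "w \<in> W" "y \<in> S" for w y
      using that arc_mem_network[OF \<gamma>] OT_subset
      by (auto simp: W_def S_def along_def intro!: upper_envelope_upper)
    show "continuous_on S w" if w: "w \<in> W" for w
    proof -
      obtain w' where w': "continuous_on (\<Gamma> \<times> TT) w'" "w = along w' \<gamma>"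
        using w unfolding W_def subsolutions_below_def HJ_subsolution_iff by blast
      show ?thesis unfolding w'(2)
        by (rule continuous_on_subset[OF continuous_on_along[OF w'(1) \<gamma>]])
          (use OT_subset in \<open>auto simp: S_def\<close>)
    qed
    show "\<exists>w\<in>W. along (upper_envelope g) \<gamma> (s, t) - e < w (s, t)" if "e > 0" for e
      using upper_envelope_approx[OF ne that, of "(\<gamma> s, t)"] by (auto simp: W_def along_def)
  qed
  then have "partial_t \<psi>' y + H \<gamma> (fst y) (partial_s \<psi>' y) \<le> 0"
    using \<gamma> unfolding W_def S_def subsolutions_below_def HJ_subsolution_iff sub_at_def by (cases y) auto
  with d'[OF w(3)] show False by simp
qed

text \<open>The same stability argument in the time variable alone, with continuity of
  \<open>deriv\<close> in place of that of \<open>H\<close>.\<close>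

lemma upper_envelope_vertex_sub_at:
  assumes ne: "subsolutions_below g \<noteq> {}" and x: "x \<in> vertices E" and t: "t \<in> OT"
  shows "vertex_sub_at (\<lambda>t. upper_envelope g (x, t)) x t"
  unfolding vertex_sub_at_def
proof (intro allI impI, rule ccontr)
  fix \<psi> assume \<psi>: "supertangent UNIV (\<lambda>t. upper_envelope g (x, t)) t \<psi>" and neg: "\<not> deriv \<psi> t \<le> c x"
  define W where "W = (\<lambda>w t. w (x, t)) ` subsolutions_below g"
  define \<psi>' where "\<psi>' = (\<lambda>y. \<psi> y + (dist y t)\<^sup>2)"
  have C1: "C1_near \<psi> t" using \<psi> by (simp add: supertangent_def)
  then have C1': "C1_near \<psi>' t" unfolding \<psi>'_def by (intro C1_near_add C1_near_dist_sq)
  have "(\<psi>' has_real_derivative deriv \<psi> t) (at t)"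
    unfolding \<psi>'_def dist_real_def power2_abs
    by (auto intro!: derivative_eq_intros C1_near_deriv(1)[OF C1])
  then have eq: "deriv \<psi>' t = deriv \<psi> t" by (rule DERIV_imp_deriv)
  have "(deriv \<psi>' \<longlongrightarrow> deriv \<psi>' t) (at t)"
    using C1_near_deriv(2)[OF C1'] by (simp add: isCont_def)
  then have "\<forall>\<^sub>F y in at t. c x < deriv \<psi>' y"
    using neg by (intro order_tendstoD(1)) (auto simp: eq)
  then obtain d where d: "d > 0" "\<And>y. y \<noteq> t \<Longrightarrow> dist y t < d \<Longrightarrow> c x < deriv \<psi>' y"
    unfolding eventually_at by auto
  have d': "c x < deriv \<psi>' y" if "dist y t < d" for y
    using d(2)[of y] that neg by (cases "y = t") (auto simp: eq)
  obtain w y where w: "w \<in> W" "y \<in> OT" "dist y t < d" "supertangent UNIV w y \<psi>'"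
  proof (rule supertangent_perturbed[OF \<psi> open_times_open t d(1), of W, folded \<psi>'_def])
    show "w y \<le> upper_envelope g (x, y)" if "w \<in> W" "y \<in> OT" for w y
      using that vertex_network[OF x] OT_subset by (auto simp: W_def intro!: upper_envelope_upper)
    show "continuous_on OT w" if w: "w \<in> W" for w
    proof -
      obtain w' where w': "continuous_on (\<Gamma> \<times> TT) w'" "w = (\<lambda>t. w' (x, t))"
        using w unfolding W_def subsolutions_below_def HJ_subsolution_iff by blast
      show ?thesis unfolding w'(2)
        by (rule continuous_on_compose2[OF w'(1)])
          (use vertex_network[OF x] OT_subset in \<open>auto intro!: continuous_intros\<close>)
    qed
    show "\<exists>w\<in>W. upper_envelope g (x, t) - e < w t" if "e > 0" for e
      using upper_envelope_approx[OF ne that, of "(x, t)"] by (auto simp: W_def)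
  qed
  then have "deriv \<psi>' y \<le> c x"
    using x unfolding W_def subsolutions_below_def HJ_subsolution_iff vertex_sub_at_def by auto
  with d'[OF w(3)] show False by simp
qed

lemma upper_envelope_mem:
  assumes g: "continuous_on \<Gamma> g"
  shows "upper_envelope g \<in> subsolutions_below g"
proof -
  have "subsolutions_below g \<noteq> {}" using upper_envelope_approximation[OF g zero_less_one] by metis
  then show ?thesis
    using upper_envelope_sub_at upper_envelope_vertex_sub_at upper_envelope_initial[OF g]
      uniformly_continuous_imp_continuous[OF upper_envelope_uniformly_continuous[OF g]]
    unfolding subsolutions_below_def HJ_subsolution_iff by auto
qed

section \<open>Modifying a subsolution on the arcs at a vertex\<close>

text \<open>If the arcs meet at an interior parameter \<open>s'\<close>, they are equal or reverse
  to each other, and the reverse of an arc into \<open>x\<close> starts at \<open>x\<close>, which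
  would make a loop. The value \<open>s' = 0\<close> is excluded because several arcs may share
  their far end.\<close>

lemma arcs_into_meet:
  assumes x: "x \<in> vertices E" and \<gamma>: "\<gamma> \<in> arcs_into E x" "\<gamma>' \<in> arcs_into E x"
    and s: "s \<in> {0..1}" "s' \<in> {0<..1}" "\<gamma> s = \<gamma>' s'"
  shows "\<gamma>' = \<gamma> \<and> s' = s \<or> s = 1 \<and> s' = 1"
proof -
  have E: "\<gamma> \<in> E" "\<gamma> 1 = x" "\<gamma>' \<in> E" "\<gamma>' 1 = x" using \<gamma> arcs_intoD by auto
  have loops: "\<gamma> 0 \<noteq> x" using no_loops[OF E(1)] E(2) by (simp add: pathstart_def pathfinish_def)
  show ?thesis
  proof (cases "s' = 1")
    case True
    then have "\<gamma> s = \<gamma> 1" using s E by simp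
    then show ?thesis using inj_onD[OF arc_inj[OF E(1)], of s 1] s True by auto
  next
    case False
    then have s': "s' \<in> {0<..<1}" using s by auto
    from arcs_meet[OF E(3,1) this s(1)] s(3)
    consider "\<gamma> = \<gamma>'" "s = s'" | "\<gamma> = reversepath \<gamma>'" by fastforce
    then show ?thesis
    proof cases
      case 2
      then have "\<gamma> 0 = x" using E(4) by (simp add: reversepath_def)
      then show ?thesis using loops by simp
    qed auto
  qed
qed

lemma ex_arc_into:
  assumes "x \<in> vertices E"
  obtains \<gamma> where "\<gamma> \<in> arcs_into E x"
proof -
  obtain \<gamma> where "\<gamma> \<in> E" "x = pathstart \<gamma> \<or> x = pathfinish \<gamma>"
    using assms unfolding vertices_def by blast
  then have "\<gamma> \<in> arcs_into E x \<or> reversepath \<gamma> \<in> arcs_into E x"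
    using inverse_arc[of \<gamma>] by (auto simp: arcs_into_def)
  then show thesis using that by blast
qed

text \<open>The vehicle for both supersolution proofs. Functions \<open>f \<gamma>\<close> on the
  arcs into \<open>x\<close> that agree at \<open>x\<close> and equal the supremum at the far ends
  define a function on the network; if at each point it keeps the old value or satisfies the
  subsolution inequality by itself, it competes in the class and cannot exceed the supremum.\<close>

lemma patch_below_envelope:
  fixes f :: "(real \<Rightarrow> 'a) \<Rightarrow> real \<times> real \<Rightarrow> real"
    and g :: "'a \<Rightarrow> real"
  defines "u \<equiv> upper_envelope g"
  assumes g: "continuous_on \<Gamma> g" and x: "x \<in> vertices E"
    and f0: "\<And>\<gamma> t. \<gamma> \<in> arcs_into E x \<Longrightarrow> t \<in> TT \<Longrightarrow> f \<gamma> (0, t) = u (\<gamma> 0, t)"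
    and f1: "\<And>\<gamma> t. \<gamma> \<in> arcs_into E x \<Longrightarrow> t \<in> TT \<Longrightarrow> f \<gamma> (1, t) = \<beta> t"
    and cont: "\<And>\<gamma>. \<gamma> \<in> arcs_into E x \<Longrightarrow> continuous_on ({0..1} \<times> TT) (f \<gamma>)"
    and ge: "\<And>\<gamma> s t. \<gamma> \<in> arcs_into E x \<Longrightarrow> s \<in> {0..1} \<Longrightarrow> t \<in> TT \<Longrightarrow> u (\<gamma> s, t) \<le> f \<gamma> (s, t)"
    and init: "\<And>\<gamma> s. \<gamma> \<in> arcs_into E x \<Longrightarrow> s \<in> {0..1} \<Longrightarrow> f \<gamma> (s, T0) = u (\<gamma> s, T0)"
    and sub: "\<And>\<gamma> s t. \<gamma> \<in> arcs_into E x \<Longrightarrow> s \<in> {0<..<1} \<Longrightarrow> t \<in> OT \<Longrightarrow>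
        f \<gamma> (s, t) = u (\<gamma> s, t) \<or> sub_at (f \<gamma>) \<gamma> s t"
    and vsub: "\<And>t. t \<in> OT \<Longrightarrow> \<beta> t = u (x, t) \<or> vertex_sub_at \<beta> x t"
    and \<gamma>s: "\<gamma> \<in> arcs_into E x" "s \<in> {0..1}" "t \<in> TT"
  shows "f \<gamma> (s, t) \<le> u (\<gamma> s, t)"
proof -
  have u: "u \<in> subsolutions_below g" unfolding u_def by (rule upper_envelope_mem[OF g])
  \<comment> \<open>The pair consists of an arc into \<open>x\<close> and a nonzero parameter. It is
    unique except for \<open>y = x\<close>, where all arcs give the common value
    \<open>\<beta>\<close>, so the choice made by \<open>SOME\<close> is immaterial; far ends are
    left to \<open>u\<close>.\<close>
  define star where "star = (\<lambda>y p. fst p \<in> arcs_into E x \<and> snd p \<in> {0<..1} \<and> y = fst p (snd p))"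
  define w where "w = (\<lambda>(y, t). if \<exists>p. star y p
      then f (fst (SOME p. star y p)) (snd (SOME p. star y p), t) else u (y, t))"
  have w_star: "w (\<gamma> s, t) = f \<gamma> (s, t)" if \<gamma>: "\<gamma> \<in> arcs_into E x" and s: "s \<in> {0..1}" and t: "t \<in> TT" for \<gamma> s t
  proof (cases "s = 0")
    case True
    have "\<not> star (\<gamma> s) p" for p
      using arcs_into_meet[OF x \<gamma>, of "fst p" s "snd p"] s True by (auto simp: star_def)
    then show ?thesis using f0[OF \<gamma> t] True by (simp add: w_def)
  next
    case False
    then have ex: "star (\<gamma> s) (\<gamma>, s)" using \<gamma> s by (simp add: star_def)
    define p where "p = (SOME p. star (\<gamma> s) p)"
    have p: "star (\<gamma> s) p" unfolding p_def using ex by (rule someI)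
    have "w (\<gamma> s, t) = f (fst p) (snd p, t)" using ex by (auto simp: w_def p_def)
    moreover have "fst p = \<gamma> \<and> snd p = s \<or> s = 1 \<and> snd p = 1"
      using arcs_into_meet[OF x \<gamma>, of "fst p" s "snd p"] p s by (auto simp: star_def)
    moreover have "fst p \<in> arcs_into E x" using p by (simp add: star_def)
    ultimately show ?thesis using f1 \<gamma> t by auto
  qed
  have w_off: "w (y, t) = u (y, t)" if "\<nexists>p. star y p" for y t using that by (simp add: w_def)
  obtain \<gamma>0 where \<gamma>0: "\<gamma>0 \<in> arcs_into E x" using ex_arc_into[OF x] .
  have w_x: "w (x, t) = \<beta> t" if "t \<in> TT" for t
    using w_star[OF \<gamma>0 _ that, of 1] f1[OF \<gamma>0 that] arcs_intoD[OF \<gamma>0] by auto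
  have w_ge: "u (y, t) \<le> w (y, t)" if "t \<in> TT" for y t
  proof (cases "\<exists>p. star y p")
    case True
    then obtain p where "star y p" by blast
    then have "fst p \<in> arcs_into E x" "snd p \<in> {0..1}" "y = fst p (snd p)" by (auto simp: star_def)
    then show ?thesis using w_star ge that by auto
  qed (simp add: w_off)
  \<comment> \<open>An arc on which \<open>w\<close> differs from \<open>u\<close> must end or start
    at \<open>x\<close>.\<close>
  have cases: "\<gamma> \<in> arcs_into E x \<or> reversepath \<gamma> \<in> arcs_into E x \<or> (\<forall>s\<in>{0..1}. \<forall>t. w (\<gamma> s, t) = u (\<gamma> s, t))"
    if \<gamma>: "\<gamma> \<in> E" for \<gamma>
  proof -
    have "\<gamma> \<in> arcs_into E x \<or> reversepath \<gamma> \<in> arcs_into E x" if p: "star (\<gamma> s) p" and s: "s \<in> {0..1}" for p s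
    proof -
      obtain \<gamma>' s' where \<gamma>': "\<gamma>' \<in> arcs_into E x" "s' \<in> {0<..1}" "\<gamma>' s' = \<gamma> s"
        using p unfolding star_def by auto
      have E: "\<gamma>' \<in> E" "\<gamma>' 1 = x" using arcs_intoD[OF \<gamma>'(1)] by auto
      show ?thesis
      proof (cases "s' = 1")
        case True
        then have "\<gamma> s = x" using \<gamma>' E by simp
        then have "s \<notin> {0<..<1}" using interior_not_vertex[OF \<gamma>] x by metis
        then have "s = 0 \<or> s = 1" using s by auto
        then show ?thesis using \<gamma> inverse_arc[OF \<gamma>] \<open>\<gamma> s = x\<close>
          by (auto simp: arcs_into_def pathfinish_def reversepath_def)
      next
        case False
        then have "s' \<in> {0<..<1}" using \<gamma>' by auto
        from arcs_meet[OF E(1) \<gamma> this s \<gamma>'(3)]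
        consider "\<gamma> = \<gamma>'" | "\<gamma> = reversepath \<gamma>'" by blast
        then show ?thesis using \<gamma>'(1) by cases auto
      qed
    qed
    then show ?thesis using w_off by blast
  qed
  have sub_star: "sub_at (along w \<gamma>) \<gamma> s t" if \<gamma>: "\<gamma> \<in> arcs_into E x" and s: "s \<in> {0<..<1}" and t: "t \<in> OT" for \<gamma> s t
    using sub[OF \<gamma> s t]
  proof
    have st: "s \<in> {0..1}" "t \<in> TT" using s t OT_subset by auto
    {
      assume "f \<gamma> (s, t) = u (\<gamma> s, t)"
      moreover have "sub_at (along u \<gamma>) \<gamma> s t"
        using u arcs_intoD[OF \<gamma>] s t unfolding subsolutions_below_def HJ_subsolution_iff by blast
      moreover have "\<forall>\<^sub>F y in at (s, t). along u \<gamma> y \<le> along w \<gamma> y"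
        using near_interior[OF s t] by eventually_elim (use w_ge OT_subset in \<open>auto simp: along_def\<close>)
      ultimately show ?thesis
        using w_star[OF \<gamma> st] by (rule_tac sub_at_transfer[of "along u \<gamma>"]) (auto simp: along_def)
    }
    assume "sub_at (f \<gamma>) \<gamma> s t"
    moreover have "\<forall>\<^sub>F y in at (s, t). f \<gamma> y \<le> along w \<gamma> y"
      using near_interior[OF s t] by eventually_elim (use w_star[OF \<gamma>] OT_subset in \<open>auto simp: along_def\<close>)
    ultimately show ?thesis
      using w_star[OF \<gamma> st] by (rule_tac sub_at_transfer[of "f \<gamma>"]) (auto simp: along_def)
  qed
  \<comment> \<open>An arc leaving \<open>x\<close> is treated through its reverse, on which the
    patch is prescribed.\<close>
  have along_rev: "along w \<gamma> = (\<lambda>z. along w (reversepath \<gamma>) (1 - fst z, snd z))" for \<gamma>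
    by (auto simp: along_def reversepath_def)
  have "sub_at (along w \<gamma>) \<gamma> s t" if \<gamma>: "\<gamma> \<in> E" and s: "s \<in> {0<..<1}" and t: "t \<in> OT" for \<gamma> s t
    using cases[OF \<gamma>]
  proof (elim disjE)
    assume "reversepath \<gamma> \<in> arcs_into E x"
    then have "sub_at (along w (reversepath \<gamma>)) (reversepath \<gamma>) (1 - s) t" using s t by (intro sub_star) auto
    from sub_at_reverse[OF inverse_arc[OF \<gamma>] _ this] s show ?thesis
      by (subst along_rev) (simp add: reversepath_reversepath)
  next
    assume off: "\<forall>s\<in>{0..1}. \<forall>t. w (\<gamma> s, t) = u (\<gamma> s, t)"
    have "sub_at (along u \<gamma>) \<gamma> s t"
      using u \<gamma> s t unfolding subsolutions_below_def HJ_subsolution_iff by blast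
    moreover have "\<forall>\<^sub>F y in at (s, t). along u \<gamma> y \<le> along w \<gamma> y"
      using near_interior[OF s t] by eventually_elim (use off in \<open>auto simp: along_def\<close>)
    ultimately show ?thesis
      using off s by (rule_tac sub_at_transfer[of "along u \<gamma>"]) (auto simp: along_def)
  qed (use sub_star s t in auto)
  moreover have "vertex_sub_at (\<lambda>t. w (y, t)) y t" if y: "y \<in> vertices E" and t: "t \<in> OT" for y t
  proof -
    have tT: "t \<in> TT" using t OT_subset by auto
    have u_sub: "vertex_sub_at (\<lambda>t. u (y, t)) y t"
      using u y t unfolding subsolutions_below_def HJ_subsolution_iff by blast
    have near_ge: "\<forall>\<^sub>F t in at t. u (y, t) \<le> w (y, t)"
      using near_OT[OF t] by eventually_elim (use w_ge OT_subset in auto)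
    show ?thesis
    proof (cases "y = x")
      case True
      from vsub[OF t] show ?thesis
      proof
        assume "\<beta> t = u (x, t)"
        then show ?thesis using u_sub near_ge w_x[OF tT] True
          by (rule_tac vertex_sub_at_transfer[of "\<lambda>t. u (y, t)"]) auto
      next
        assume "vertex_sub_at \<beta> x t"
        moreover have "\<forall>\<^sub>F t in at t. \<beta> t \<le> w (y, t)"
          using near_OT[OF t] by eventually_elim (use w_x OT_subset True in auto)
        ultimately show ?thesis using w_x[OF tT] True
          by (rule_tac vertex_sub_at_transfer[of \<beta>]) auto
      qed
    next
      case False
      have "\<not> star y p" for p
        using interior_not_vertex[of "fst p" "snd p"] y arcs_intoD[of "fst p" x] False
        by (cases "snd p = 1") (auto simp: star_def)
      then have "w (y, t) = u (y, t)" using w_off by blast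
      then show ?thesis using u_sub near_ge
        by (rule_tac vertex_sub_at_transfer[of "\<lambda>t. u (y, t)"]) auto
    qed
  qed
  moreover have "continuous_on (\<Gamma> \<times> TT) w"
  proof (rule continuous_on_alongI)
    fix \<gamma> assume \<gamma>: "\<gamma> \<in> E"
    have star_cont: "continuous_on ({0..1} \<times> TT) (along w \<gamma>)" if "\<gamma> \<in> arcs_into E x" for \<gamma>
      using cont[OF that] w_star[OF that] by (subst continuous_on_cong[OF refl, of _ _ "f \<gamma>"]) (auto simp: along_def)
    from cases[OF \<gamma>] show "continuous_on ({0..1} \<times> TT) (along w \<gamma>)"
    proof (elim disjE)
      assume "reversepath \<gamma> \<in> arcs_into E x"
      from star_cont[OF this]
      have "continuous_on ({0..1} \<times> TT) (\<lambda>z. along w (reversepath \<gamma>) (1 - fst z, snd z))"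
        by (rule continuous_on_compose2) (auto intro!: continuous_intros)
      then show ?thesis by (subst along_rev)
    next
      assume off: "\<forall>s\<in>{0..1}. \<forall>t. w (\<gamma> s, t) = u (\<gamma> s, t)"
      have "continuous_on ({0..1} \<times> TT) (along u \<gamma>)"
        using u continuous_on_along[OF _ \<gamma>] unfolding subsolutions_below_def HJ_subsolution_iff by blast
      then show ?thesis using off
        by (subst continuous_on_cong[OF refl, of _ _ "along u \<gamma>"]) (auto simp: along_def)
    qed (rule star_cont)
  qed
  moreover have "w (y, T0) \<le> g y" if "y \<in> \<Gamma>" for y
  proof -
    have "w (y, T0) = u (y, T0)"
    proof (cases "\<exists>p. star y p")
      case True
      then obtain p where "star y p" by blast
    then have "fst p \<in> arcs_into E x" "snd p \<in> {0..1}" "y = fst p (snd p)" by (auto simp: star_def)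
      then show ?thesis using w_star[OF _ _ T0_in] init by auto
    qed (simp add: w_off)
    then show ?thesis using u that by (auto simp: subsolutions_below_def)
  qed
  ultimately have "w \<in> subsolutions_below g"
    unfolding subsolutions_below_def HJ_subsolution_iff by blast
  then have "w (\<gamma> s, t) \<le> u (\<gamma> s, t)"
    unfolding u_def using \<gamma>s arc_mem_network arcs_intoD[OF \<gamma>s(1)] by (intro upper_envelope_upper) auto
  then show ?thesis using w_star[OF \<gamma>s] by simp
qed

end

section \<open>The maximal subsolution is a supersolution\<close>

lemma finite_small:
  fixes P :: "'b \<Rightarrow> real \<Rightarrow> bool"
  assumes "finite A" "\<And>a. a \<in> A \<Longrightarrow> \<exists>d>0. \<forall>e. 0 < e \<and> e \<le> d \<longrightarrow> P a e"
  obtains d where "d > 0" "\<And>a e. a \<in> A \<Longrightarrow> 0 < e \<Longrightarrow> e \<le> d \<Longrightarrow> P a e"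
proof -
  have "\<exists>d>0. \<forall>a\<in>A. \<forall>e. 0 < e \<and> e \<le> d \<longrightarrow> P a e"
    using assms
  proof (induction A rule: finite_induct)
    case empty
    then show ?case by (auto intro: exI[of _ 1])
  next
    case (insert a A)
    obtain d1 where "d1 > 0" "\<forall>a\<in>A. \<forall>e. 0 < e \<and> e \<le> d1 \<longrightarrow> P a e"
      using insert by auto
    moreover obtain d2 where "d2 > 0" "\<forall>e. 0 < e \<and> e \<le> d2 \<longrightarrow> P a e"
      using insert.prems[of a] by auto
    ultimately show ?case by (intro exI[of _ "min d1 d2"]) auto
  qed
  then show thesis using that by blast
qed

text \<open>Differentiability replaces the test function by its affine part minus a small cone,
  which allows bumps to be built from absolute values.\<close>

lemma subtangent_lower_bound:
  assumes \<phi>: "subtangent C w (s, t) \<phi>" and e: "e > 0"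
  obtains d where "d > 0"
    "\<And>y r. (y, r) \<in> C \<Longrightarrow> \<bar>y - s\<bar> \<le> d \<Longrightarrow> \<bar>r - t\<bar> \<le> d \<Longrightarrow>
      w (s, t) + partial_s \<phi> (s, t) * (y - s) + partial_t \<phi> (s, t) * (r - t) - e * (\<bar>y - s\<bar> + \<bar>r - t\<bar>) \<le> w (y, r)"
proof -
  have C1: "C1_near \<phi> (s, t)" using \<phi> by (simp add: subtangent_def)
  obtain d1 where d1: "d1 > 0" "\<And>y. norm (y - (s, t)) < d1 \<Longrightarrow>
      norm (\<phi> y - \<phi> (s, t) - (partial_s \<phi> (s, t) * fst (y - (s, t)) + partial_t \<phi> (s, t) * snd (y - (s, t))))
        \<le> e * norm (y - (s, t))"
    using C1_near_has_partials(3)[OF C1] e unfolding has_derivative_at_alt by blast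
  obtain d2 where d2: "d2 > 0" "\<And>y. y \<in> C \<Longrightarrow> y \<noteq> (s, t) \<Longrightarrow> dist y (s, t) < d2 \<Longrightarrow> w (s, t) - \<phi> (s, t) \<le> w y - \<phi> y"
    using \<phi> unfolding subtangent_def eventually_at by auto
  show thesis
  proof (rule that[of "min d1 d2 / 3"])
    fix y r assume C: "(y, r) \<in> C" and "\<bar>y - s\<bar> \<le> min d1 d2 / 3" "\<bar>r - t\<bar> \<le> min d1 d2 / 3"
    moreover have norm: "norm ((y, r) - (s, t)) \<le> \<bar>y - s\<bar> + \<bar>r - t\<bar>"
      using sqrt_sum_squares_le_sum_abs by (simp add: norm_Pair)
    ultimately have small: "norm ((y, r) - (s, t)) < d1" "dist (y, r) (s, t) < d2"
      using d1(1) d2(1) unfolding dist_norm by linarith+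
    have "\<phi> (s, t) + partial_s \<phi> (s, t) * (y - s) + partial_t \<phi> (s, t) * (r - t) - e * norm ((y, r) - (s, t)) \<le> \<phi> (y, r)"
      using d1(2)[OF small(1)] by (simp add: abs_le_iff)
    moreover have "w (s, t) - \<phi> (s, t) \<le> w (y, r) - \<phi> (y, r)"
      using d2(2)[OF C _ small(2)] by (cases "(y, r) = (s, t)") auto
    moreover have "e * norm ((y, r) - (s, t)) \<le> e * (\<bar>y - s\<bar> + \<bar>r - t\<bar>)"
      using norm e by (intro mult_left_mono) auto
    ultimately show "w (s, t) + partial_s \<phi> (s, t) * (y - s) + partial_t \<phi> (s, t) * (r - t)
        - e * (\<bar>y - s\<bar> + \<bar>r - t\<bar>) \<le> w (y, r)" by linarith
  qed (use d1 d2 in auto)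
qed

lemma subtangent_lower_bound_1:
  fixes w :: "real \<Rightarrow> real"
  assumes \<phi>: "subtangent UNIV w t \<phi>" and e: "e > 0"
  obtains d where "d > 0" "\<And>r. \<bar>r - t\<bar> \<le> d \<Longrightarrow> w t + deriv \<phi> t * (r - t) - e * \<bar>r - t\<bar> \<le> w r"
proof -
  have C1: "C1_near \<phi> t" using \<phi> by (simp add: subtangent_def)
  obtain d1 where d1: "d1 > 0" "\<And>y. norm (y - t) < d1 \<Longrightarrow>
      norm (\<phi> y - \<phi> t - deriv \<phi> t * (y - t)) \<le> e * norm (y - t)"
    using C1_near_deriv(1)[OF C1] e unfolding has_field_derivative_def has_derivative_at_alt by blast
  obtain d2 where d2: "d2 > 0" "\<And>y. y \<noteq> t \<Longrightarrow> dist y t < d2 \<Longrightarrow> w t - \<phi> t \<le> w y - \<phi> y"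
    using \<phi> unfolding subtangent_def eventually_at by auto
  show thesis
  proof (rule that[of "min d1 d2 / 2"])
    fix r assume "\<bar>r - t\<bar> \<le> min d1 d2 / 2"
    then have small: "norm (r - t) < d1" "dist r t < d2"
      using d1(1) d2(1) unfolding dist_real_def real_norm_def by linarith+
    have "\<phi> t + deriv \<phi> t * (r - t) - e * \<bar>r - t\<bar> \<le> \<phi> r"
      using d1(2)[OF small(1)] by (simp add: abs_le_iff)
    moreover have "w t - \<phi> t \<le> w r - \<phi> r"
      using d2(2)[OF _ small(2)] by (cases "r = t") auto
    ultimately show "w t + deriv \<phi> t * (r - t) - e * \<bar>r - t\<bar> \<le> w r" by linarith
  qed (use d1 d2 in auto)
qed

definition patch :: "('b \<Rightarrow> real) \<Rightarrow> real \<Rightarrow> ('b \<Rightarrow> real) \<Rightarrow> ('b \<Rightarrow> real) \<Rightarrow> 'b \<Rightarrow> real" where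
  "patch m N v b z = (if m z \<le> N then max (v z) (b z) else v z)"

lemma patch_ge: "v z \<le> patch m N v b z"
  by (simp add: patch_def)

lemma patch_continuous:
  fixes m :: "'b::topological_space \<Rightarrow> real"
  assumes "continuous_on D m" "continuous_on D v" "continuous_on D b"
    and "\<And>z. z \<in> D \<Longrightarrow> m z = N \<Longrightarrow> b z \<le> v z"
  shows "continuous_on D (patch m N v b)"
proof -
  have "continuous_on {z \<in> D. m z \<le> N} (\<lambda>z. max (v z) (b z))" "continuous_on {z \<in> D. N \<le> m z} v"
    using assms(2,3) by (auto intro!: continuous_intros intro: continuous_on_subset)
  moreover have "max (v z) (b z) = v z" if "z \<in> D" "m z = N" for z
    using assms(4)[OF that] by (rule max_absorb1)
  ultimately have "continuous_on D (\<lambda>z. if m z \<le> N then max (v z) (b z) else v z)"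
    by (rule continuous_on_cases_le[OF _ _ assms(1)])
  then show ?thesis by (simp add: patch_def[abs_def])
qed

text \<open>The alternative is shaped for the transfer lemmas: either the old value persists, or
  \<open>b\<close> is active at an inner point and lies below the patched function nearby. The
  condition on the edge \<open>m z = N\<close> prevents \<open>b\<close> from being active where the
  patch ends.\<close>

lemma patch_cases:
  assumes "isCont m z" "m z = N \<Longrightarrow> b z \<le> v z"
  shows "patch m N v b z = v z \<or> m z < N \<and> patch m N v b z = b z \<and> (\<forall>\<^sub>F y in at z. b y \<le> patch m N v b y)"
proof (cases "m z < N \<and> v z < b z")
  case True
  then have "\<forall>\<^sub>F y in at z. m y < N"
    using assms(1) by (intro order_tendstoD(2)) (auto simp: isCont_def)
  then have "\<forall>\<^sub>F y in at z. b y \<le> patch m N v b y"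
    by eventually_elim (simp add: patch_def)
  then show ?thesis using True by (auto simp: patch_def)
next
  case False
  then show ?thesis using assms(2) by (auto simp: patch_def max_def)
qed

context flux_limited_network
begin

text \<open>The tolerances \<open>3 * e\<close> in time and \<open>2 * e\<close> in space cover the
  deviations of the slopes of the bumps below from those of the subtangents.\<close>

lemma H_strictly_less_nearby:
  assumes \<gamma>: "\<gamma> \<in> E" and s: "s \<in> {0..1}" and less: "a + H \<gamma> s p < 0"
  obtains d where "d > 0" "\<And>e s' p'. 0 < e \<Longrightarrow> e \<le> d \<Longrightarrow> s' \<in> {0..1} \<Longrightarrow> \<bar>s' - s\<bar> \<le> e \<Longrightarrow> \<bar>p' - p\<bar> \<le> 2 * e
      \<Longrightarrow> a + 3 * e + H \<gamma> s' p' \<le> 0"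
proof -
  define m where "m = - (a + H \<gamma> s p)"
  have m: "m > 0" using less by (simp add: m_def)
  have "(s, p) \<in> {0..1} \<times> UNIV" using s by simp
  then obtain d where d: "d > 0" "\<And>y. y \<in> {0..1} \<times> UNIV \<Longrightarrow> dist y (s, p) < d \<Longrightarrow>
      dist (case y of (s, p) \<Rightarrow> H \<gamma> s p) (case (s, p) of (s, p) \<Rightarrow> H \<gamma> s p) < m / 2"
    using H_continuous[OF \<gamma>] m unfolding continuous_on_iff by (meson half_gt_zero)
  show thesis
  proof (rule that[of "min (d / 4) (m / 6)"])
    fix e s' p' assume e: "0 < e" "e \<le> min (d / 4) (m / 6)"
      and s': "s' \<in> {0..1}" "\<bar>s' - s\<bar> \<le> e" "\<bar>p' - p\<bar> \<le> 2 * e"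
    have "dist (s', p') (s, p) \<le> \<bar>s' - s\<bar> + \<bar>p' - p\<bar>"
      using sqrt_sum_squares_le_sum_abs by (simp add: dist_Pair_Pair dist_real_def)
    also have "\<dots> < d" using e s' by auto
    finally have "\<bar>H \<gamma> s' p' - H \<gamma> s p\<bar> < m / 2"
      using d(2)[of "(s', p')"] s' by (simp add: dist_real_def)
    then have "H \<gamma> s' p' - H \<gamma> s p < m / 2" by linarith
    moreover have "3 * e \<le> m / 2" using e by auto
    moreover have "a + H \<gamma> s p = - m" by (simp add: m_def)
    ultimately show "a + 3 * e + H \<gamma> s' p' \<le> 0" by linarith
  qed (use d m in auto)
qed

text \<open>Were the inequality violated, the cone \<open>b\<close> would satisfy the subsolution
  inequality near the contact point and could be inserted into the supremum, raising its value there
  by \<open>e * N\<close>.\<close>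

lemma upper_envelope_supersolution_interior:
  assumes g: "continuous_on \<Gamma> g" and \<gamma>: "\<gamma> \<in> E" and s0: "s0 \<in> {0<..<1}" and t0: "t0 \<in> OT"
    and \<phi>: "subtangent UNIV (along (upper_envelope g) \<gamma>) (s0, t0) \<phi>"
  shows "partial_t \<phi> (s0, t0) + H \<gamma> s0 (partial_s \<phi> (s0, t0)) \<ge> 0"
proof (rule ccontr)
  assume neg: "\<not> ?thesis"
  let ?u = "upper_envelope g"
  define p where "p = partial_s \<phi> (s0, t0)"
  define a where "a = partial_t \<phi> (s0, t0)"
  define u0 where "u0 = ?u (\<gamma> s0, t0)"
  have "a + H \<gamma> s0 p < 0" using neg by (simp add: a_def p_def)
  moreover have "s0 \<in> {0..1}" using s0 by auto
  ultimately obtain e where e: "e > 0" "\<And>s p'. s \<in> {0..1} \<Longrightarrow> \<bar>s - s0\<bar> \<le> e \<Longrightarrow> \<bar>p' - p\<bar> \<le> 2 * e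
      \<Longrightarrow> a + 3 * e + H \<gamma> s p' \<le> 0"
    using H_strictly_less_nearby[OF \<gamma>] by (metis order_refl)
  obtain d where d: "d > 0" "\<And>y r. \<bar>y - s0\<bar> \<le> d \<Longrightarrow> \<bar>r - t0\<bar> \<le> d \<Longrightarrow>
      u0 + p * (y - s0) + a * (r - t0) - e * (\<bar>y - s0\<bar> + \<bar>r - t0\<bar>) \<le> along ?u \<gamma> (y, r)"
    using subtangent_lower_bound[OF \<phi> e(1)] unfolding p_def a_def u0_def along_def by auto
  \<comment> \<open>Keeps the patch inside the arc and after the initial time, and within the range
    of the lower bound and of the estimate for \<open>H\<close>.\<close>
  define N where "N = Min {d, s0 / 2, (1 - s0) / 2, (t0 - T0) / 2, e}"
  have N: "N > 0" "N \<le> d" "N \<le> s0 / 2" "N \<le> (1 - s0) / 2" "N \<le> (t0 - T0) / 2" "N \<le> e"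
  proof -
    show "N > 0" unfolding N_def using d(1) s0 t0 e(1) by (subst Min_gr_iff) (auto simp: open_times_def)
  qed (unfold N_def, (rule Min_le; simp)+)
  define m where "m = (\<lambda>z::real\<times>real. max \<bar>fst z - s0\<bar> \<bar>snd z - t0\<bar>)"
  \<comment> \<open>The cone descends with slope \<open>2 * e\<close> while the lower bound for the
    supremum loses only \<open>e\<close>; the lift \<open>e * N\<close> is therefore used up on the
    edge \<open>m z = N\<close>.\<close>
  define b where "b = (\<lambda>z. u0 + e * N + p * (fst z - s0) - 2 * e * \<bar>fst z - s0\<bar> + a * (snd z - t0) - 2 * e * \<bar>snd z - t0\<bar>)"
  define F where "F = patch m N (along ?u \<gamma>) b"
  have edge: "b z \<le> along ?u \<gamma> z" if "m z = N" for z
  proof -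
    have z: "\<bar>fst z - s0\<bar> \<le> d" "\<bar>snd z - t0\<bar> \<le> d" "N \<le> \<bar>fst z - s0\<bar> + \<bar>snd z - t0\<bar>"
      using that N(2) by (auto simp: m_def max_def split: if_splits)
    have "e * N \<le> e * (\<bar>fst z - s0\<bar> + \<bar>snd z - t0\<bar>)" using z(3) e(1) by (intro mult_left_mono) auto
    then show ?thesis using d(2)[OF z(1,2)] by (simp add: b_def algebra_simps)
  qed
  have "continuous_on UNIV m" unfolding m_def by (intro continuous_intros)
  then have mcont: "isCont m z" "continuous_on A m" for z A
    by (metis UNIV_I continuous_on_eq_continuous_at open_UNIV)
      (metis \<open>continuous_on UNIV m\<close> continuous_on_subset subset_UNIV)
  have b_sub: "sub_at b \<gamma> s t" if st: "m (s, t) < N" "s \<in> {0..1}" for s t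
    unfolding sub_at_def
  proof (intro allI impI)
    fix \<psi> assume \<psi>: "supertangent UNIV b (s, t) \<psi>"
    have "p * (y - s) - 2 * e * \<bar>y - s\<bar> \<le> b (y, t) - b (s, t)" for y
    proof -
      have "e * \<bar>y - s0\<bar> \<le> e * (\<bar>s - s0\<bar> + \<bar>y - s\<bar>)" using e(1) by (intro mult_left_mono) auto
      then show ?thesis by (simp add: b_def algebra_simps)
    qed
    then have "\<bar>partial_s \<psi> (s, t) - p\<bar> \<le> 2 * e"
      by (intro supertangent_partial_s_bound[OF \<psi>] always_eventually) auto
    moreover have "partial_t \<psi> (s, t) \<le> a + 2 * e"
    proof (rule supertangent_partial_t_le[OF \<psi>])
      have "(a + 2 * e) * (y - t) \<le> b (s, y) - b (s, t)" if "y < t" for y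
      proof -
        have "e * \<bar>y - t0\<bar> \<le> e * (\<bar>t - t0\<bar> + (t - y))" using e(1) that by (intro mult_left_mono) auto
        then show ?thesis by (simp add: b_def algebra_simps)
      qed
      then show "\<forall>\<^sub>F y in at_left t. (a + 2 * e) * (y - t) \<le> b (s, y) - b (s, t)"
        by (auto simp: eventually_at_filter)
    qed
    moreover have "\<bar>s - s0\<bar> \<le> e" using st N(6) by (auto simp: m_def)
    ultimately show "partial_t \<psi> (s, t) + H \<gamma> s (partial_s \<psi> (s, t)) \<le> 0"
      using e(2)[OF st(2), of "partial_s \<psi> (s, t)"] e(1) by auto
  qed
  \<comment> \<open>The arc is regarded as an arc into its end point; the patch reaches neither end,
    so the values at vertices are unchanged.\<close>
  define x where "x = \<gamma> 1"
  have x: "x \<in> vertices E" using arc_end_vertex(2)[OF \<gamma>] by (simp add: x_def)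
  have \<gamma>x: "\<gamma> \<in> arcs_into E x" using \<gamma> by (simp add: arcs_into_def x_def pathfinish_def)
  have ucont: "continuous_on ({0..1} \<times> TT) (along ?u \<gamma>')" if "\<gamma>' \<in> arcs_into E x" for \<gamma>'
    using upper_envelope_mem[OF g] continuous_on_along arcs_intoD[OF that]
    unfolding subsolutions_below_def HJ_subsolution_iff by blast
  define f where "f = (\<lambda>\<gamma>'. if \<gamma>' = \<gamma> then F else along ?u \<gamma>')"
  have "f \<gamma> (s0, t0) \<le> ?u (\<gamma> s0, t0)"
  proof (rule patch_below_envelope[OF g x, where f = f and \<beta> = "\<lambda>t. ?u (x, t)"])
    fix \<gamma>' t assume \<gamma>': "\<gamma>' \<in> arcs_into E x" and t: "t \<in> TT"
    have "\<gamma>' 1 = x" using arcs_intoD[OF \<gamma>'] by simp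
    then show "f \<gamma>' (0, t) = ?u (\<gamma>' 0, t)" "f \<gamma>' (1, t) = ?u (x, t)"
      using N s0 by (auto simp: f_def F_def patch_def m_def along_def)
  next
    fix \<gamma>' assume \<gamma>': "\<gamma>' \<in> arcs_into E x"
    have "continuous_on ({0..1} \<times> TT) F"
      unfolding F_def
    proof (rule patch_continuous[OF mcont(2) ucont[OF \<gamma>x] _ edge])
      show "continuous_on ({0..1} \<times> TT) b" unfolding b_def by (intro continuous_intros)
    qed
    then show "continuous_on ({0..1} \<times> TT) (f \<gamma>')" using ucont[OF \<gamma>'] by (simp add: f_def)
  next
    fix \<gamma>' s t
    show "?u (\<gamma>' s, t) \<le> f \<gamma>' (s, t)"
      using patch_ge[of "along ?u \<gamma>" "(s, t)" m N b] by (simp add: f_def F_def along_def)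
  next
    fix \<gamma>' s
    have "N < t0 - T0" using N by auto
    then show "f \<gamma>' (s, T0) = ?u (\<gamma>' s, T0)"
      using N by (auto simp: f_def F_def patch_def m_def along_def)
  next
    fix \<gamma>' and s t :: real assume \<gamma>': "\<gamma>' \<in> arcs_into E x" and s: "s \<in> {0<..<1}" and t: "t \<in> OT"
    show "f \<gamma>' (s, t) = ?u (\<gamma>' s, t) \<or> sub_at (f \<gamma>') \<gamma>' s t"
    proof (cases "\<gamma>' = \<gamma>")
      case True
      have "patch m N (along ?u \<gamma>) b (s, t) = along ?u \<gamma> (s, t) \<or> m (s, t) < N \<and>
          patch m N (along ?u \<gamma>) b (s, t) = b (s, t) \<and> (\<forall>\<^sub>F y in at (s, t). b y \<le> patch m N (along ?u \<gamma>) b y)"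
        by (rule patch_cases[OF mcont(1)]) (rule edge)
      then show ?thesis
      proof (elim disjE conjE)
        assume "m (s, t) < N" "patch m N (along ?u \<gamma>) b (s, t) = b (s, t)"
          "\<forall>\<^sub>F y in at (s, t). b y \<le> patch m N (along ?u \<gamma>) b y"
        then have "sub_at F \<gamma> s t" using s
          by (intro sub_at_transfer[OF b_sub]) (auto simp: F_def)
        then show ?thesis by (simp add: f_def True)
      qed (auto simp: f_def True F_def along_def)
    qed (simp add: f_def along_def)
  qed (use \<gamma>x s0 t0 OT_subset in auto)
  moreover have "f \<gamma> (s0, t0) \<ge> u0 + e * N"
    using N(1) by (simp add: f_def F_def patch_def m_def b_def)
  moreover have "0 < e * N" using e(1) N(1) by simp
  ultimately show False by (simp add: u0_def)
qed

text \<open>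
  The constrained subtangents on the arcs at a vertex may have different slopes in time. The bump
  uses the smallest slope in a time window around \<open>t0\<close> that is much shorter than the size \<open>N\<close> of
  the patch; earlier, the individual slopes keep each branch below the subsolution, and there the
  branches are irrelevant at the vertex itself.
\<close>

lemma upper_envelope_supersolution_vertex:
  assumes g: "continuous_on \<Gamma> g" and x: "x \<in> vertices E" and t0: "t0 \<in> OT"
    and \<phi>0: "subtangent UNIV (\<lambda>t. upper_envelope g (x, t)) t0 \<phi>0" "deriv \<phi>0 t0 < c x"
  shows "\<exists>\<gamma>\<in>arcs_into E x. \<forall>\<phi>.
    subtangent ({0..1} \<times> closure OT) (along (upper_envelope g) \<gamma>) (1, t0) \<phi> \<longrightarrow>
      partial_t \<phi> (1, t0) + H \<gamma> 1 (partial_s \<phi> (1, t0)) \<ge> 0"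
proof (rule ccontr)
  let ?u = "upper_envelope g" and ?A = "arcs_into E x"
  assume "\<not> ?thesis"
  then have "\<forall>\<gamma>\<in>?A. \<exists>\<phi>. subtangent ({0..1} \<times> closure OT) (along ?u \<gamma>) (1, t0) \<phi> \<and>
      partial_t \<phi> (1, t0) + H \<gamma> 1 (partial_s \<phi> (1, t0)) < 0" by (meson not_le)
  then obtain \<Phi> where \<Phi>: "\<And>\<gamma>. \<gamma> \<in> ?A \<Longrightarrow> subtangent ({0..1} \<times> closure OT) (along ?u \<gamma>) (1, t0) (\<Phi> \<gamma>)"
    "\<And>\<gamma>. \<gamma> \<in> ?A \<Longrightarrow> partial_t (\<Phi> \<gamma>) (1, t0) + H \<gamma> 1 (partial_s (\<Phi> \<gamma>) (1, t0)) < 0"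
    by metis
  define p where "p = (\<lambda>\<gamma>. partial_s (\<Phi> \<gamma>) (1, t0))"
  define a where "a = (\<lambda>\<gamma>. partial_t (\<Phi> \<gamma>) (1, t0))"
  define u0 where "u0 = ?u (x, t0)"
  have fin: "finite ?A" using finite_arcs by (simp add: arcs_into_def)
  have A: "\<gamma> \<in> E" "\<gamma> 1 = x" if "\<gamma> \<in> ?A" for \<gamma> using arcs_intoD[OF that] by auto
  obtain \<gamma>0 where \<gamma>0: "\<gamma>0 \<in> ?A" using ex_arc_into[OF x] .
  \<comment> \<open>The bump needs one time slope at the vertex. The smallest one is at most
    \<open>deriv \<phi>0 t0 < c x\<close>, hence compatible with the flux condition, and at most
    each \<open>a \<gamma>\<close>, hence compatible with the inequality on each arc.\<close>
  define a0 where "a0 = Min (insert (deriv \<phi>0 t0) (a ` ?A))"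
  have a0: "a0 \<le> deriv \<phi>0 t0" "\<And>\<gamma>. \<gamma> \<in> ?A \<Longrightarrow> a0 \<le> a \<gamma>" "a0 = deriv \<phi>0 t0 \<or> (\<exists>\<gamma>\<in>?A. a0 = a \<gamma>)"
    using fin Min_in[of "insert (deriv \<phi>0 t0) (a ` ?A)"] by (auto simp: a0_def)
  obtain d where d: "d > 0" "\<And>\<gamma> e. \<gamma> \<in> ?A \<Longrightarrow> 0 < e \<Longrightarrow> e \<le> d \<Longrightarrow>
      \<forall>s\<in>{0..1}. \<bar>s - 1\<bar> \<le> e \<longrightarrow> a \<gamma> + 3 * e + H \<gamma> s (p \<gamma> + 2 * e) \<le> 0"
  proof (rule finite_small[OF fin])
    fix \<gamma> assume \<gamma>: "\<gamma> \<in> ?A"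
    obtain d where "d > 0" "\<And>e s' p'. 0 < e \<Longrightarrow> e \<le> d \<Longrightarrow> s' \<in> {0..1} \<Longrightarrow> \<bar>s' - 1\<bar> \<le> e \<Longrightarrow> \<bar>p' - p \<gamma>\<bar> \<le> 2 * e
        \<Longrightarrow> a \<gamma> + 3 * e + H \<gamma> s' p' \<le> 0"
      using H_strictly_less_nearby[OF A(1)[OF \<gamma>], of 1 "a \<gamma>" "p \<gamma>"] \<Phi>(2)[OF \<gamma>]
      by (auto simp: a_def p_def)
    then show "\<exists>d>0. \<forall>e. 0 < e \<and> e \<le> d \<longrightarrow> (\<forall>s\<in>{0..1}. \<bar>s - 1\<bar> \<le> e \<longrightarrow> a \<gamma> + 3 * e + H \<gamma> s (p \<gamma> + 2 * e) \<le> 0)"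
      by (intro exI[of _ d]) auto
  qed blast
  \<comment> \<open>The vertex profile will have time slopes up to \<open>a0 + 2 * e\<close>, which
    must not exceed \<open>c x\<close>.\<close>
  define e where "e = min d ((c x - deriv \<phi>0 t0) / 2)"
  have e: "e > 0" "e \<le> d" "a0 + 2 * e \<le> c x"
  proof -
    have "e \<le> (c x - deriv \<phi>0 t0) / 2" unfolding e_def by (rule min.cobounded2)
    then have "2 * e \<le> c x - deriv \<phi>0 t0" by simp
    then show "a0 + 2 * e \<le> c x" using a0(1) by linarith
  qed (use d(1) \<phi>0(2) in \<open>auto simp: e_def\<close>)
  have He: "a \<gamma> + 3 * e + H \<gamma> s (p \<gamma> + 2 * e) \<le> 0" if "\<gamma> \<in> ?A" "s \<in> {0..1}" "\<bar>s - 1\<bar> \<le> e" for \<gamma> s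
    using d(2)[OF that(1) e(1,2)] that by blast
  obtain h where h: "h > 0" "t0 + h \<in> TT" using times_from_later[of t0 T0 T1] t0 OT_subset by blast
  have window: "t \<in> OT" if "T0 < t" "t \<le> t0 + h" for t
    using that times_from_le[OF h(2), of t] by (auto simp: times_from_def open_times_def)
  obtain d' where d': "d' > 0" "\<And>\<gamma> N. \<gamma> \<in> ?A \<Longrightarrow> 0 < N \<Longrightarrow> N \<le> d' \<Longrightarrow>
      \<forall>s\<in>{0..1}. \<forall>t\<in>OT. 1 - s \<le> 8 * N \<and> \<bar>t - t0\<bar> \<le> N \<longrightarrow>
        u0 + p \<gamma> * (s - 1) + a \<gamma> * (t - t0) - e * ((1 - s) + \<bar>t - t0\<bar>) \<le> ?u (\<gamma> s, t)"
  proof (rule finite_small[OF fin])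
    fix \<gamma> assume \<gamma>: "\<gamma> \<in> ?A"
    obtain d where d: "d > 0" "\<And>y r. (y, r) \<in> {0..1} \<times> closure OT \<Longrightarrow> \<bar>y - 1\<bar> \<le> d \<Longrightarrow> \<bar>r - t0\<bar> \<le> d \<Longrightarrow>
        along ?u \<gamma> (1, t0) + p \<gamma> * (y - 1) + a \<gamma> * (r - t0) - e * (\<bar>y - 1\<bar> + \<bar>r - t0\<bar>) \<le> along ?u \<gamma> (y, r)"
      using subtangent_lower_bound[OF \<Phi>(1)[OF \<gamma>] e(1)] unfolding p_def a_def by blast
    show "\<exists>d>0. \<forall>N. 0 < N \<and> N \<le> d \<longrightarrow> (\<forall>s\<in>{0..1}. \<forall>t\<in>OT. 1 - s \<le> 8 * N \<and> \<bar>t - t0\<bar> \<le> N \<longrightarrow>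
        u0 + p \<gamma> * (s - 1) + a \<gamma> * (t - t0) - e * ((1 - s) + \<bar>t - t0\<bar>) \<le> ?u (\<gamma> s, t))"
    proof (intro exI[of _ "d / 8"] conjI allI impI ballI)
      fix N s t assume N: "0 < N \<and> N \<le> d / 8" and s: "s \<in> {0..1}" "t \<in> OT" "1 - s \<le> 8 * N \<and> \<bar>t - t0\<bar> \<le> N"
      have "(s, t) \<in> {0..1} \<times> closure OT" using s closure_subset by blast
      moreover have "\<bar>s - 1\<bar> \<le> d" "\<bar>t - t0\<bar> \<le> d" "\<bar>s - 1\<bar> = 1 - s" using N s by auto
      ultimately show "u0 + p \<gamma> * (s - 1) + a \<gamma> * (t - t0) - e * ((1 - s) + \<bar>t - t0\<bar>) \<le> ?u (\<gamma> s, t)"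
        using d(2)[of s t] A(2)[OF \<gamma>] by (simp add: along_def u0_def)
    qed (use d in auto)
  qed blast
  obtain d1 where d1: "d1 > 0" "\<And>r. \<bar>r - t0\<bar> \<le> d1 \<Longrightarrow> u0 + deriv \<phi>0 t0 * (r - t0) - e * \<bar>r - t0\<bar> \<le> ?u (x, r)"
    using subtangent_lower_bound_1[OF \<phi>0(1) e(1)] unfolding u0_def by blast
  \<comment> \<open>The patch extends \<open>8 * N\<close> in space: \<open>e / 8\<close> gives
    \<open>\<bar>s - 1\<bar> \<le> e\<close> there, and \<open>1 / 16\<close> keeps it away from the
    far end of each arc.\<close>
  define N where "N = Min {d', d1, e / 8, 1 / 16, h, (t0 - T0) / 2}"
  have N: "N > 0" "N \<le> d'" "N \<le> d1" "N \<le> e / 8" "N \<le> 1 / 16" "N \<le> h" "N \<le> (t0 - T0) / 2"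
  proof -
    show "N > 0" unfolding N_def using d'(1) d1(1) e(1) h(1) t0 by (subst Min_gr_iff) (auto simp: open_times_def)
  qed (unfold N_def, (rule Min_le; simp)+)
  have NT: "N < t0 - T0" using N(1,7) by simp
  have inOT: "t \<in> OT" if "\<bar>t - t0\<bar> \<le> N" for t
    using that N(6) NT by (intro window) linarith+
  have lower: "u0 + p \<gamma> * (s - 1) + a \<gamma> * (t - t0) - e * ((1 - s) + \<bar>t - t0\<bar>) \<le> ?u (\<gamma> s, t)"
    if "\<gamma> \<in> ?A" "s \<in> {0..1}" "1 - s \<le> 8 * N" "\<bar>t - t0\<bar> \<le> N" for \<gamma> s t
    using d'(2)[OF that(1) N(1,2)] that inOT by blast
  \<comment> \<open>Whichever slope attains the minimum \<open>a0\<close> comes with a lower bound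
    for the supremum at \<open>x\<close>.\<close>
  have vlower: "u0 + a0 * (t - t0) - e * \<bar>t - t0\<bar> \<le> ?u (x, t)" if t: "\<bar>t - t0\<bar> \<le> N" for t
  proof -
    have "u0 + deriv \<phi>0 t0 * (t - t0) - e * \<bar>t - t0\<bar> \<le> ?u (x, t)" using t N(3) by (intro d1(2)) simp
    moreover have "u0 + a \<gamma> * (t - t0) - e * \<bar>t - t0\<bar> \<le> ?u (x, t)" if "\<gamma> \<in> ?A" for \<gamma>
      using lower[OF that, of 1 t] t N(1) A(2)[OF that] by simp
    ultimately show ?thesis using a0(3) by blast
  qed
  define D where "D = Max (insert 0 ((\<lambda>\<gamma>. a \<gamma> - a0) ` ?A))"
  have D: "0 \<le> D" "\<And>\<gamma>. \<gamma> \<in> ?A \<Longrightarrow> a \<gamma> - a0 \<le> D" using fin by (auto simp: D_def)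
  \<comment> \<open>Makes the vertex profile \<open>l\<close> lie below the individual line of each
    arc as long as \<open>\<bar>\<tau>\<bar> \<le> \<delta> / e\<close>; \<open>D\<close> bounds the
    differences of the time slopes.\<close>
  define \<delta> where "\<delta> = e * N / ((D + e) / e + 1)"
  have k: "(D + e) / e + 1 > 1" using D(1) e(1) by (simp add: field_simps)
  have \<delta>: "\<delta> > 0" "\<delta> \<le> e * N" "(D + e) * (\<delta> / e) + \<delta> \<le> e * N"
  proof -
    have pos: "e * N > 0" using e(1) N(1) by simp
    then show "\<delta> > 0" using k unfolding \<delta>_def by (intro divide_pos_pos) auto
    have eq: "\<delta> * ((D + e) / e + 1) = e * N" using k by (simp add: \<delta>_def)
    then show "(D + e) * (\<delta> / e) + \<delta> \<le> e * N" by (simp add: algebra_simps)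
    have "\<delta> * 1 \<le> \<delta> * ((D + e) / e + 1)" using \<open>\<delta> > 0\<close> k by (intro mult_left_mono) auto
    then show "\<delta> \<le> e * N" using eq by simp
  qed
  \<comment> \<open>The lower bound at the vertex loses only \<open>e * \<bar>\<tau>\<bar>\<close>,
    so \<open>u0 + l \<tau>\<close> exceeds it only for
    \<open>\<bar>\<tau>\<bar> < \<delta> / e\<close>.\<close>
  define l where "l = (\<lambda>\<tau>. a0 * \<tau> - 2 * e * \<bar>\<tau>\<bar> + \<delta>)"
  \<comment> \<open>The line with slope \<open>a \<gamma> + 3 * e\<close> keeps the bump below the
    supremum at the early edge \<open>\<tau> = - N\<close>, where \<open>l\<close> with its smaller
    slope may be too high; at the late edge \<open>l\<close> does so.\<close>
  define M where "M = (\<lambda>\<gamma> \<tau>. min (l \<tau>) ((a \<gamma> + 3 * e) * \<tau> + e * N))"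
  define b where "b = (\<lambda>\<gamma> z. u0 + (p \<gamma> + 2 * e) * (fst z - 1) + M \<gamma> (snd z - t0))"
  \<comment> \<open>With the factor 8, the extra space slope gains \<open>8 * e * N\<close> at the
    inner edge, more than the \<open>5 * e * N\<close> that the time terms can cost.\<close>
  define m where "m = (\<lambda>z::real\<times>real. max (\<bar>fst z - 1\<bar> / 8) \<bar>snd z - t0\<bar>)"
  define f where "f = (\<lambda>\<gamma>. patch m N (along ?u \<gamma>) (b \<gamma>))"
  define \<beta> where "\<beta> = patch (\<lambda>t. \<bar>t - t0\<bar>) N (\<lambda>t. ?u (x, t)) (\<lambda>t. u0 + l (t - t0))"
  have l_step: "(a0 + 2 * e) * (y - t) \<le> l y - l t" if "y < t" for y t
  proof -
    have "e * \<bar>y\<bar> \<le> e * (\<bar>t\<bar> + (t - y))" using e(1) that by (intro mult_left_mono) auto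
    then show ?thesis by (simp add: l_def algebra_simps)
  qed
  have M_step: "(a \<gamma> + 3 * e) * (y - t) \<le> M \<gamma> y - M \<gamma> t" if "y < t" "\<gamma> \<in> ?A" for y t \<gamma>
  proof -
    have "(a \<gamma> + 3 * e) * (y - t) \<le> (a0 + 2 * e) * (y - t)"
      using that(1) a0(2)[OF that(2)] e(1) by (intro mult_right_mono_neg) auto
    then have "(a \<gamma> + 3 * e) * (y - t) \<le> l y - l t" using l_step[OF that(1)] by linarith
    moreover have "(a \<gamma> + 3 * e) * (y - t) = ((a \<gamma> + 3 * e) * y + e * N) - ((a \<gamma> + 3 * e) * t + e * N)"
      by (simp add: algebra_simps)
    ultimately show ?thesis unfolding M_def by linarith
  qed
  have "continuous_on UNIV m" unfolding m_def by (intro continuous_intros) auto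
  then have mcont: "isCont m z" "continuous_on B m" for z B
    by (metis UNIV_I continuous_on_eq_continuous_at open_UNIV)
      (metis \<open>continuous_on UNIV m\<close> continuous_on_subset subset_UNIV)
  have bcont: "continuous_on B (b \<gamma>)" for B \<gamma>
    unfolding b_def M_def l_def by (intro continuous_intros)
  have edge: "b \<gamma> z \<le> along ?u \<gamma> z" if \<gamma>: "\<gamma> \<in> ?A" and z: "z \<in> {0..1} \<times> UNIV" "m z = N" for \<gamma> z
  proof -
    obtain s t where z_eq: "z = (s, t)" by (cases z)
    define \<sigma> where "\<sigma> = 1 - s"
    define \<tau> where "\<tau> = t - t0"
    have s: "s \<in> {0..1}" using z by (simp add: z_eq)
    have m_eq: "max (\<sigma> / 8) \<bar>\<tau>\<bar> = N" using z s by (simp add: m_def z_eq \<sigma>_def \<tau>_def)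
    then have \<sigma>: "0 \<le> \<sigma>" "\<sigma> \<le> 8 * N" "\<bar>\<tau>\<bar> \<le> N" "\<sigma> = 8 * N \<or> \<tau> = N \<or> \<tau> = - N"
      using s by (auto simp: \<sigma>_def max_def split: if_splits)
    have "u0 + p \<gamma> * (s - 1) + a \<gamma> * \<tau> - e * (\<sigma> + \<bar>\<tau>\<bar>) \<le> ?u (\<gamma> s, t)"
      using lower[OF \<gamma> s, of t] \<sigma> by (simp add: \<sigma>_def \<tau>_def)
    moreover have "b \<gamma> (s, t) = u0 + p \<gamma> * (s - 1) - 2 * (e * \<sigma>) + M \<gamma> \<tau>"
      by (simp add: b_def \<sigma>_def \<tau>_def algebra_simps)
    moreover have "- (2 * (e * \<sigma>)) + M \<gamma> \<tau> \<le> a \<gamma> * \<tau> - e * (\<sigma> + \<bar>\<tau>\<bar>)"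
    proof -
      have e\<sigma>: "0 \<le> e * \<sigma>" using e(1) \<sigma>(1) by simp
      have eN: "0 < e * N" using e(1) N(1) by simp
      have eq: "e * \<bar>\<tau>\<bar> = \<bar>e * \<tau>\<bar>" using e(1) by (simp add: abs_mult)
      have "e * \<bar>\<tau>\<bar> \<le> e * N" using e(1) \<sigma>(3) by (intro mult_left_mono) auto
      then have e\<tau>: "e * \<tau> \<le> e * N" "- (e * \<tau>) \<le> e * N" "\<bar>e * \<tau>\<bar> \<le> e * N" "e * \<bar>\<tau>\<bar> = \<bar>e * \<tau>\<bar>"
        unfolding eq by auto
      have M1: "M \<gamma> \<tau> \<le> a \<gamma> * \<tau> + 3 * (e * \<tau>) + e * N" by (simp add: M_def algebra_simps)
      from \<sigma>(4) show ?thesis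
      proof (elim disjE)
        assume "\<sigma> = 8 * N"
        then have "e * \<sigma> = 8 * (e * N)" by simp
        then show ?thesis using M1 e\<tau>(1,3) eN unfolding distrib_left eq by linarith
      next
        assume \<tau>: "\<tau> = N"
        have "M \<gamma> \<tau> \<le> a0 * N - 2 * (e * N) + \<delta>" using N(1) by (simp add: M_def l_def \<tau>)
        moreover have "a0 * N \<le> a \<gamma> * N" using a0(2)[OF \<gamma>] N(1) by (intro mult_right_mono) auto
        moreover have "\<bar>\<tau>\<bar> = N" using N(1) \<tau> by simp
        ultimately show ?thesis using \<delta>(2) e\<sigma> unfolding \<open>\<bar>\<tau>\<bar> = N\<close> distrib_left \<tau> by linarith
      next
        assume \<tau>: "\<tau> = - N"
        then show ?thesis using M1 e\<sigma> eN N(1) by (simp add: \<tau> algebra_simps)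
      qed
    qed
    ultimately show ?thesis by (simp add: z_eq along_def)
  qed
  \<comment> \<open>For \<open>\<bar>\<tau>\<bar> \<le> \<delta> / e\<close> the minimum
    \<open>M \<gamma> \<tau>\<close> is \<open>l \<tau>\<close>; for larger
    \<open>\<bar>\<tau>\<bar>\<close> in the patch, both \<open>u0 + M \<gamma> \<tau>\<close> and
    \<open>u0 + l \<tau>\<close> are at most the supremum at the vertex. So the patches on all arcs
    agree at \<open>x\<close>.\<close>
  have f1: "f \<gamma> (1, t) = \<beta> t" if \<gamma>: "\<gamma> \<in> ?A" for \<gamma> t
  proof (cases "\<bar>t - t0\<bar> \<le> N")
    case True
    define \<tau> where "\<tau> = t - t0"
    have b1: "b \<gamma> (1, t) = u0 + M \<gamma> \<tau>" by (simp add: b_def \<tau>_def)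
    have "max (?u (x, t)) (u0 + M \<gamma> \<tau>) = max (?u (x, t)) (u0 + l \<tau>)"
    proof (cases "\<bar>\<tau>\<bar> \<le> \<delta> / e")
      case close: True
      have "l \<tau> \<le> (a \<gamma> + 3 * e) * \<tau> + e * N"
      proof (cases "0 \<le> \<tau>")
        case True
        have "a0 * \<tau> \<le> a \<gamma> * \<tau>" using a0(2)[OF \<gamma>] True by (intro mult_right_mono)
        moreover have "0 \<le> e * \<tau>" using e(1) True by simp
        ultimately show ?thesis using \<delta>(2) True by (simp add: l_def algebra_simps)
      next
        case False
        have "(a \<gamma> - a0 + e) * \<bar>\<tau>\<bar> \<le> (D + e) * (\<delta> / e)"
          using D(1) D(2)[OF \<gamma>] a0(2)[OF \<gamma>] e(1) close by (intro mult_mono) auto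
        then have "(a \<gamma> - a0 + e) * (- \<tau>) + \<delta> \<le> e * N" using \<delta>(3) False by simp
        then show ?thesis using False by (simp add: l_def algebra_simps)
      qed
      then show ?thesis by (simp add: M_def min_absorb1)
    next
      case False
      then have "\<delta> < e * \<bar>\<tau>\<bar>" using e(1) by (simp add: field_simps)
      then have "u0 + l \<tau> \<le> ?u (x, t)" using vlower[OF True] by (simp add: l_def \<tau>_def)
      moreover have "M \<gamma> \<tau> \<le> l \<tau>" by (simp add: M_def)
      ultimately show ?thesis by simp
    qed
    then show ?thesis using True A(2)[OF \<gamma>] N(1) b1
      by (simp add: f_def \<beta>_def patch_def m_def along_def \<tau>_def)
  next
    case False
    then show ?thesis using A(2)[OF \<gamma>] by (simp add: f_def \<beta>_def patch_def m_def along_def)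
  qed
  have "f \<gamma>0 (1, t0) \<le> ?u (\<gamma>0 1, t0)"
  proof (rule patch_below_envelope[OF g x, where f = f and \<beta> = \<beta>])
    show "f \<gamma> (0, t) = ?u (\<gamma> 0, t)" for \<gamma> t
      using N(5) by (simp add: f_def patch_def m_def along_def)
    show "f \<gamma> (1, t) = \<beta> t" if "\<gamma> \<in> ?A" for \<gamma> t by (rule f1[OF that])
    show "continuous_on ({0..1} \<times> TT) (f \<gamma>)" if \<gamma>: "\<gamma> \<in> ?A" for \<gamma>
      unfolding f_def
    proof (rule patch_continuous[OF mcont(2) _ bcont])
      show "continuous_on ({0..1} \<times> TT) (along ?u \<gamma>)"
        using upper_envelope_mem[OF g] continuous_on_along A(1)[OF \<gamma>]
        unfolding subsolutions_below_def HJ_subsolution_iff by blast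
    qed (use edge[OF \<gamma>] in auto)
    show "?u (\<gamma> s, t) \<le> f \<gamma> (s, t)" for \<gamma> s t
      using patch_ge[of "along ?u \<gamma>" "(s, t)"] by (simp add: f_def along_def)
    show "f \<gamma> (s, T0) = ?u (\<gamma> s, T0)" for \<gamma> s
    proof -
      have "N < \<bar>T0 - t0\<bar>" using NT by linarith
      then show ?thesis by (simp add: f_def patch_def m_def along_def)
    qed
    show "f \<gamma> (s, t) = ?u (\<gamma> s, t) \<or> sub_at (f \<gamma>) \<gamma> s t"
      if \<gamma>: "\<gamma> \<in> ?A" and s: "s \<in> {0<..<1}" and t: "t \<in> OT" for \<gamma> s t
    proof -
      have "patch m N (along ?u \<gamma>) (b \<gamma>) (s, t) = along ?u \<gamma> (s, t) \<or> m (s, t) < N \<and>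
          patch m N (along ?u \<gamma>) (b \<gamma>) (s, t) = b \<gamma> (s, t) \<and>
          (\<forall>\<^sub>F y in at (s, t). b \<gamma> y \<le> patch m N (along ?u \<gamma>) (b \<gamma>) y)"
        by (rule patch_cases[OF mcont(1)]) (use s in \<open>auto intro!: edge[OF \<gamma>]\<close>)
      then show ?thesis
      proof (elim disjE conjE)
        assume *: "m (s, t) < N" "patch m N (along ?u \<gamma>) (b \<gamma>) (s, t) = b \<gamma> (s, t)"
          "\<forall>\<^sub>F y in at (s, t). b \<gamma> y \<le> patch m N (along ?u \<gamma>) (b \<gamma>) y"
        have "sub_at (b \<gamma>) \<gamma> s t"
          unfolding sub_at_def
        proof (intro allI impI)
          fix \<psi> assume \<psi>: "supertangent UNIV (b \<gamma>) (s, t) \<psi>"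
          have "\<bar>partial_s \<psi> (s, t) - (p \<gamma> + 2 * e)\<bar> \<le> 0"
            by (intro supertangent_partial_s_bound[OF \<psi>] always_eventually) (simp add: b_def algebra_simps)
          then have "partial_s \<psi> (s, t) = p \<gamma> + 2 * e" by simp
          moreover have "partial_t \<psi> (s, t) \<le> a \<gamma> + 3 * e"
          proof (rule supertangent_partial_t_le[OF \<psi>])
            have "(a \<gamma> + 3 * e) * (y - t) \<le> b \<gamma> (s, y) - b \<gamma> (s, t)" if "y < t" for y
              using M_step[of "y - t0" "t - t0" \<gamma>] that \<gamma> by (simp add: b_def)
            then show "\<forall>\<^sub>F y in at_left t. (a \<gamma> + 3 * e) * (y - t) \<le> b \<gamma> (s, y) - b \<gamma> (s, t)"
              by (auto simp: eventually_at_filter)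
          qed
          moreover have "\<bar>s - 1\<bar> \<le> e" using *(1) N(4) by (auto simp: m_def)
          then have "a \<gamma> + 3 * e + H \<gamma> s (p \<gamma> + 2 * e) \<le> 0" using He[OF \<gamma>] s by auto
          ultimately show "partial_t \<psi> (s, t) + H \<gamma> s (partial_s \<psi> (s, t)) \<le> 0" by simp
        qed
        then have "sub_at (f \<gamma>) \<gamma> s t"
          using *(2,3) by (rule_tac sub_at_transfer[of "b \<gamma>"]) (auto simp: f_def)
        then show ?thesis ..
      qed (auto simp: f_def along_def)
    qed
    show "\<beta> t = ?u (x, t) \<or> vertex_sub_at \<beta> x t" if "t \<in> OT" for t
    proof -
      have "isCont (\<lambda>t. \<bar>t - t0\<bar>) t" by (intro continuous_intros)
      moreover have "u0 + l (t - t0) \<le> ?u (x, t)" if "\<bar>t - t0\<bar> = N"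
        using vlower[of t] \<delta>(2) that by (simp add: l_def)
      ultimately have "\<beta> t = ?u (x, t) \<or> \<bar>t - t0\<bar> < N \<and> \<beta> t = u0 + l (t - t0) \<and>
          (\<forall>\<^sub>F y in at t. u0 + l (y - t0) \<le> \<beta> y)"
        unfolding \<beta>_def by (rule patch_cases)
      moreover have "vertex_sub_at (\<lambda>t. u0 + l (t - t0)) x t"
        unfolding vertex_sub_at_def
      proof (intro allI impI)
        fix \<psi> assume \<psi>: "supertangent UNIV (\<lambda>t. u0 + l (t - t0)) t \<psi>"
        have "deriv \<psi> t \<le> a0 + 2 * e"
        proof (rule touching_derivative_le[of \<psi> _ t "\<lambda>t. u0 + l (t - t0)"])
          show "\<forall>\<^sub>F y in at_left t. (a0 + 2 * e) * (y - t) \<le> (u0 + l (y - t0)) - (u0 + l (t - t0))"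
            using l_step[of "_ - t0" "t - t0"] by (auto simp: eventually_at_filter)
        qed (use \<psi> C1_near_deriv(1) in \<open>auto simp: supertangent_def\<close>)
        then show "deriv \<psi> t \<le> c x" using e(3) by simp
      qed
      ultimately show ?thesis
        using vertex_sub_at_transfer[of "\<lambda>t. u0 + l (t - t0)" x t \<beta>] by auto
    qed
  qed (use \<gamma>0 t0 OT_subset in auto)
  moreover have "u0 + \<delta> \<le> f \<gamma>0 (1, t0)"
    using f1[OF \<gamma>0, of t0] N(1) by (simp add: \<beta>_def patch_def l_def)
  ultimately show False using \<delta>(1) A(2)[OF \<gamma>0] by (simp add: u0_def)
qed

section \<open>Existence and uniqueness\<close>

lemma upper_envelope_solution:
  assumes g: "continuous_on \<Gamma> g"
  shows "HJ_solution_from E H c T0 T1 g (upper_envelope g)"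
proof -
  have sub: "HJ_subsolution E H c T0 T1 (upper_envelope g)"
    using upper_envelope_mem[OF g] by (simp add: subsolutions_below_def)
  then have cont: "continuous_on (\<Gamma> \<times> TT) (upper_envelope g)" unfolding HJ_subsolution_iff by blast
  have "continuous_on ({0<..<1} \<times> OT) (along (upper_envelope g) \<gamma>)" if "\<gamma> \<in> E" for \<gamma>
    by (rule continuous_on_subset[OF continuous_on_along[OF cont that]]) (use OT_subset in auto)
  then have "HJ_supersolution E H c T0 T1 (upper_envelope g)"
    unfolding HJ_supersolution_def viscosity_supersolution_def
    using cont upper_envelope_supersolution_interior[OF g] upper_envelope_supersolution_vertex[OF g]
    by blast
  then show ?thesis
    using sub upper_envelope_initial[OF g] by (simp add: HJ_solution_from_def HJ_solution_def)
qed

text \<open>Comparison enters through a Lipschitz datum \<open>g'\<close> within \<open>e\<close>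
  below \<open>g\<close>, whose supremum has the Lipschitz bound in space that comparison
  requires.\<close>

lemma solution_unique:
  assumes g: "continuous_on \<Gamma> g" and v: "HJ_solution_from E H c T0 T1 g v" and z: "z \<in> \<Gamma> \<times> TT"
  shows "v z = upper_envelope g z"
proof (rule antisym)
  have "v \<in> subsolutions_below g"
    using v by (auto simp: subsolutions_below_def HJ_solution_from_def HJ_solution_def)
  then show "v z \<le> upper_envelope g z" using z by (rule upper_envelope_upper)
  show "upper_envelope g z \<le> v z"
  proof (rule field_le_epsilon)
    fix e :: real assume e: "e > 0"
    obtain g' where g': "Lipschitz_on_network E g'" "\<And>x. x \<in> \<Gamma> \<Longrightarrow> g' x \<le> g x"
      "\<And>z. z \<in> \<Gamma> \<times> TT \<Longrightarrow> upper_envelope g z \<le> upper_envelope g' z + e"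
      by (rule upper_envelope_approximation[OF g e]) (rule that)
    have g'_cont: "continuous_on \<Gamma> g'" using g'(1) by (simp add: Lipschitz_on_network_def)
    have "upper_envelope g' (fst z, snd z) \<le> v (fst z, snd z)"
    proof (rule comparison[OF flux])
      show "HJ_subsolution E H c T0 T1 (upper_envelope g')"
        using upper_envelope_mem[OF g'_cont] by (simp add: subsolutions_below_def)
      show "HJ_supersolution E H c T0 T1 v" using v by (simp add: HJ_solution_from_def HJ_solution_def)
      show "\<exists>M. \<forall>s\<in>{0..1}. \<forall>s'\<in>{0..1}. \<forall>t\<in>TT.
          \<bar>upper_envelope g' (\<gamma> s, t) - upper_envelope g' (\<gamma> s', t)\<bar> \<le> M * \<bar>s - s'\<bar>" if "\<gamma> \<in> E" for \<gamma>
      proof -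
        obtain K where "\<And>\<gamma>. \<gamma> \<in> E \<Longrightarrow> \<exists>M\<ge>0. \<forall>s\<in>{0..1}. \<forall>s'\<in>{0..1}. \<forall>t\<in>TT.
          \<bar>upper_envelope g' (\<gamma> s, t) - upper_envelope g' (\<gamma> s', t)\<bar> \<le> M * \<bar>s - s'\<bar>"
          by (rule upper_envelope_Lipschitz[OF g'(1)]) (rule that)
        from this[OF that] show ?thesis by auto
      qed
      show "upper_envelope g' (x, T0) \<le> v (x, T0)" if "x \<in> \<Gamma>" for x
        using upper_envelope_initial[OF g'_cont that] g'(2)[OF that] v that
        by (simp add: HJ_solution_from_def)
    qed (use z in auto)
    then show "upper_envelope g z \<le> v z + e" using g'(3)[OF z] by simp
  qed
qed

end

theorem proposition7p8:
  fixes E :: "(real \<Rightarrow> 'a::euclidean_space) set"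
    and H :: "(real \<Rightarrow> 'a) \<Rightarrow> real \<Rightarrow> real \<Rightarrow> real"
    and c :: "'a \<Rightarrow> real"
    and g :: "'a \<Rightarrow> real"
    and T0 :: real and T1 :: ereal
  assumes "0 \<le> T0" and "ereal T0 < T1"
    and "network_hamiltonians E H"
    and "continuous_on (network_set E) g"
    and "flux_limiter E H c"
  shows "\<exists>u :: 'a \<times> real \<Rightarrow> real.
           HJ_solution_from E H c T0 T1 g u \<and>
           (\<forall>v. HJ_solution_from E H c T0 T1 g v \<longrightarrow>
              (\<forall>z\<in>network_set E \<times> times_from T0 T1. v z = u z)) \<and>
           uniformly_continuous_on (network_set E \<times> times_from T0 T1) u \<and>
           (Lipschitz_on_network E g \<longrightarrow> Lipschitz_on_network_times E T0 T1 u)"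
proof -
  interpret flux_limited_network E H c T0 T1
    by (rule flux_limited_network.intro[OF assms(3)]) (unfold_locales, fact+)
  show ?thesis
    using upper_envelope_solution[OF assms(4)] solution_unique[OF assms(4)]
      upper_envelope_uniformly_continuous[OF assms(4)] upper_envelope_Lipschitz_network(1)
    by blast
qed

end
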